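(* Let $\mathcal T$ be a suspended idempotent complete category, linear over a ring $\mathsf k$, with a triangulation of order $2$ (respectively, of order $3$). Suppose a finite group $G$ acts on $\mathcal T$ by exact autoequivalences and $|G|$ is invertible in $\mathsf k$. Equip $\mathcal T^G$ with the shift functor $(F,(\theta_g))[1]=(F[1],(\theta_g[1]))$ (acting on morphisms as the shift of $\mathcal T$), and call a triangle in $\mathcal T^G$ distinguished if and only if its image in $\mathcal T$ under the forgetful functor $(F,(\theta_g))\mapsto F$ is distinguished. Then this makes $\mathcal T^G$ a triangulated category of order $2$ (respectively, of order $3$).
   Context: **Suspended categories.** A suspended category is an additive category with an automorphism $X\mapsto X[1]$, called the shift. A functor $F$ between suspended categories is stable if $F(-)[1]=F(-[1])$. A triangle is a diagram $X\to Y\to Z\to X[1]$ with base $X\to Y$. A functor between suspended categories with classes of distinguished triangles is exact if it is stable and preserves distinguished triangles. A category is idempotent complete if every idempotent endomorphism splits. **Axioms** for a suspended category with a class of distinguished triangles: - (1a) Any triangle isomorphic to a distinguished one is distinguished. (1b) $0\to X\xrightarrow{1_X}X\to0$ is distinguished for every $X$. (1c) $X\xrightarrow{f}Y\xrightarrow{g}Z\xrightarrow{h}X[1]$ is distinguished iff $Y\xrightarrow{g}Z\xrightarrow{h}X[1]\xrightarrow{-f[1]}Y[1]$ is. - (2) Any morphism $f\colon X\to Y$ fits into a distinguished triangle $X\xrightarrow{f}Y\to Z\to X[1]$. - (3) For any two distinguished triangles, any morphism of their bases extends to a morphism of triangles. - (4) Any pair $X\xrightarrow{f}Y\xrightarrow{g}Z$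 is the base of a distinguished octahedron. - (5) For any two distinguished octahedra, any morphism between their bases extends to a morphism of octahedra. An octahedron with base $X\xrightarrow{f}Y\xrightarrow{g}Z$ consists of four triangles $X\xrightarrow{f}Y\xrightarrow{x}Z'\to X[1]$, $X\xrightarrow{gf}Z\to Y'\to X[1]$, $Y\xrightarrow{g}Z\to X'\xrightarrow{r}Y[1]$, $Z'\to Y'\to X'\to Z'[1]$ such that: $Y\xrightarrow{x}Z'\to Y'$ equals $Y\xrightarrow{g}Z\to Y'$; $Z'\to Y'\to X[1]$ equals $Z'\to X[1]$; $Z\to Y'\to X'$ equals $Z\to X'$; $X'\to Z'[1]$ equals $x[1]\circ r$; and $Y'\to X[1]\xrightarrow{f[1]}Y[1]$ equals $Y'\to X'\xrightarrow{r}Y[1]$. It is distinguished if all four triangles are distinguished. A morphism of octahedra (or triangles) is a morphism of diagrams compatible with the shift. The category has a triangulation of order $2$ (is triangulated of order $2$) if it satisfies (1)–(3); it has a triangulation of order $3$ (is triangulated of order $3$) if it satisfies (1)–(5). **Group actions.** A (right) action of a finite group $G$ on a $\mathsf k$-linear category $\mathcal C$ consists of autoequivalences $\phi_g\colon\mathcal C\to\mathcal C$ ($g\in G$) and isomorphisms of functors $\varepsilon_{g,h}\colon\phi_g\phi_h\to\phi_{hg}$ with $\varepsilon_{f,hg}\circ\phi_f(\varepsilon_{g,h})=\varepsilon_{gf,h}\circ(\varepsilon_{f,g}\phi_h)$ for all $f,g,h$. The action is by exact autoequivalences if all $\phi_g$ are exact. A $G$-equivariant object is a pair $(F,(\theta_g)_{g\in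 G})$ with $F\in\mathcal C$ and isomorphisms $\theta_g\colon F\to\phi_g(F)$ such that $\theta_{hg}=\varepsilon_{g,h}\circ\phi_g(\theta_h)\circ\theta_g$. A morphism $(F_1,(\theta^1_g))\to(F_2,(\theta^2_g))$ is a morphism $f\colon F_1\to F_2$ with $\theta^2_g f=\phi_g(f)\theta^1_g$ for all $g$. The category of these is $\mathcal C^G$.
   Formalization: The isomorphisms ε_{g,h} are additionally assumed to commute with the shift, ε_{g,h}(X[1]) = ε_{g,h}(X)[1]; this holds exactly when (F[1],(θ_g[1])) is equivariant for every (F,(θ_g)), so that the shift on T^G is defined. *)

theory Defs
  imports "HOL-Algebra.Module" "HOL-Algebra.Coset"
begin

section \<open>Linear categories\<close>

text \<open>
  Each hom-set is a HOL-Algebra record of type \<^typ>\<open>('k, 'm) module\<close>, of which only the carrier,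
  the addition, the zero and the scalar multiplication are used; the fields \<open>mult\<close> and \<open>one\<close>
  inherited from rings are irrelevant.  Composition and functors act on bare arrows, and
  different hom-sets are allowed to overlap.  (Every small category has such a presentation:
  let arrows remember their source and target.)  Thus an arrow of the equivariant category
  below is literally an arrow of the original category.
\<close>

record ('k, 'o, 'm) cat =
  Obj :: "'o set"
  Hom :: "'o \<Rightarrow> 'o \<Rightarrow> ('k, 'm) module"
  Comp :: "'m \<Rightarrow> 'm \<Rightarrow> 'm" (infixl "\<star>\<index>" 70)
  Ident :: "'o \<Rightarrow> 'm"

definition arr :: "('k, 'o, 'm) cat \<Rightarrow> 'o \<Rightarrow> 'o \<Rightarrow> 'm \<Rightarrow> bool" where
  "arr C X Y f \<longleftrightarrow> X \<in> Obj C \<and> Y \<in> Obj C \<and> f \<in> carrier (Hom C X Y)"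

locale category =
  fixes C :: "('k, 'o, 'm) cat" (structure)
  assumes Ident_arr: "X \<in> Obj C \<Longrightarrow> arr C X X (Ident C X)"
    and Comp_arr: "\<lbrakk>arr C X Y f; arr C Y Z g\<rbrakk> \<Longrightarrow> arr C X Z (g \<star> f)"
    and Comp_Ident: "arr C X Y f \<Longrightarrow> f \<star> Ident C X = f"
    and Ident_Comp: "arr C X Y f \<Longrightarrow> Ident C Y \<star> f = f"
    and Comp_assoc:
      "\<lbrakk>arr C X Y f; arr C Y Z g; arr C Z W h\<rbrakk> \<Longrightarrow> (h \<star> g) \<star> f = h \<star> (g \<star> f)"

locale preadditive_category = category C for C :: "('k, 'o, 'm) cat" (structure) +
  assumes Hom_abelian_group: "\<lbrakk>X \<in> Obj C; Y \<in> Obj C\<rbrakk> \<Longrightarrow> abelian_group (Hom C X Y)"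
    and Comp_add_left: "\<lbrakk>arr C X Y f; arr C Y Z g; arr C Y Z g'\<rbrakk> \<Longrightarrow>
      (g \<oplus>\<^bsub>Hom C Y Z\<^esub> g') \<star> f = (g \<star> f) \<oplus>\<^bsub>Hom C X Z\<^esub> (g' \<star> f)"
    and Comp_add_right: "\<lbrakk>arr C X Y f; arr C X Y f'; arr C Y Z g\<rbrakk> \<Longrightarrow>
      g \<star> (f \<oplus>\<^bsub>Hom C X Y\<^esub> f') = (g \<star> f) \<oplus>\<^bsub>Hom C X Z\<^esub> (g \<star> f')"

text \<open>
  The locale \<^locale>\<open>module\<close> requires a commutative ring of scalars, hence the module laws are
  spelled out here; for commutative scalars they say that the hom-sets are modules in the sense
  of that locale.
\<close>

locale linear_category = preadditive_category C + ring k
  for k :: "('k, 'r) ring_scheme" and C :: "('k, 'o, 'm) cat" (structure) +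
  assumes smult_arr: "\<lbrakk>a \<in> carrier k; arr C X Y f\<rbrakk> \<Longrightarrow> arr C X Y (a \<odot>\<^bsub>Hom C X Y\<^esub> f)"
    and smult_add_scalar: "\<lbrakk>a \<in> carrier k; b \<in> carrier k; arr C X Y f\<rbrakk> \<Longrightarrow>
      (a \<oplus>\<^bsub>k\<^esub> b) \<odot>\<^bsub>Hom C X Y\<^esub> f
        = (a \<odot>\<^bsub>Hom C X Y\<^esub> f) \<oplus>\<^bsub>Hom C X Y\<^esub> (b \<odot>\<^bsub>Hom C X Y\<^esub> f)"
    and smult_add_arr: "\<lbrakk>a \<in> carrier k; arr C X Y f; arr C X Y f'\<rbrakk> \<Longrightarrow>
      a \<odot>\<^bsub>Hom C X Y\<^esub> (f \<oplus>\<^bsub>Hom C X Y\<^esub> f')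
        = (a \<odot>\<^bsub>Hom C X Y\<^esub> f) \<oplus>\<^bsub>Hom C X Y\<^esub> (a \<odot>\<^bsub>Hom C X Y\<^esub> f')"
    and smult_mult: "\<lbrakk>a \<in> carrier k; b \<in> carrier k; arr C X Y f\<rbrakk> \<Longrightarrow>
      (a \<otimes>\<^bsub>k\<^esub> b) \<odot>\<^bsub>Hom C X Y\<^esub> f = a \<odot>\<^bsub>Hom C X Y\<^esub> (b \<odot>\<^bsub>Hom C X Y\<^esub> f)"
    and smult_one: "arr C X Y f \<Longrightarrow> \<one>\<^bsub>k\<^esub> \<odot>\<^bsub>Hom C X Y\<^esub> f = f"
    and smult_Comp_left: "\<lbrakk>a \<in> carrier k; arr C X Y f; arr C Y Z g\<rbrakk> \<Longrightarrow>
      (a \<odot>\<^bsub>Hom C Y Z\<^esub> g) \<star> f = a \<odot>\<^bsub>Hom C X Z\<^esub> (g \<star> f)"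
    and smult_Comp_right: "\<lbrakk>a \<in> carrier k; arr C X Y f; arr C Y Z g\<rbrakk> \<Longrightarrow>
      g \<star> (a \<odot>\<^bsub>Hom C X Y\<^esub> f) = a \<odot>\<^bsub>Hom C X Z\<^esub> (g \<star> f)"

definition zero_object :: "('k, 'o, 'm) cat \<Rightarrow> 'o \<Rightarrow> bool" where
  "zero_object C N \<longleftrightarrow> N \<in> Obj C \<and>
     (\<forall>X\<in>Obj C. (\<exists>!f. arr C X N f) \<and> (\<exists>!f. arr C N X f))"

locale additive_category = preadditive_category C for C :: "('k, 'o, 'm) cat" (structure) +
  assumes ex_zero_object: "\<exists>N. zero_object C N"
    and ex_biproduct: "\<lbrakk>X \<in> Obj C; Y \<in> Obj C\<rbrakk> \<Longrightarrow>
      \<exists>W i j p q. arr C X W i \<and> arr C Y W j \<and> arr C W X p \<and> arr C W Y q \<and>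
        p \<star> i = Ident C X \<and> q \<star> j = Ident C Y \<and>
        q \<star> i = \<zero>\<^bsub>Hom C X Y\<^esub> \<and> p \<star> j = \<zero>\<^bsub>Hom C Y X\<^esub> \<and>
        (i \<star> p) \<oplus>\<^bsub>Hom C W W\<^esub> (j \<star> q) = Ident C W"

definition idempotent_complete :: "('k, 'o, 'm) cat \<Rightarrow> bool" where
  "idempotent_complete C \<longleftrightarrow>
     (\<forall>X e. arr C X X e \<and> e \<star>\<^bsub>C\<^esub> e = e \<longrightarrow>
       (\<exists>Y p i. arr C X Y p \<and> arr C Y X i \<and> p \<star>\<^bsub>C\<^esub> i = Ident C Y \<and> i \<star>\<^bsub>C\<^esub> p = e))"

definition iso_arr :: "('k, 'o, 'm) cat \<Rightarrow> 'o \<Rightarrow> 'o \<Rightarrow> 'm \<Rightarrow> bool" where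
  "iso_arr C X Y f \<longleftrightarrow> arr C X Y f \<and>
     (\<exists>g. arr C Y X g \<and> g \<star>\<^bsub>C\<^esub> f = Ident C X \<and> f \<star>\<^bsub>C\<^esub> g = Ident C Y)"


section \<open>Functors\<close>

record ('o, 'm, 'p, 'n) cfunctor =
  fobj :: "'o \<Rightarrow> 'p"
  fmor :: "'m \<Rightarrow> 'n"

definition is_functor ::
  "('k, 'o, 'm) cat \<Rightarrow> ('l, 'p, 'n) cat \<Rightarrow> ('o, 'm, 'p, 'n) cfunctor \<Rightarrow> bool" where
  "is_functor C D F \<longleftrightarrow>
     (\<forall>X\<in>Obj C. fobj F X \<in> Obj D) \<and>
     (\<forall>X Y f. arr C X Y f \<longrightarrow> arr D (fobj F X) (fobj F Y) (fmor F f)) \<and>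
     (\<forall>X\<in>Obj C. fmor F (Ident C X) = Ident D (fobj F X)) \<and>
     (\<forall>X Y Z f g. arr C X Y f \<and> arr C Y Z g \<longrightarrow>
        fmor F (g \<star>\<^bsub>C\<^esub> f) = fmor F g \<star>\<^bsub>D\<^esub> fmor F f)"

definition id_functor :: "('o, 'm, 'o, 'm) cfunctor" where
  "id_functor = \<lparr>fobj = (\<lambda>X. X), fmor = (\<lambda>f. f)\<rparr>"

definition comp_functor ::
  "('p, 'n, 'q, 'l) cfunctor \<Rightarrow> ('o, 'm, 'p, 'n) cfunctor \<Rightarrow> ('o, 'm, 'q, 'l) cfunctor"
  (infixl "\<circ>\<^sub>F" 75) where
  "F \<circ>\<^sub>F H = \<lparr>fobj = (\<lambda>X. fobj F (fobj H X)), fmor = (\<lambda>f. fmor F (fmor H f))\<rparr>"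

definition natural_iso ::
  "('k, 'o, 'm) cat \<Rightarrow> ('l, 'p, 'n) cat \<Rightarrow> ('o, 'm, 'p, 'n) cfunctor \<Rightarrow>
   ('o, 'm, 'p, 'n) cfunctor \<Rightarrow> ('o \<Rightarrow> 'n) \<Rightarrow> bool" where
  "natural_iso C D F H \<eta> \<longleftrightarrow>
     (\<forall>X\<in>Obj C. iso_arr D (fobj F X) (fobj H X) (\<eta> X)) \<and>
     (\<forall>X Y f. arr C X Y f \<longrightarrow> \<eta> Y \<star>\<^bsub>D\<^esub> fmor F f = fmor H f \<star>\<^bsub>D\<^esub> \<eta> X)"

text \<open>
  No additivity is demanded of functors: equivalences and automorphisms of additive categories
  are automatically additive.
\<close>

definition autoequivalence :: "('k, 'o, 'm) cat \<Rightarrow> ('o, 'm, 'o, 'm) cfunctor \<Rightarrow> bool" where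
  "autoequivalence C F \<longleftrightarrow> is_functor C C F \<and>
     (\<exists>H \<eta> \<zeta>. is_functor C C H \<and>
        natural_iso C C (H \<circ>\<^sub>F F) id_functor \<eta> \<and> natural_iso C C (F \<circ>\<^sub>F H) id_functor \<zeta>)"

definition automorphism :: "('k, 'o, 'm) cat \<Rightarrow> ('o, 'm, 'o, 'm) cfunctor \<Rightarrow> bool" where
  "automorphism C F \<longleftrightarrow> is_functor C C F \<and>
     (\<exists>H. is_functor C C H \<and>
        (\<forall>X\<in>Obj C. fobj H (fobj F X) = X \<and> fobj F (fobj H X) = X) \<and>
        (\<forall>X Y f. arr C X Y f \<longrightarrow> fmor H (fmor F f) = f \<and> fmor F (fmor H f) = f))"


section \<open>Suspended categories, triangles and octahedra\<close>

locale suspended_category = additive_category C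
  for C :: "('k, 'o, 'm) cat" (structure) and S :: "('o, 'm, 'o, 'm) cfunctor" +
  assumes shift_automorphism: "automorphism C S"

text \<open>\<open>Triangle X Y Z f g h\<close> stands for the diagram \<open>X --f--> Y --g--> Z --h--> X[1]\<close>.\<close>

datatype ('o, 'm) triangle = Triangle 'o 'o 'o 'm 'm 'm

fun is_triangle ::
  "('k, 'o, 'm) cat \<Rightarrow> ('o, 'm, 'o, 'm) cfunctor \<Rightarrow> ('o, 'm) triangle \<Rightarrow> bool" where
  "is_triangle C S (Triangle X Y Z f g h) \<longleftrightarrow>
     arr C X Y f \<and> arr C Y Z g \<and> arr C Z (fobj S X) h"

definition functor_triangle ::
  "('o, 'm, 'p, 'n) cfunctor \<Rightarrow> ('o, 'm) triangle \<Rightarrow> ('p, 'n) triangle" where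
  "functor_triangle F = map_triangle (fobj F) (fmor F)"

fun rotate_triangle ::
  "('k, 'o, 'm) cat \<Rightarrow> ('o, 'm, 'o, 'm) cfunctor \<Rightarrow> ('o, 'm) triangle \<Rightarrow> ('o, 'm) triangle" where
  "rotate_triangle C S (Triangle X Y Z f g h) =
     Triangle Y Z (fobj S X) g h (\<ominus>\<^bsub>Hom C (fobj S X) (fobj S Y)\<^esub> fmor S f)"

fun triangle_base_mor ::
  "('k, 'o, 'm) cat \<Rightarrow> ('o, 'm) triangle \<Rightarrow> ('o, 'm) triangle \<Rightarrow> 'm \<Rightarrow> 'm \<Rightarrow> bool" where
  "triangle_base_mor C (Triangle X Y Z f g h) (Triangle X' Y' Z' f' g' h') a b \<longleftrightarrow>
     arr C X X' a \<and> arr C Y Y' b \<and> b \<star>\<^bsub>C\<^esub> f = f' \<star>\<^bsub>C\<^esub> a"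

fun triangle_mor ::
  "('k, 'o, 'm) cat \<Rightarrow> ('o, 'm, 'o, 'm) cfunctor \<Rightarrow>
   ('o, 'm) triangle \<Rightarrow> ('o, 'm) triangle \<Rightarrow> 'm \<Rightarrow> 'm \<Rightarrow> 'm \<Rightarrow> bool" where
  "triangle_mor C S (Triangle X Y Z f g h) (Triangle X' Y' Z' f' g' h') a b c \<longleftrightarrow>
     arr C X X' a \<and> arr C Y Y' b \<and> arr C Z Z' c \<and>
     b \<star>\<^bsub>C\<^esub> f = f' \<star>\<^bsub>C\<^esub> a \<and> c \<star>\<^bsub>C\<^esub> g = g' \<star>\<^bsub>C\<^esub> b \<and> fmor S a \<star>\<^bsub>C\<^esub> h = h' \<star>\<^bsub>C\<^esub> c"

fun triangle_iso ::
  "('k, 'o, 'm) cat \<Rightarrow> ('o, 'm, 'o, 'm) cfunctor \<Rightarrow>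
   ('o, 'm) triangle \<Rightarrow> ('o, 'm) triangle \<Rightarrow> bool" where
  "triangle_iso C S (Triangle X Y Z f g h) (Triangle X' Y' Z' f' g' h') \<longleftrightarrow>
     (\<exists>a b c. iso_arr C X X' a \<and> iso_arr C Y Y' b \<and> iso_arr C Z Z' c \<and>
        triangle_mor C S (Triangle X Y Z f g h) (Triangle X' Y' Z' f' g' h') a b c)"

datatype ('o, 'm) octahedron =
  Octahedron "('o, 'm) triangle" "('o, 'm) triangle" "('o, 'm) triangle" "('o, 'm) triangle"

text \<open>
  In the following definition \<open>X1\<close>, \<open>Y1\<close>, \<open>Z1\<close> are the vertices usually called \<open>X'\<close>, \<open>Y'\<close>, \<open>Z'\<close>.
  The primed variables are the repeated occurrences of vertices in the four triangles.
\<close>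

fun is_octahedron ::
  "('k, 'o, 'm) cat \<Rightarrow> ('o, 'm, 'o, 'm) cfunctor \<Rightarrow> ('o, 'm) octahedron \<Rightarrow> bool" where
  "is_octahedron C S (Octahedron
       (Triangle X Y Z1 f x x1) (Triangle X' Z Y1 k y y1)
       (Triangle Y' Z' X1 g z r) (Triangle Z1' Y1' X1' u v w)) \<longleftrightarrow>
     is_triangle C S (Triangle X Y Z1 f x x1) \<and> is_triangle C S (Triangle X' Z Y1 k y y1) \<and>
     is_triangle C S (Triangle Y' Z' X1 g z r) \<and> is_triangle C S (Triangle Z1' Y1' X1' u v w) \<and>
     X' = X \<and> Y' = Y \<and> Z' = Z \<and> X1' = X1 \<and> Y1' = Y1 \<and> Z1' = Z1 \<and>
     k = g \<star>\<^bsub>C\<^esub> f \<and>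
     u \<star>\<^bsub>C\<^esub> x = y \<star>\<^bsub>C\<^esub> g \<and>
     y1 \<star>\<^bsub>C\<^esub> u = x1 \<and>
     v \<star>\<^bsub>C\<^esub> y = z \<and>
     w = fmor S x \<star>\<^bsub>C\<^esub> r \<and>
     fmor S f \<star>\<^bsub>C\<^esub> y1 = r \<star>\<^bsub>C\<^esub> v"

fun octahedron_triangles :: "('o, 'm) octahedron \<Rightarrow> ('o, 'm) triangle set" where
  "octahedron_triangles (Octahedron t1 t2 t3 t4) = {t1, t2, t3, t4}"

definition distinguished_octahedron ::
  "('k, 'o, 'm) cat \<Rightarrow> ('o, 'm, 'o, 'm) cfunctor \<Rightarrow> ('o, 'm) triangle set \<Rightarrow>
   ('o, 'm) octahedron \<Rightarrow> bool" where
  "distinguished_octahedron C S \<Delta> t \<longleftrightarrow> is_octahedron C S t \<and> octahedron_triangles t \<subseteq> \<Delta>"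

text \<open>The base \<open>(X, Y, Z, f, g)\<close> is read off from the first and the third triangle.\<close>

fun octahedron_base :: "('o, 'm) octahedron \<Rightarrow> 'o \<times> 'o \<times> 'o \<times> 'm \<times> 'm" where
  "octahedron_base (Octahedron (Triangle X Y _ f _ _) _ (Triangle _ Z _ g _ _) _) = (X, Y, Z, f, g)"

definition octahedron_base_mor ::
  "('k, 'o, 'm) cat \<Rightarrow> ('o, 'm) octahedron \<Rightarrow> ('o, 'm) octahedron \<Rightarrow> 'm \<Rightarrow> 'm \<Rightarrow> 'm \<Rightarrow> bool" where
  "octahedron_base_mor C s t a b c \<longleftrightarrow>
     (case (octahedron_base s, octahedron_base t) of
        ((X, Y, Z, f, g), (X', Y', Z', f', g')) \<Rightarrow>
          arr C X X' a \<and> arr C Y Y' b \<and> arr C Z Z' c \<and>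
          b \<star>\<^bsub>C\<^esub> f = f' \<star>\<^bsub>C\<^esub> a \<and> c \<star>\<^bsub>C\<^esub> g = g' \<star>\<^bsub>C\<^esub> b)"

text \<open>
  The arrows of an octahedron are exactly those of its four triangles, so compatibility with all
  of them means being a morphism on each of the triangles.  The arguments \<open>a b c a1 b1 c1\<close> are the
  components at \<open>X\<close>, \<open>Y\<close>, \<open>Z\<close>, \<open>X'\<close>, \<open>Y'\<close>, \<open>Z'\<close>.
\<close>

fun octahedron_mor ::
  "('k, 'o, 'm) cat \<Rightarrow> ('o, 'm, 'o, 'm) cfunctor \<Rightarrow> ('o, 'm) octahedron \<Rightarrow> ('o, 'm) octahedron \<Rightarrow>
   'm \<Rightarrow> 'm \<Rightarrow> 'm \<Rightarrow> 'm \<Rightarrow> 'm \<Rightarrow> 'm \<Rightarrow> bool" where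
  "octahedron_mor C S (Octahedron s1 s2 s3 s4) (Octahedron t1 t2 t3 t4) a b c a1 b1 c1 \<longleftrightarrow>
     triangle_mor C S s1 t1 a b c1 \<and> triangle_mor C S s2 t2 a c b1 \<and>
     triangle_mor C S s3 t3 b c a1 \<and> triangle_mor C S s4 t4 c1 b1 a1"


section \<open>Triangulations of order 2 and 3\<close>

locale triangulated_order2 = suspended_category C S
  for C :: "('k, 'o, 'm) cat" (structure) and S :: "('o, 'm, 'o, 'm) cfunctor" +
  fixes \<Delta> :: "('o, 'm) triangle set"
  assumes distinguished_is_triangle: "t \<in> \<Delta> \<Longrightarrow> is_triangle C S t"
    and axiom_1a: "\<lbrakk>is_triangle C S s; t \<in> \<Delta>; triangle_iso C S s t\<rbrakk> \<Longrightarrow> s \<in> \<Delta>"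
    and axiom_1b: "\<lbrakk>zero_object C N; X \<in> Obj C\<rbrakk> \<Longrightarrow>
      Triangle N X X \<zero>\<^bsub>Hom C N X\<^esub> (Ident C X) \<zero>\<^bsub>Hom C X (fobj S N)\<^esub> \<in> \<Delta>"
    and axiom_1c: "is_triangle C S t \<Longrightarrow> t \<in> \<Delta> \<longleftrightarrow> rotate_triangle C S t \<in> \<Delta>"
    and axiom_2: "arr C X Y f \<Longrightarrow> \<exists>Z g h. Triangle X Y Z f g h \<in> \<Delta>"
    and axiom_3: "\<lbrakk>s \<in> \<Delta>; t \<in> \<Delta>; triangle_base_mor C s t a b\<rbrakk> \<Longrightarrow>
      \<exists>c. triangle_mor C S s t a b c"

locale triangulated_order3 = triangulated_order2 C S \<Delta>
  for C :: "('k, 'o, 'm) cat" (structure) and S :: "('o, 'm, 'o, 'm) cfunctor"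
    and \<Delta> :: "('o, 'm) triangle set" +
  assumes axiom_4: "\<lbrakk>arr C X Y f; arr C Y Z g\<rbrakk> \<Longrightarrow>
      \<exists>t. distinguished_octahedron C S \<Delta> t \<and> octahedron_base t = (X, Y, Z, f, g)"
    and axiom_5: "\<lbrakk>distinguished_octahedron C S \<Delta> s; distinguished_octahedron C S \<Delta> t;
      octahedron_base_mor C s t a b c\<rbrakk> \<Longrightarrow> \<exists>a1 b1 c1. octahedron_mor C S s t a b c a1 b1 c1"

text \<open>Exactness is stated for endofunctors, the only case needed.  Stability is on the nose.\<close>

definition stable_functor ::
  "('k, 'o, 'm) cat \<Rightarrow> ('o, 'm, 'o, 'm) cfunctor \<Rightarrow> ('o, 'm, 'o, 'm) cfunctor \<Rightarrow> bool" where
  "stable_functor C S F \<longleftrightarrow>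
     (\<forall>X\<in>Obj C. fobj S (fobj F X) = fobj F (fobj S X)) \<and>
     (\<forall>X Y f. arr C X Y f \<longrightarrow> fmor S (fmor F f) = fmor F (fmor S f))"

definition exact_functor ::
  "('k, 'o, 'm) cat \<Rightarrow> ('o, 'm, 'o, 'm) cfunctor \<Rightarrow> ('o, 'm) triangle set \<Rightarrow>
   ('o, 'm, 'o, 'm) cfunctor \<Rightarrow> bool" where
  "exact_functor C S \<Delta> F \<longleftrightarrow>
     is_functor C C F \<and> stable_functor C S F \<and> (\<forall>t\<in>\<Delta>. functor_triangle F t \<in> \<Delta>)"


section \<open>Group actions and equivariant objects\<close>

text \<open>The component at \<open>X\<close> of the isomorphism \<open>\<epsilon>\<^sub>g\<^sub>,\<^sub>h\<close> is \<open>\<epsilon> g h X\<close>.\<close>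

locale right_action = category C + group G
  for C :: "('k, 'o, 'm) cat" (structure) and G :: "('g, 'b) monoid_scheme" (structure) +
  fixes \<phi> :: "'g \<Rightarrow> ('o, 'm, 'o, 'm) cfunctor"
    and \<epsilon> :: "'g \<Rightarrow> 'g \<Rightarrow> 'o \<Rightarrow> 'm"
  assumes action_autoequivalence: "g \<in> carrier G \<Longrightarrow> autoequivalence C (\<phi> g)"
    and action_natural_iso: "\<lbrakk>g \<in> carrier G; h \<in> carrier G\<rbrakk> \<Longrightarrow>
      natural_iso C C (\<phi> g \<circ>\<^sub>F \<phi> h) (\<phi> (h \<otimes>\<^bsub>G\<^esub> g)) (\<epsilon> g h)"
    and action_cocycle:
      "\<lbrakk>f \<in> carrier G; g \<in> carrier G; h \<in> carrier G; X \<in> Obj C\<rbrakk> \<Longrightarrow>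
        \<epsilon> f (h \<otimes>\<^bsub>G\<^esub> g) X \<star>\<^bsub>C\<^esub> fmor (\<phi> f) (\<epsilon> g h X)
          = \<epsilon> (g \<otimes>\<^bsub>G\<^esub> f) h X \<star>\<^bsub>C\<^esub> \<epsilon> f g (fobj (\<phi> h) X)"

text \<open>
  The isomorphisms of stable functors \<open>\<epsilon>\<^sub>g\<^sub>,\<^sub>h\<close> have to commute with the shift: for an equivariant
  object \<open>(F, \<theta>)\<close> the pair \<open>(F[1], \<theta>[1])\<close> is again equivariant if and only if
  \<open>\<epsilon>\<^sub>g\<^sub>,\<^sub>h(F[1]) = \<epsilon>\<^sub>g\<^sub>,\<^sub>h(F)[1]\<close> for all \<open>g\<close>, \<open>h\<close>, so without this condition the shift on equivariant
  objects is not defined.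
\<close>

definition action_commutes_with_shift ::
  "('k, 'o, 'm) cat \<Rightarrow> ('o, 'm, 'o, 'm) cfunctor \<Rightarrow> ('g, 'b) monoid_scheme \<Rightarrow>
   ('g \<Rightarrow> 'g \<Rightarrow> 'o \<Rightarrow> 'm) \<Rightarrow> bool" where
  "action_commutes_with_shift C S G \<epsilon> \<longleftrightarrow>
     (\<forall>g\<in>carrier G. \<forall>h\<in>carrier G. \<forall>X\<in>Obj C. \<epsilon> g h (fobj S X) = fmor S (\<epsilon> g h X))"

text \<open>
  An equivariant object is a pair \<open>(F, \<theta>)\<close>; the family \<open>\<theta>\<close> is indexed by \<open>carrier G\<close>, whence the
  extensionality.
\<close>

definition equivariant_objects ::
  "('k, 'o, 'm) cat \<Rightarrow> ('g, 'b) monoid_scheme \<Rightarrow> ('g \<Rightarrow> ('o, 'm, 'o, 'm) cfunctor) \<Rightarrow>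
   ('g \<Rightarrow> 'g \<Rightarrow> 'o \<Rightarrow> 'm) \<Rightarrow> ('o \<times> ('g \<Rightarrow> 'm)) set" where
  "equivariant_objects C G \<phi> \<epsilon> =
     {(F, \<theta>). F \<in> Obj C \<and> \<theta> \<in> extensional (carrier G) \<and>
        (\<forall>g\<in>carrier G. iso_arr C F (fobj (\<phi> g) F) (\<theta> g)) \<and>
        (\<forall>g\<in>carrier G. \<forall>h\<in>carrier G.
           \<theta> (h \<otimes>\<^bsub>G\<^esub> g) = \<epsilon> g h F \<star>\<^bsub>C\<^esub> (fmor (\<phi> g) (\<theta> h) \<star>\<^bsub>C\<^esub> \<theta> g))}"

definition equivariant_category ::
  "('k, 'o, 'm) cat \<Rightarrow> ('g, 'b) monoid_scheme \<Rightarrow> ('g \<Rightarrow> ('o, 'm, 'o, 'm) cfunctor) \<Rightarrow>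
   ('g \<Rightarrow> 'g \<Rightarrow> 'o \<Rightarrow> 'm) \<Rightarrow> ('k, 'o \<times> ('g \<Rightarrow> 'm), 'm) cat" where
  "equivariant_category C G \<phi> \<epsilon> =
     \<lparr>Obj = equivariant_objects C G \<phi> \<epsilon>,
      Hom = (\<lambda>(F1, \<theta>1) (F2, \<theta>2). (Hom C F1 F2)
        \<lparr>carrier := {f \<in> carrier (Hom C F1 F2).
                       \<forall>g\<in>carrier G. \<theta>2 g \<star>\<^bsub>C\<^esub> f = fmor (\<phi> g) f \<star>\<^bsub>C\<^esub> \<theta>1 g}\<rparr>),
      Comp = Comp C,
      Ident = (\<lambda>(F, \<theta>). Ident C F)\<rparr>"

definition forgetful :: "('o \<times> ('g \<Rightarrow> 'm), 'm, 'o, 'm) cfunctor" where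
  "forgetful = \<lparr>fobj = (\<lambda>(F, \<theta>). F), fmor = (\<lambda>f. f)\<rparr>"

definition equivariant_shift ::
  "('o, 'm, 'o, 'm) cfunctor \<Rightarrow> ('g, 'b) monoid_scheme \<Rightarrow>
   ('o \<times> ('g \<Rightarrow> 'm), 'm, 'o \<times> ('g \<Rightarrow> 'm), 'm) cfunctor" where
  "equivariant_shift S G =
     \<lparr>fobj = (\<lambda>(F, \<theta>). (fobj S F, \<lambda>g\<in>carrier G. fmor S (\<theta> g))), fmor = fmor S\<rparr>"

definition equivariant_distinguished ::
  "('k, 'o, 'm) cat \<Rightarrow> ('o, 'm, 'o, 'm) cfunctor \<Rightarrow> ('o, 'm) triangle set \<Rightarrow>
   ('g, 'b) monoid_scheme \<Rightarrow> ('g \<Rightarrow> ('o, 'm, 'o, 'm) cfunctor) \<Rightarrow>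
   ('g \<Rightarrow> 'g \<Rightarrow> 'o \<Rightarrow> 'm) \<Rightarrow> ('o \<times> ('g \<Rightarrow> 'm), 'm) triangle set" where
  "equivariant_distinguished C S \<Delta> G \<phi> \<epsilon> =
     {t. is_triangle (equivariant_category C G \<phi> \<epsilon>) (equivariant_shift S G) t \<and>
         functor_triangle forgetful t \<in> \<Delta>}"

end

theory Submission
  imports Defs "HOL-Algebra.AbelCoset"
begin

text \<open>
  Since the order of \<open>G\<close> is invertible, every morphism between the objects underlying two equivariant
  objects can be averaged to an equivariant one, compatibly with composition with equivariant
  morphisms.  Averaging an extension of an equivariant base morphism gives the axioms (3) and (5).

  For the existence axioms (2) and (4), induction sends \<open>X\<close> to the equivariant object
  \<open>\<Oplus>\<^sub>g \<phi>\<^sub>g X\<close> and a distinguished triangle or octahedron of the original category to a distinguished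
  equivariant one.  An equivariant \<open>X\<close> is naturally a retract of the object induced from it, by
  averaging a splitting, so an equivariant base is a retract of an induced base.  The idempotent of the
  induced base extends by (3) or (5) to an endomorphism of the induced diagram.  On each remaining vertex
  this extension \<open>c\<close> satisfies \<open>(c\<^sup>2 - c)\<^sup>2 = 0\<close>, because \<open>c\<^sup>2 - c\<close> vanishes on the base of a
  distinguished triangle; so \<open>3c\<^sup>2 - 2c\<^sup>3\<close> is an idempotent extension.  Splitting it yields a direct
  summand of the induced diagram with the given base, and direct summands of distinguished triangles
  are distinguished.
\<close>

section \<open>Calculus in preadditive categories\<close>

text \<open>The obstacle is that cones are not functorial: the third vertex of a triangle over an
  equivariant morphism receives isomorphisms to its translates from axiom (3), but no choice of them
  is forced to satisfy the cocycle condition. Induction supplies an equivariant third vertex, though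
  only over an induced base, and idempotent completeness makes it possible to cut the wanted summand
  out again. In an octahedron three extended idempotents occur at once, tied together by the fourth
  triangle. Hence the correction must be one polynomial applied at every vertex: it commutes with
  all arrows with which the uncorrected endomorphisms commute, and it leaves the idempotents of the
  base alone. The cubic \<open>3c^2 - 2c^3\<close> is the Hermite interpolation polynomial with
  values 0 and 1 and derivative 0 at the points 0 and 1. Candidate triangles are recognised as
  distinguished through a single consequence of axiom (3): in a distinguished triangle the third
  arrow is a weak cokernel of the second.\<close>

lemma abelian_group_hom_by_add:
  assumes "abelian_group G" "abelian_group H"
    and "\<And>x. x \<in> carrier G \<Longrightarrow> h x \<in> carrier H"
    and "\<And>x y. \<lbrakk>x \<in> carrier G; y \<in> carrier G\<rbrakk> \<Longrightarrow> h (x \<oplus>\<^bsub>G\<^esub> y) = h x \<oplus>\<^bsub>H\<^esub> h y"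
  shows "abelian_group_hom G H h"
  using assms
  by (auto intro!: abelian_group_homI group_hom.intro abelian_group.a_group
      group_hom_axioms.intro homI)

lemma (in abelian_group_hom) finsum_hom:
  assumes "F \<in> A \<rightarrow> carrier G"
  shows "h (finsum G F A) = finsum H (\<lambda>j. h (F j)) A"
  using assms
proof (induction A rule: infinite_finite_induct)
  case (insert x A)
  then have "F x \<in> carrier G" "F \<in> A \<rightarrow> carrier G" by auto
  moreover from this have "(\<lambda>j. h (F j)) \<in> A \<rightarrow> carrier H" by (simp add: Pi_iff)
  ultimately show ?case using insert.hyps insert.IH by (simp add: G.finsum_insert H.finsum_insert)
qed simp_all

lemma arrI: "\<lbrakk>X \<in> Obj C; Y \<in> Obj C; f \<in> carrier (Hom C X Y)\<rbrakk> \<Longrightarrow> arr C X Y f"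
  by (simp add: arr_def)

lemma arr_source: "arr C X Y f \<Longrightarrow> X \<in> Obj C"
  and arr_target: "arr C X Y f \<Longrightarrow> Y \<in> Obj C"
  and arr_carrier: "arr C X Y f \<Longrightarrow> f \<in> carrier (Hom C X Y)"
  by (simp_all add: arr_def)

text \<open>\<open>iso_arr\<close> hides the inverse behind an existential; naming it gives
  cancellation and uniqueness something to speak of.\<close>

definition inverse_arr :: "('k, 'o, 'm) cat \<Rightarrow> 'o \<Rightarrow> 'o \<Rightarrow> 'm \<Rightarrow> 'm \<Rightarrow> bool" where
  "inverse_arr C X Y f g \<longleftrightarrow> arr C X Y f \<and> arr C Y X g \<and>
     g \<star>\<^bsub>C\<^esub> f = Ident C X \<and> f \<star>\<^bsub>C\<^esub> g = Ident C Y"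

lemma iso_arr_iff: "iso_arr C X Y f \<longleftrightarrow> (\<exists>g. inverse_arr C X Y f g)"
  by (auto simp: iso_arr_def inverse_arr_def)

context category
begin

lemma inverse_arr_left_cancel:
  assumes "inverse_arr C X Y f f'" "arr C W X u" "arr C W X v" "f \<star> u = f \<star> v"
  shows "u = v"
proof -
  have f: "arr C X Y f" "arr C Y X f'" "f' \<star> f = Ident C X"
    using assms(1) by (auto simp: inverse_arr_def)
  have "u = f' \<star> (f \<star> u)"
    using Comp_assoc[OF assms(2) f(1,2)] Ident_Comp[OF assms(2)] f by simp
  moreover have "v = f' \<star> (f \<star> v)"
    using Comp_assoc[OF assms(3) f(1,2)] Ident_Comp[OF assms(3)] f by simp
  ultimately show ?thesis using assms(4) by simp
qed

lemma inverse_arr_right_cancel: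
  assumes "inverse_arr C X Y f f'" "arr C Y W u" "arr C Y W v" "u \<star> f = v \<star> f"
  shows "u = v"
proof -
  have f: "arr C X Y f" "arr C Y X f'" "f \<star> f' = Ident C Y"
    using assms(1) by (auto simp: inverse_arr_def)
  have "u = (u \<star> f) \<star> f'"
    using Comp_assoc[OF f(2,1) assms(2)] Comp_Ident[OF assms(2)] f by simp
  moreover have "v = (v \<star> f) \<star> f'"
    using Comp_assoc[OF f(2,1) assms(3)] Comp_Ident[OF assms(3)] f by simp
  ultimately show ?thesis using assms(4) by simp
qed

lemma inverse_arr_unique:
  assumes "inverse_arr C X Y f g" "inverse_arr C X Y f g'"
  shows "g = g'"
  using inverse_arr_left_cancel[OF assms(1), of Y g g'] assms by (simp add: inverse_arr_def)

text \<open>The two one-sided inverses coincide, by evaluating \<open>l \<star> u \<star> r\<close>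
  in two ways. They may be found independently: in the comparison of triangles they come from two
  different endomorphisms.\<close>

lemma iso_arr_by_both_sides:
  assumes u: "arr C X Y u" and l: "arr C Y X l" "l \<star> u = Ident C X"
    and r: "arr C Y X r" "u \<star> r = Ident C Y"
  shows "iso_arr C X Y u"
proof -
  have "l = l \<star> (u \<star> r)" using r Comp_Ident[OF l(1)] by simp
  also have "\<dots> = r" using Comp_assoc[OF r(1) u l(1)] l Ident_Comp[OF r(1)] by simp
  finally show ?thesis using assms by (auto simp: iso_arr_def)
qed

lemma iso_arr_Ident: "X \<in> Obj C \<Longrightarrow> iso_arr C X X (Ident C X)"
  using Ident_arr[of X] Comp_Ident[of X X "Ident C X"] by (auto simp: iso_arr_def)

end

context preadditive_category
begin

lemma zero_arr: "\<lbrakk>X \<in> Obj C; Y \<in> Obj C\<rbrakk> \<Longrightarrow> arr C X Y \<zero>\<^bsub>Hom C X Y\<^esub>"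
  using abelian_groupE(2)[OF Hom_abelian_group] by (auto intro: arrI)

lemma add_arr: "\<lbrakk>arr C X Y f; arr C X Y g\<rbrakk> \<Longrightarrow> arr C X Y (f \<oplus>\<^bsub>Hom C X Y\<^esub> g)"
  using abelian_groupE(1)[OF Hom_abelian_group] by (auto simp: arr_def)

lemma uminus_arr: "arr C X Y f \<Longrightarrow> arr C X Y (\<ominus>\<^bsub>Hom C X Y\<^esub> f)"
  using abelian_group.a_inv_closed[OF Hom_abelian_group] by (auto simp: arr_def)

lemma minus_arr: "\<lbrakk>arr C X Y f; arr C X Y g\<rbrakk> \<Longrightarrow> arr C X Y (f \<ominus>\<^bsub>Hom C X Y\<^esub> g)"
  by (simp add: a_minus_def add_arr uminus_arr)

lemma finsum_arr:
  assumes "X \<in> Obj C" "Y \<in> Obj C" "\<And>j. j \<in> A \<Longrightarrow> arr C X Y (F j)"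
  shows "arr C X Y (finsum (Hom C X Y) F A)"
proof -
  interpret H: abelian_group "Hom C X Y" using Hom_abelian_group assms by blast
  show ?thesis using assms by (auto simp: arr_def intro: H.finsum_closed)
qed

lemma finsum_eq:
  assumes "X \<in> Obj C" "Y \<in> Obj C" "\<And>j. j \<in> A \<Longrightarrow> arr C X Y (F' j)"
    and "\<And>j. j \<in> A \<Longrightarrow> F j = F' j"
  shows "finsum (Hom C X Y) F A = finsum (Hom C X Y) F' A"
proof -
  interpret H: abelian_group "Hom C X Y" using Hom_abelian_group assms by blast
  show ?thesis using assms by (intro H.finsum_cong') (auto simp: arr_def)
qed

lemma Comp_hom_left:
  assumes "arr C Y Z g" "X \<in> Obj C"
  shows "abelian_group_hom (Hom C X Y) (Hom C X Z) (\<lambda>f. g \<star> f)"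
  using assms Comp_arr[of X Y _ Z g] Comp_add_right[of X Y _ _ Z g]
  by (intro abelian_group_hom_by_add Hom_abelian_group) (auto simp: arr_def)

lemma Comp_hom_right:
  assumes "arr C X Y f" "Z \<in> Obj C"
  shows "abelian_group_hom (Hom C Y Z) (Hom C X Z) (\<lambda>g. g \<star> f)"
  using assms Comp_arr[of X Y f Z] Comp_add_left[of X Y f Z]
  by (intro abelian_group_hom_by_add Hom_abelian_group) (auto simp: arr_def)

lemma Comp_zero_right:
  "\<lbrakk>arr C Y Z g; X \<in> Obj C\<rbrakk> \<Longrightarrow> g \<star> \<zero>\<^bsub>Hom C X Y\<^esub> = \<zero>\<^bsub>Hom C X Z\<^esub>"
  by (rule abelian_group_hom.hom_zero[OF Comp_hom_left])

lemma Comp_zero_left: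
  "\<lbrakk>arr C X Y f; Z \<in> Obj C\<rbrakk> \<Longrightarrow> \<zero>\<^bsub>Hom C Y Z\<^esub> \<star> f = \<zero>\<^bsub>Hom C X Z\<^esub>"
  by (rule abelian_group_hom.hom_zero[OF Comp_hom_right])

lemma Comp_uminus_right:
  "\<lbrakk>arr C X Y f; arr C Y Z g\<rbrakk> \<Longrightarrow> g \<star> (\<ominus>\<^bsub>Hom C X Y\<^esub> f) = \<ominus>\<^bsub>Hom C X Z\<^esub> (g \<star> f)"
  by (rule abelian_group_hom.hom_a_inv[OF Comp_hom_left]) (auto simp: arr_def)

lemma Comp_uminus_left:
  "\<lbrakk>arr C X Y f; arr C Y Z g\<rbrakk> \<Longrightarrow> (\<ominus>\<^bsub>Hom C Y Z\<^esub> g) \<star> f = \<ominus>\<^bsub>Hom C X Z\<^esub> (g \<star> f)"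
  by (rule abelian_group_hom.hom_a_inv[OF Comp_hom_right]) (auto simp: arr_def)

lemma Comp_minus_right:
  "\<lbrakk>arr C X Y f; arr C X Y f'; arr C Y Z g\<rbrakk> \<Longrightarrow>
    g \<star> (f \<ominus>\<^bsub>Hom C X Y\<^esub> f') = (g \<star> f) \<ominus>\<^bsub>Hom C X Z\<^esub> (g \<star> f')"
  by (simp add: a_minus_def Comp_add_right uminus_arr Comp_uminus_right)

lemma Comp_minus_left:
  "\<lbrakk>arr C X Y f; arr C Y Z g; arr C Y Z g'\<rbrakk> \<Longrightarrow>
    (g \<ominus>\<^bsub>Hom C Y Z\<^esub> g') \<star> f = (g \<star> f) \<ominus>\<^bsub>Hom C X Z\<^esub> (g' \<star> f)"
  by (simp add: a_minus_def Comp_add_left uminus_arr Comp_uminus_left)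

lemma Comp_finsum_right:
  assumes "X \<in> Obj C" "arr C Y Z g" "\<And>j. j \<in> A \<Longrightarrow> arr C X Y (F j)"
  shows "g \<star> finsum (Hom C X Y) F A = finsum (Hom C X Z) (\<lambda>j. g \<star> F j) A"
  using assms by (intro abelian_group_hom.finsum_hom[OF Comp_hom_left]) (auto simp: arr_def)

lemma Comp_finsum_left:
  assumes "Z \<in> Obj C" "arr C X Y f" "\<And>j. j \<in> A \<Longrightarrow> arr C Y Z (F j)"
  shows "finsum (Hom C Y Z) F A \<star> f = finsum (Hom C X Z) (\<lambda>j. F j \<star> f) A"
  using assms by (intro abelian_group_hom.finsum_hom[OF Comp_hom_right]) (auto simp: arr_def)

lemma minus_self: "arr C X Y f \<Longrightarrow> f \<ominus>\<^bsub>Hom C X Y\<^esub> f = \<zero>\<^bsub>Hom C X Y\<^esub>"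
  using abelian_group.r_neg[OF Hom_abelian_group] by (auto simp: arr_def a_minus_def)

lemma eq_if_minus_zero:
  assumes "arr C X Y f" "arr C X Y g" "f \<ominus>\<^bsub>Hom C X Y\<^esub> g = \<zero>\<^bsub>Hom C X Y\<^esub>"
  shows "f = g"
proof -
  interpret H: abelian_group "Hom C X Y" using Hom_abelian_group assms(1) by (auto simp: arr_def)
  show ?thesis
    using assms H.minus_equality[of f "\<ominus>\<^bsub>Hom C X Y\<^esub> g"] H.minus_minus by (auto simp: arr_def a_minus_def)
qed

text \<open>Any arrow to or from \<open>N\<close> equals its composite with the identity of
  \<open>N\<close>, so it vanishes once that identity does. The equational form is easy to carry
  along functors and between the two categories.\<close>

lemma zero_object_iff: "zero_object C N \<longleftrightarrow> N \<in> Obj C \<and> Ident C N = \<zero>\<^bsub>Hom C N N\<^esub>"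
proof
  assume "zero_object C N"
  then show "N \<in> Obj C \<and> Ident C N = \<zero>\<^bsub>Hom C N N\<^esub>"
    using Ident_arr[of N] zero_arr[of N N] by (auto simp: zero_object_def)
next
  assume N: "N \<in> Obj C \<and> Ident C N = \<zero>\<^bsub>Hom C N N\<^esub>"
  have "f = \<zero>\<^bsub>Hom C X N\<^esub>" if "arr C X N f" for X f
    using Ident_Comp[OF that] Comp_zero_left[OF that, of N] N by simp
  moreover have "f = \<zero>\<^bsub>Hom C N X\<^esub>" if "arr C N X f" for X f
    using Comp_Ident[OF that] Comp_zero_right[OF that, of N] N by simp
  ultimately show "zero_object C N"
    using N zero_arr unfolding zero_object_def by (metis (no_types))
qed

lemma zero_object_arr_to: "\<lbrakk>zero_object C N; arr C X N f; arr C X N g\<rbrakk> \<Longrightarrow> f = g"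
  unfolding zero_object_def by (metis arr_source)

end

section \<open>Equivalences are additive\<close>

lemma is_functorD:
  assumes "is_functor C D F"
  shows functor_obj: "X \<in> Obj C \<Longrightarrow> fobj F X \<in> Obj D"
    and functor_arr: "arr C X Y f \<Longrightarrow> arr D (fobj F X) (fobj F Y) (fmor F f)"
    and functor_Ident: "X \<in> Obj C \<Longrightarrow> fmor F (Ident C X) = Ident D (fobj F X)"
    and functor_Comp: "\<lbrakk>arr C X Y f; arr C Y Z g\<rbrakk> \<Longrightarrow> fmor F (g \<star>\<^bsub>C\<^esub> f) = fmor F g \<star>\<^bsub>D\<^esub> fmor F f"
  using assms unfolding is_functor_def by blast+

lemma functor_inverse_arr:
  assumes "is_functor C D F" "inverse_arr C X Y f g"
  shows "inverse_arr D (fobj F X) (fobj F Y) (fmor F f) (fmor F g)"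
proof -
  have fg: "arr C X Y f" "arr C Y X g" "g \<star>\<^bsub>C\<^esub> f = Ident C X" "f \<star>\<^bsub>C\<^esub> g = Ident C Y"
    using assms(2) by (auto simp: inverse_arr_def)
  show ?thesis
    using functor_Comp[OF assms(1) fg(1,2)] functor_Comp[OF assms(1) fg(2,1)] fg
      functor_arr[OF assms(1)] functor_Ident[OF assms(1)] arr_source[OF fg(1)] arr_source[OF fg(2)]
    by (auto simp: inverse_arr_def)
qed

lemma functor_iso_arr:
  assumes "is_functor C D F" "iso_arr C X Y f"
  shows "iso_arr D (fobj F X) (fobj F Y) (fmor F f)"
  using assms functor_inverse_arr by (fastforce simp: iso_arr_iff)

lemma autoequivalence_if_automorphism:
  assumes "category C" "automorphism C F"
  shows "autoequivalence C F"
proof -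
  interpret category C by fact
  obtain H where H: "is_functor C C F" "is_functor C C H"
    "\<And>X. X \<in> Obj C \<Longrightarrow> fobj H (fobj F X) = X \<and> fobj F (fobj H X) = X"
    "\<And>X Y f. arr C X Y f \<Longrightarrow> fmor H (fmor F f) = f \<and> fmor F (fmor H f) = f"
    using assms(2) unfolding automorphism_def by metis
  have "natural_iso C C (H \<circ>\<^sub>F F) id_functor (Ident C)" "natural_iso C C (F \<circ>\<^sub>F H) id_functor (Ident C)"
    using H(3,4) iso_arr_Ident Comp_Ident Ident_Comp
    unfolding natural_iso_def comp_functor_def id_functor_def by auto
  with H show ?thesis unfolding autoequivalence_def by blast
qed

context category
begin

text \<open>Naturality gives \<open>\<eta> Y \<star> fmor H (fmor F f) = f \<star> \<eta> X\<close>,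
  and \<open>\<eta> X\<close> cancels. As only the composite \<open>H \<circ>\<^sub>F F\<close>
  occurs, a functor and its quasi-inverse can exchange roles, which the proof of fullness
  exploits.\<close>

lemma left_invertible_functor_faithful:
  assumes F: "is_functor C C F" and H: "is_functor C C H"
    and \<eta>: "natural_iso C C (H \<circ>\<^sub>F F) id_functor \<eta>"
    and f: "arr C X Y f" and g: "arr C X Y g" and eq: "fmor F f = fmor F g"
  shows "f = g"
proof -
  have nat: "\<eta> Y \<star> fmor H (fmor F u) = u \<star> \<eta> X" if "arr C X Y u" for u
    using \<eta> that unfolding natural_iso_def comp_functor_def id_functor_def by auto
  obtain \<eta>' where "inverse_arr C (fobj H (fobj F X)) X (\<eta> X) \<eta>'"
    using \<eta> arr_source[OF f]
    unfolding natural_iso_def iso_arr_iff comp_functor_def id_functor_def by auto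
  with f g show ?thesis
    using nat[OF f] nat[OF g] eq inverse_arr_right_cancel by metis
qed

lemma autoequivalence_faithful:
  assumes "autoequivalence C F" "arr C X Y f" "arr C X Y g" "fmor F f = fmor F g"
  shows "f = g"
  using assms left_invertible_functor_faithful unfolding autoequivalence_def by blast

lemma autoequivalence_full:
  assumes "autoequivalence C F" and X: "X \<in> Obj C" and Y: "Y \<in> Obj C"
    and u: "arr C (fobj F X) (fobj F Y) u"
  obtains f where "arr C X Y f" "fmor F f = u"
proof -
  obtain H \<eta> \<zeta> where F: "is_functor C C F" and H: "is_functor C C H"
    and \<eta>: "natural_iso C C (H \<circ>\<^sub>F F) id_functor \<eta>" and \<zeta>: "natural_iso C C (F \<circ>\<^sub>F H) id_functor \<zeta>"
    using assms(1) unfolding autoequivalence_def by blast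
  obtain x where x: "inverse_arr C (fobj H (fobj F X)) X (\<eta> X) x"
    using \<eta> X unfolding natural_iso_def iso_arr_iff comp_functor_def id_functor_def by auto
  obtain y where y: "inverse_arr C (fobj H (fobj F Y)) Y (\<eta> Y) y"
    using \<eta> Y unfolding natural_iso_def iso_arr_iff comp_functor_def id_functor_def by auto
  have xa: "arr C (fobj H (fobj F X)) X (\<eta> X)" "arr C X (fobj H (fobj F X)) x"
    "x \<star> \<eta> X = Ident C (fobj H (fobj F X))"
    and ya: "arr C (fobj H (fobj F Y)) Y (\<eta> Y)"
    using x y by (auto simp: inverse_arr_def)
  have Hu: "arr C (fobj H (fobj F X)) (fobj H (fobj F Y)) (fmor H u)"
    by (rule functor_arr[OF H u])
  \<comment> \<open>The only candidate, since naturality of \<open>\<eta>\<close> determines a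
    preimage of \<open>u\<close>. Its image is compared with \<open>u\<close> after applying
    \<open>H\<close>, which is faithful by \<open>\<zeta>\<close>.\<close>
  define f where "f = (\<eta> Y \<star> fmor H u) \<star> x"
  have f: "arr C X Y f"
    unfolding f_def by (rule Comp_arr[OF xa(2) Comp_arr[OF Hu ya]])
  have HFf: "arr C (fobj H (fobj F X)) (fobj H (fobj F Y)) (fmor H (fmor F f))"
    by (rule functor_arr[OF H functor_arr[OF F f]])
  have "\<eta> Y \<star> fmor H (fmor F f) = f \<star> \<eta> X"
    using \<eta> f unfolding natural_iso_def comp_functor_def id_functor_def by auto
  also have "\<dots> = \<eta> Y \<star> fmor H u"
    unfolding f_def
    using Comp_assoc[OF xa(1,2) Comp_arr[OF Hu ya]] xa(3) Comp_Ident[OF Comp_arr[OF Hu ya]] by simp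
  finally have "fmor H (fmor F f) = fmor H u"
    using inverse_arr_left_cancel[OF y HFf Hu] by simp
  then have "fmor F f = u"
    by (rule left_invertible_functor_faithful[OF H F \<zeta> functor_arr[OF F f] u])
  with f that show thesis by blast
qed

end

definition additive_functor :: "('k, 'o, 'm) cat \<Rightarrow> ('o, 'm, 'o, 'm) cfunctor \<Rightarrow> bool" where
  "additive_functor C F \<longleftrightarrow> is_functor C C F \<and>
     (\<forall>X Y f g. arr C X Y f \<and> arr C X Y g \<longrightarrow>
        fmor F (f \<oplus>\<^bsub>Hom C X Y\<^esub> g) = fmor F f \<oplus>\<^bsub>Hom C (fobj F X) (fobj F Y)\<^esub> fmor F g)"

context preadditive_category
begin

lemma additive_functor_hom:
  assumes "additive_functor C F" "X \<in> Obj C" "Y \<in> Obj C"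
  shows "abelian_group_hom (Hom C X Y) (Hom C (fobj F X) (fobj F Y)) (fmor F)"
proof -
  have F: "is_functor C C F" using assms(1) by (simp add: additive_functor_def)
  show ?thesis
    using assms functor_obj[OF F] functor_arr[OF F, of X Y]
    by (intro abelian_group_hom_by_add Hom_abelian_group) (auto simp: additive_functor_def arr_def)
qed

lemma functor_zero:
  "\<lbrakk>additive_functor C F; X \<in> Obj C; Y \<in> Obj C\<rbrakk> \<Longrightarrow>
    fmor F \<zero>\<^bsub>Hom C X Y\<^esub> = \<zero>\<^bsub>Hom C (fobj F X) (fobj F Y)\<^esub>"
  by (rule abelian_group_hom.hom_zero[OF additive_functor_hom])

lemma functor_add:
  "\<lbrakk>additive_functor C F; arr C X Y f; arr C X Y g\<rbrakk> \<Longrightarrow>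
    fmor F (f \<oplus>\<^bsub>Hom C X Y\<^esub> g) = fmor F f \<oplus>\<^bsub>Hom C (fobj F X) (fobj F Y)\<^esub> fmor F g"
  by (simp add: additive_functor_def)

lemma functor_uminus:
  "\<lbrakk>additive_functor C F; arr C X Y f\<rbrakk> \<Longrightarrow>
    fmor F (\<ominus>\<^bsub>Hom C X Y\<^esub> f) = \<ominus>\<^bsub>Hom C (fobj F X) (fobj F Y)\<^esub> fmor F f"
  by (rule abelian_group_hom.hom_a_inv[OF additive_functor_hom]) (auto simp: arr_def)

lemma functor_minus:
  "\<lbrakk>additive_functor C F; arr C X Y f; arr C X Y g\<rbrakk> \<Longrightarrow>
    fmor F (f \<ominus>\<^bsub>Hom C X Y\<^esub> g) = fmor F f \<ominus>\<^bsub>Hom C (fobj F X) (fobj F Y)\<^esub> fmor F g"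
  by (simp add: a_minus_def functor_add functor_uminus uminus_arr)

lemma functor_finsum:
  assumes "additive_functor C F" "X \<in> Obj C" "Y \<in> Obj C" "\<And>j. j \<in> A \<Longrightarrow> arr C X Y (f j)"
  shows "fmor F (finsum (Hom C X Y) f A)
    = finsum (Hom C (fobj F X) (fobj F Y)) (\<lambda>j. fmor F (f j)) A"
  using assms by (intro abelian_group_hom.finsum_hom[OF additive_functor_hom]) (auto simp: arr_def)

end

lemma additive_functor_is_functor: "additive_functor C F \<Longrightarrow> is_functor C C F"
  by (simp add: additive_functor_def)

context additive_category
begin

text \<open>Fullness lifts the zero endomorphism of \<open>fobj F N\<close> to an endomorphism of
  \<open>N\<close>, which can only be the identity; so zero and identity agree on
  \<open>fobj F N\<close>.\<close>

lemma autoequivalence_zero_object: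
  assumes F: "autoequivalence C F" and N: "zero_object C N"
  shows "zero_object C (fobj F N)"
proof -
  have fun_F: "is_functor C C F" using F by (simp add: autoequivalence_def)
  have obj: "N \<in> Obj C" "fobj F N \<in> Obj C"
    using N functor_obj[OF fun_F] by (auto simp: zero_object_def)
  obtain f where f: "arr C N N f" "fmor F f = \<zero>\<^bsub>Hom C (fobj F N) (fobj F N)\<^esub>"
    by (rule autoequivalence_full[OF F obj(1) obj(1) zero_arr[OF obj(2) obj(2)]])
  have "f = Ident C N" by (rule zero_object_arr_to[OF N f(1) Ident_arr[OF obj(1)]])
  with f show ?thesis using functor_Ident[OF fun_F obj(1)] obj by (simp add: zero_object_iff)
qed

text \<open>A zero arrow is one that factors through a zero object, and \<open>F\<close> preserves
  zero objects.\<close>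

lemma autoequivalence_zero:
  assumes F: "autoequivalence C F" and X: "X \<in> Obj C" and Y: "Y \<in> Obj C"
  shows "fmor F \<zero>\<^bsub>Hom C X Y\<^esub> = \<zero>\<^bsub>Hom C (fobj F X) (fobj F Y)\<^esub>"
proof -
  have fun_F: "is_functor C C F" using F by (simp add: autoequivalence_def)
  obtain N where N: "zero_object C N" using ex_zero_object by blast
  then have NO: "N \<in> Obj C" by (simp add: zero_object_def)
  let ?p = "\<zero>\<^bsub>Hom C X N\<^esub>" and ?i = "\<zero>\<^bsub>Hom C N Y\<^esub>"
  have arr: "arr C X N ?p" "arr C N Y ?i" using zero_arr X Y NO by auto
  have "fmor F \<zero>\<^bsub>Hom C X Y\<^esub> = fmor F (?i \<star> ?p)" using Comp_zero_right[OF arr(2) X] by simp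
  also have "\<dots> = fmor F ?i \<star> fmor F ?p" by (rule functor_Comp[OF fun_F arr])
  also have "fmor F ?p = \<zero>\<^bsub>Hom C (fobj F X) (fobj F N)\<^esub>"
    using zero_object_arr_to[OF autoequivalence_zero_object[OF F N] functor_arr[OF fun_F arr(1)]]
      zero_arr functor_obj[OF fun_F] X NO by blast
  also have "fmor F ?i \<star> \<dots> = \<zero>\<^bsub>Hom C (fobj F X) (fobj F Y)\<^esub>"
    by (rule Comp_zero_right[OF functor_arr[OF fun_F arr(2)] functor_obj[OF fun_F X]])
  finally show ?thesis .
qed

text \<open>An equivalence preserves the biproduct \<open>X \<oplus> X\<close>, through which every sum factors.\<close>

lemma autoequivalence_additive:
  assumes F: "autoequivalence C F"
  shows "additive_functor C F"
  unfolding additive_functor_def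
proof (intro conjI allI impI)
  show fun_F: "is_functor C C F" using F by (simp add: autoequivalence_def)
  fix X Y f g assume "arr C X Y f \<and> arr C X Y g"
  then have f: "arr C X Y f" and g: "arr C X Y g" by auto
  have X: "X \<in> Obj C" and Y: "Y \<in> Obj C" using f by (auto simp: arr_def)
  obtain W i j p q where i: "arr C X W i" and j: "arr C X W j" and p: "arr C W X p" and q: "arr C W X q"
    and eqs: "p \<star> i = Ident C X" "q \<star> j = Ident C X"
      "q \<star> i = \<zero>\<^bsub>Hom C X X\<^esub>" "p \<star> j = \<zero>\<^bsub>Hom C X X\<^esub>"
    using ex_biproduct[OF X X] by blast
  let ?X = "fobj F X" and ?W = "fobj F W" and ?Y = "fobj F Y"
  note fi = functor_arr[OF fun_F i] and fj = functor_arr[OF fun_F j]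
    and fp = functor_arr[OF fun_F p] and fq = functor_arr[OF fun_F q]
  have W: "W \<in> Obj C" using i by (simp add: arr_def)
  have eqsF: "fmor F p \<star> fmor F i = Ident C ?X" "fmor F q \<star> fmor F j = Ident C ?X"
    "fmor F q \<star> fmor F i = \<zero>\<^bsub>Hom C ?X ?X\<^esub>" "fmor F p \<star> fmor F j = \<zero>\<^bsub>Hom C ?X ?X\<^esub>"
    using eqs functor_Comp[OF fun_F i p] functor_Comp[OF fun_F i q] functor_Comp[OF fun_F j p]
      functor_Comp[OF fun_F j q] functor_Ident[OF fun_F X] autoequivalence_zero[OF F X X] by simp_all
  let ?e = "(fmor F i \<star> fmor F p) \<oplus>\<^bsub>Hom C ?W ?W\<^esub> (fmor F j \<star> fmor F q)"
  have e: "arr C ?W ?W ?e" by (intro add_arr Comp_arr[OF fp fi] Comp_arr[OF fq fj])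
  interpret HXX: abelian_group "Hom C ?W ?X"
    using Hom_abelian_group functor_obj[OF fun_F] X W by blast
  have pe: "fmor F p \<star> ?e = fmor F p"
    using Comp_add_right[OF Comp_arr[OF fp fi] Comp_arr[OF fq fj] fp]
      Comp_assoc[OF fp fi fp] Comp_assoc[OF fq fj fp] eqsF Ident_Comp[OF fp]
      Comp_zero_left[OF fq arr_target[OF fp]] HXX.r_zero[OF arr_carrier[OF fp]] by simp
  have qe: "fmor F q \<star> ?e = fmor F q"
    using Comp_add_right[OF Comp_arr[OF fp fi] Comp_arr[OF fq fj] fq]
      Comp_assoc[OF fp fi fq] Comp_assoc[OF fq fj fq] eqsF Ident_Comp[OF fq]
      Comp_zero_left[OF fp arr_target[OF fq]] HXX.l_zero[OF arr_carrier[OF fq]] by simp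
  interpret HXY: abelian_group "Hom C X Y" using Hom_abelian_group X Y by blast
  interpret HX: abelian_group "Hom C X X" using Hom_abelian_group X by blast
  \<comment> \<open>The sum of \<open>f\<close> and \<open>g\<close> is the row \<open>?s\<close>
    composed with the diagonal \<open>?d\<close>, so the claim is reduced to the images of these two
    arrows, which are known through their components.\<close>
  let ?s = "(f \<star> p) \<oplus>\<^bsub>Hom C W Y\<^esub> (g \<star> q)" and ?d = "i \<oplus>\<^bsub>Hom C X W\<^esub> j"
  note fp' = Comp_arr[OF p f] and gq' = Comp_arr[OF q g]
  have s: "arr C W Y ?s" by (intro add_arr fp' gq')
  have d: "arr C X W ?d" by (intro add_arr i j)
  have Id: "Ident C X \<in> carrier (Hom C X X)" by (rule arr_carrier[OF Ident_arr[OF X]])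
  have si: "?s \<star> i = f"
    using Comp_add_left[OF i fp' gq'] Comp_assoc[OF i p f] Comp_assoc[OF i q g] eqs Comp_Ident[OF f]
      Comp_zero_right[OF g X] HXY.r_zero[OF arr_carrier[OF f]] by simp
  have sj: "?s \<star> j = g"
    using Comp_add_left[OF j fp' gq'] Comp_assoc[OF j p f] Comp_assoc[OF j q g] eqs Comp_Ident[OF g]
      Comp_zero_right[OF f X] HXY.l_zero[OF arr_carrier[OF g]] by simp
  have pd: "p \<star> ?d = Ident C X"
    using Comp_add_right[OF i j p] eqs HX.r_zero[OF Id] by simp
  have qd: "q \<star> ?d = Ident C X"
    using Comp_add_right[OF i j q] eqs HX.l_zero[OF Id] by simp
  have sd: "?s \<star> ?d = f \<oplus>\<^bsub>Hom C X Y\<^esub> g"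
    using Comp_add_right[OF i j s] si sj by simp
  \<comment> \<open>Fullness pulls \<open>?e\<close> back to \<open>e'\<close>, and faithfulness
    turns \<open>pe\<close> and \<open>qe\<close> into \<open>p \<star> e' = p\<close> and
    \<open>q \<star> e' = q\<close>. Hence \<open>?s\<close> absorbs \<open>e'\<close> and its image
    absorbs \<open>?e\<close>, through which the image of \<open>?d\<close> splits into
    components.\<close>
  obtain e' where e': "arr C W W e'" "fmor F e' = ?e"
    using autoequivalence_full[OF F W W e] by blast
  have "p \<star> e' = p"
    using pe e' functor_Comp[OF fun_F e'(1) p] autoequivalence_faithful[OF F Comp_arr[OF e'(1) p] p] by simp
  moreover have "q \<star> e' = q"
    using qe e' functor_Comp[OF fun_F e'(1) q] autoequivalence_faithful[OF F Comp_arr[OF e'(1) q] q] by simp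
  ultimately have "?s \<star> e' = ?s"
    using Comp_add_left[OF e'(1) fp' gq'] Comp_assoc[OF e'(1) p f] Comp_assoc[OF e'(1) q g] by simp
  then have Fs: "fmor F ?s = fmor F ?s \<star> ?e"
    using functor_Comp[OF fun_F e'(1) s] e'(2) by simp
  note Fs' = functor_arr[OF fun_F s] and Fd' = functor_arr[OF fun_F d]
  have "fmor F (f \<oplus>\<^bsub>Hom C X Y\<^esub> g) = (fmor F ?s \<star> ?e) \<star> fmor F ?d"
    using sd functor_Comp[OF fun_F d s] Fs by simp
  also have "\<dots> = fmor F ?s \<star> (?e \<star> fmor F ?d)" by (rule Comp_assoc[OF Fd' e Fs'])
  also have "?e \<star> fmor F ?d = fmor F i \<oplus>\<^bsub>Hom C ?X ?W\<^esub> fmor F j"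
    using Comp_add_left[OF Fd' Comp_arr[OF fp fi] Comp_arr[OF fq fj]]
      Comp_assoc[OF Fd' fp fi] Comp_assoc[OF Fd' fq fj] pd qd functor_Comp[OF fun_F d p]
      functor_Comp[OF fun_F d q] functor_Ident[OF fun_F X] Comp_Ident[OF fi] Comp_Ident[OF fj] by simp
  also have "fmor F ?s \<star> \<dots> = fmor F f \<oplus>\<^bsub>Hom C ?X ?Y\<^esub> fmor F g"
    using Comp_add_right[OF fi fj Fs'] functor_Comp[OF fun_F i s] functor_Comp[OF fun_F j s] si sj
    by simp
  finally show "fmor F (f \<oplus>\<^bsub>Hom C X Y\<^esub> g) = fmor F f \<oplus>\<^bsub>Hom C ?X ?Y\<^esub> fmor F g" .
qed

end

section \<open>Finite biproducts\<close>

definition biproduct ::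
  "('k, 'o, 'm) cat \<Rightarrow> 'j set \<Rightarrow> ('j \<Rightarrow> 'o) \<Rightarrow> 'o \<Rightarrow> ('j \<Rightarrow> 'm) \<Rightarrow> ('j \<Rightarrow> 'm) \<Rightarrow> bool" where
  "biproduct C J V W i p \<longleftrightarrow> W \<in> Obj C \<and>
     (\<forall>j\<in>J. arr C (V j) W (i j) \<and> arr C W (V j) (p j) \<and> p j \<star>\<^bsub>C\<^esub> i j = Ident C (V j)) \<and>
     (\<forall>j\<in>J. \<forall>l\<in>J. j \<noteq> l \<longrightarrow> p l \<star>\<^bsub>C\<^esub> i j = \<zero>\<^bsub>Hom C (V j) (V l)\<^esub>) \<and>
     (\<Oplus>\<^bsub>Hom C W W\<^esub>j\<in>J. i j \<star>\<^bsub>C\<^esub> p j) = Ident C W"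

lemma biproductD:
  assumes "biproduct C J V W i p"
  shows "W \<in> Obj C" "j \<in> J \<Longrightarrow> arr C (V j) W (i j)" "j \<in> J \<Longrightarrow> arr C W (V j) (p j)"
    "j \<in> J \<Longrightarrow> p j \<star>\<^bsub>C\<^esub> i j = Ident C (V j)"
    "\<lbrakk>j \<in> J; l \<in> J; j \<noteq> l\<rbrakk> \<Longrightarrow> p l \<star>\<^bsub>C\<^esub> i j = \<zero>\<^bsub>Hom C (V j) (V l)\<^esub>"
    "(\<Oplus>\<^bsub>Hom C W W\<^esub>j\<in>J. i j \<star>\<^bsub>C\<^esub> p j) = Ident C W"
  using assms unfolding biproduct_def by blast+

text \<open>Expanding the identity of \<open>W\<close> writes an arrow \<open>w\<close> as the sum
  of the \<open>(w \<star> b j) \<star> a j\<close>. A resolution of the identity is weaker than a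
  biproduct, as it says nothing about \<open>a l \<star> b j\<close> for single indices; it
  therefore covers direct summands as well as direct sums.\<close>

lemma (in preadditive_category) eq_by_resolution_right:
  assumes res: "(\<Oplus>\<^bsub>Hom C W W\<^esub>j\<in>J. b j \<star> a j) = Ident C W"
    and ab: "\<And>j. j \<in> J \<Longrightarrow> arr C W (V j) (a j)" "\<And>j. j \<in> J \<Longrightarrow> arr C (V j) W (b j)"
    and u: "arr C W Z u" and v: "arr C W Z v"
    and eq: "\<And>j. j \<in> J \<Longrightarrow> u \<star> b j = v \<star> b j"
  shows "u = v"
proof -
  have expand: "w = (\<Oplus>\<^bsub>Hom C W Z\<^esub>j\<in>J. (w \<star> b j) \<star> a j)" if w: "arr C W Z w" for w
  proof -
    have W: "W \<in> Obj C" and Z: "Z \<in> Obj C" using w by (auto simp: arr_def)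
    have "w = w \<star> (\<Oplus>\<^bsub>Hom C W W\<^esub>j\<in>J. b j \<star> a j)" using res Comp_Ident[OF w] by simp
    also have "\<dots> = (\<Oplus>\<^bsub>Hom C W Z\<^esub>j\<in>J. w \<star> (b j \<star> a j))"
      using ab by (intro Comp_finsum_right[OF W w] Comp_arr)
    also have "\<dots> = (\<Oplus>\<^bsub>Hom C W Z\<^esub>j\<in>J. (w \<star> b j) \<star> a j)"
      by (intro finsum_eq W Z Comp_arr[OF ab(1) Comp_arr[OF ab(2) w]]) (simp_all add: Comp_assoc[OF ab w])
    finally show ?thesis .
  qed
  have W: "W \<in> Obj C" and Z: "Z \<in> Obj C" using u by (auto simp: arr_def)
  have "(\<Oplus>\<^bsub>Hom C W Z\<^esub>j\<in>J. (u \<star> b j) \<star> a j) = (\<Oplus>\<^bsub>Hom C W Z\<^esub>j\<in>J. (v \<star> b j) \<star> a j)"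
    using eq by (intro finsum_eq W Z) (auto intro: Comp_arr[OF ab(1) Comp_arr[OF ab(2) v]])
  with expand[OF u] expand[OF v] show ?thesis by simp
qed

lemma (in preadditive_category) eq_by_resolution_left:
  assumes res: "(\<Oplus>\<^bsub>Hom C W W\<^esub>j\<in>J. b j \<star> a j) = Ident C W"
    and ab: "\<And>j. j \<in> J \<Longrightarrow> arr C W (V j) (a j)" "\<And>j. j \<in> J \<Longrightarrow> arr C (V j) W (b j)"
    and u: "arr C Z W u" and v: "arr C Z W v"
    and eq: "\<And>j. j \<in> J \<Longrightarrow> a j \<star> u = a j \<star> v"
  shows "u = v"
proof -
  have expand: "w = (\<Oplus>\<^bsub>Hom C Z W\<^esub>j\<in>J. b j \<star> (a j \<star> w))" if w: "arr C Z W w" for w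
  proof -
    have W: "W \<in> Obj C" and Z: "Z \<in> Obj C" using w by (auto simp: arr_def)
    have "w = (\<Oplus>\<^bsub>Hom C W W\<^esub>j\<in>J. b j \<star> a j) \<star> w" using res Ident_Comp[OF w] by simp
    also have "\<dots> = (\<Oplus>\<^bsub>Hom C Z W\<^esub>j\<in>J. (b j \<star> a j) \<star> w)"
      using ab by (intro Comp_finsum_left[OF W w] Comp_arr)
    also have "\<dots> = (\<Oplus>\<^bsub>Hom C Z W\<^esub>j\<in>J. b j \<star> (a j \<star> w))"
      by (intro finsum_eq W Z Comp_arr[OF Comp_arr[OF w ab(1)] ab(2)]) (simp_all add: Comp_assoc[OF w ab])
    finally show ?thesis .
  qed
  have W: "W \<in> Obj C" and Z: "Z \<in> Obj C" using u by (auto simp: arr_def)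
  have "(\<Oplus>\<^bsub>Hom C Z W\<^esub>j\<in>J. b j \<star> (a j \<star> u)) = (\<Oplus>\<^bsub>Hom C Z W\<^esub>j\<in>J. b j \<star> (a j \<star> v))"
    using eq by (intro finsum_eq W Z) (auto intro: Comp_arr[OF Comp_arr[OF v ab(1)] ab(2)])
  with expand[OF u] expand[OF v] show ?thesis by simp
qed

text \<open>Orthogonality leaves only the summand at \<open>l\<close>. Arrows into direct sums are
  built below as such sums and recognised by their components.\<close>

lemma (in preadditive_category) biproduct_proj_finsum:
  assumes bp: "biproduct C J V W i p" and fin: "finite J" and l: "l \<in> J"
    and F: "\<And>j. j \<in> J \<Longrightarrow> arr C Z (V j) (F j)" and Z: "Z \<in> Obj C"
  shows "p l \<star> (\<Oplus>\<^bsub>Hom C Z W\<^esub>j\<in>J. i j \<star> F j) = F l"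
proof -
  note W = biproductD(1)[OF bp] and i = biproductD(2)[OF bp] and p = biproductD(3)[OF bp]
  have Vl: "V l \<in> Obj C" using p[OF l] by (simp add: arr_def)
  interpret H: abelian_group "Hom C Z (V l)" by (rule Hom_abelian_group[OF Z Vl])
  have "p l \<star> (\<Oplus>\<^bsub>Hom C Z W\<^esub>j\<in>J. i j \<star> F j) = (\<Oplus>\<^bsub>Hom C Z (V l)\<^esub>j\<in>J. p l \<star> (i j \<star> F j))"
    by (rule Comp_finsum_right[OF Z p[OF l]]) (rule Comp_arr[OF F i])
  also have "\<dots> = (\<Oplus>\<^bsub>Hom C Z (V l)\<^esub>j\<in>J. if l = j then F j else \<zero>\<^bsub>Hom C Z (V l)\<^esub>)"
  proof (rule finsum_eq[OF Z Vl])
    fix j assume j: "j \<in> J"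
    show "arr C Z (V l) (if l = j then F j else \<zero>\<^bsub>Hom C Z (V l)\<^esub>)"
      using F[OF j] zero_arr[OF Z Vl] by auto
    have "p l \<star> (i j \<star> F j) = (p l \<star> i j) \<star> F j"
      by (rule Comp_assoc[OF F[OF j] i[OF j] p[OF l], symmetric])
    also have "\<dots> = (if l = j then F j else \<zero>\<^bsub>Hom C Z (V l)\<^esub>)"
      using biproductD(4)[OF bp l] biproductD(5)[OF bp j l] Ident_Comp[OF F[OF j]]
        Comp_zero_left[OF F[OF j] Vl] by auto
    finally show "p l \<star> (i j \<star> F j) = (if l = j then F j else \<zero>\<^bsub>Hom C Z (V l)\<^esub>)" .
  qed
  also have "\<dots> = F l"
  proof -
    have "(\<lambda>j. if l = j then F j else \<zero>\<^bsub>Hom C Z (V l)\<^esub>) \<in> J \<rightarrow> carrier (Hom C Z (V l))"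
      using arr_carrier[OF F[OF l]] by auto
    from H.finsum_singleton[OF l fin this] show ?thesis by (simp cong: if_cong)
  qed
  finally show ?thesis .
qed

lemma (in additive_category) ex_finite_biproduct:
  assumes "finite J" "\<And>j. j \<in> J \<Longrightarrow> V j \<in> Obj C"
  shows "\<exists>W i p. biproduct C J V W i p"
  using assms
proof (induction J rule: finite_induct)
  case empty
  obtain N where N: "zero_object C N" using ex_zero_object by blast
  interpret H: abelian_group "Hom C N N" using Hom_abelian_group N by (simp add: zero_object_def)
  have "biproduct C {} V N i p" for i p
    using N by (auto simp: biproduct_def zero_object_iff)
  then show ?case by blast
next
  case (insert x J)
  then obtain W i p where bp: "biproduct C J V W i p" by blast
  note W = biproductD(1)[OF bp] and i = biproductD(2)[OF bp] and p = biproductD(3)[OF bp]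
  have x: "V x \<in> Obj C" using insert by blast
  obtain U i0 j0 p0 q0 where i0: "arr C (V x) U i0" and j0: "arr C W U j0"
    and p0: "arr C U (V x) p0" and q0: "arr C U W q0"
    and eqs: "p0 \<star> i0 = Ident C (V x)" "q0 \<star> j0 = Ident C W" "q0 \<star> i0 = \<zero>\<^bsub>Hom C (V x) W\<^esub>"
      "p0 \<star> j0 = \<zero>\<^bsub>Hom C W (V x)\<^esub>" "(i0 \<star> p0) \<oplus>\<^bsub>Hom C U U\<^esub> (j0 \<star> q0) = Ident C U"
    using ex_biproduct[OF x W] by metis
  let ?i = "\<lambda>j. if j = x then i0 else j0 \<star> i j" and ?p = "\<lambda>j. if j = x then p0 else p j \<star> q0"
  have U: "U \<in> Obj C" using i0 by (simp add: arr_def)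
  interpret H: abelian_group "Hom C U U" by (rule Hom_abelian_group[OF U U])
  have arrs: "arr C (V j) U (?i j)" "arr C U (V j) (?p j)" if "j \<in> insert x J" for j
    using that insert.hyps i0 p0 Comp_arr[OF i j0] Comp_arr[OF q0 p] by auto
  have ne: "j \<noteq> x" if "j \<in> J" for j using that insert.hyps by auto
  have pi: "(p l \<star> q0) \<star> (j0 \<star> i j) = p l \<star> i j" if "j \<in> J" "l \<in> J" for j l
    using that Comp_assoc[OF Comp_arr[OF i[of j] j0] q0 p[of l]] Comp_assoc[OF i[of j] j0 q0] eqs
      Ident_Comp[OF i[of j]] by simp
  have pi0: "(p l \<star> q0) \<star> i0 = \<zero>\<^bsub>Hom C (V x) (V l)\<^esub>" if "l \<in> J" for l
    using Comp_assoc[OF i0 q0 p[OF that]] eqs Comp_zero_right[OF p[OF that] x] by simp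
  have p0i: "p0 \<star> (j0 \<star> i j) = \<zero>\<^bsub>Hom C (V j) (V x)\<^esub>" if "j \<in> J" for j
    using Comp_assoc[OF i[OF that] j0 p0] eqs Comp_zero_left[OF i[OF that] x] by simp
  have "(\<Oplus>\<^bsub>Hom C U U\<^esub>j\<in>J. ?i j \<star> ?p j) = (\<Oplus>\<^bsub>Hom C U U\<^esub>j\<in>J. j0 \<star> ((i j \<star> p j) \<star> q0))"
  proof (rule finsum_eq[OF U U])
    fix j assume j: "j \<in> J"
    note ip = Comp_arr[OF p[OF j] i[OF j]]
    show "arr C U U (j0 \<star> ((i j \<star> p j) \<star> q0))" by (rule Comp_arr[OF Comp_arr[OF q0 ip] j0])
    show "?i j \<star> ?p j = j0 \<star> ((i j \<star> p j) \<star> q0)"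
      using ne[OF j] Comp_assoc[OF Comp_arr[OF q0 p[OF j]] i[OF j] j0] Comp_assoc[OF q0 p[OF j] i[OF j]]
      by simp
  qed
  also have "\<dots> = j0 \<star> ((\<Oplus>\<^bsub>Hom C W W\<^esub>j\<in>J. i j \<star> p j) \<star> q0)"
  proof -
    have "(\<Oplus>\<^bsub>Hom C W W\<^esub>j\<in>J. i j \<star> p j) \<star> q0 = (\<Oplus>\<^bsub>Hom C U W\<^esub>j\<in>J. (i j \<star> p j) \<star> q0)"
      by (rule Comp_finsum_left[OF W q0 Comp_arr[OF p i]])
    moreover have "j0 \<star> (\<Oplus>\<^bsub>Hom C U W\<^esub>j\<in>J. (i j \<star> p j) \<star> q0) = (\<Oplus>\<^bsub>Hom C U U\<^esub>j\<in>J. j0 \<star> ((i j \<star> p j) \<star> q0))"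
      by (rule Comp_finsum_right[OF U j0 Comp_arr[OF q0 Comp_arr[OF p i]]])
    ultimately show ?thesis by simp
  qed
  also have "\<dots> = j0 \<star> q0" using biproductD(6)[OF bp] Ident_Comp[OF q0] by simp
  finally have sum: "(\<Oplus>\<^bsub>Hom C U U\<^esub>j\<in>J. ?i j \<star> ?p j) = j0 \<star> q0" .
  have "(\<Oplus>\<^bsub>Hom C U U\<^esub>j\<in>insert x J. ?i j \<star> ?p j) = (i0 \<star> p0) \<oplus>\<^bsub>Hom C U U\<^esub> (j0 \<star> q0)"
    using insert.hyps sum arr_carrier[OF Comp_arr[OF p0 i0]] arr_carrier[OF Comp_arr[OF arrs(2) arrs(1)]]
    by (subst H.finsum_insert) auto
  then have "biproduct C (insert x J) V U ?i ?p"
    using U arrs eqs pi pi0 p0i ne biproductD(4,5)[OF bp] insert.hyps unfolding biproduct_def by auto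
  then show ?case by blast
qed

lemma (in preadditive_category) additive_functor_biproduct:
  assumes F: "additive_functor C F" and bp: "biproduct C J V W i p"
    and V: "\<And>j. j \<in> J \<Longrightarrow> V j \<in> Obj C"
  shows "biproduct C J (\<lambda>j. fobj F (V j)) (fobj F W) (\<lambda>j. fmor F (i j)) (\<lambda>j. fmor F (p j))"
proof -
  note fun_F = additive_functor_is_functor[OF F]
  note W = biproductD(1)[OF bp] and i = biproductD(2)[OF bp] and p = biproductD(3)[OF bp]
  have "(\<Oplus>\<^bsub>Hom C (fobj F W) (fobj F W)\<^esub>j\<in>J. fmor F (i j) \<star> fmor F (p j))
      = (\<Oplus>\<^bsub>Hom C (fobj F W) (fobj F W)\<^esub>j\<in>J. fmor F (i j \<star> p j))"
    by (intro finsum_eq functor_obj[OF fun_F W] functor_arr[OF fun_F Comp_arr[OF p i]])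
      (simp_all add: functor_Comp[OF fun_F p i])
  also have "\<dots> = Ident C (fobj F W)"
    using functor_finsum[where A = J, OF F W W Comp_arr[OF p i], symmetric] biproductD(6)[OF bp]
      functor_Ident[OF fun_F W] by simp
  finally show ?thesis
    using functor_Comp[OF fun_F i p, symmetric] biproductD(4,5)[OF bp] functor_Ident[OF fun_F]
      functor_zero[OF F] V functor_arr[OF fun_F i] functor_arr[OF fun_F p] functor_obj[OF fun_F W]
    unfolding biproduct_def by simp
qed

section \<open>Weak cokernels and lifting of idempotents\<close>

context preadditive_category
begin

text \<open>For every \<open>V\<close>, the kernel of \<open>Hom(Z,V) -> Hom(Y,V)\<close> lies in
  the image of \<open>Hom(W,V) -> Hom(Z,V)\<close>. Unlike for a cokernel, the factorization need
  not be unique.\<close>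

definition weak_cokernel :: "'o \<Rightarrow> 'o \<Rightarrow> 'o \<Rightarrow> 'm \<Rightarrow> 'm \<Rightarrow> bool" where
  "weak_cokernel Y Z W g h \<longleftrightarrow>
     (\<forall>V n. arr C Z V n \<and> n \<star> g = \<zero>\<^bsub>Hom C Y V\<^esub> \<longrightarrow> (\<exists>n'. arr C W V n' \<and> n = n' \<star> h))"

text \<open>Factoring the left copy of \<open>n\<close> as \<open>n' \<star> h\<close> exposes the
  vanishing composite \<open>h \<star> n\<close>. It is applied to \<open>w - 1\<close> for an
  endomorphism \<open>w\<close> fixing \<open>g\<close> and \<open>h\<close>, and to
  \<open>c^2 - c\<close> for an extended idempotent.\<close>

lemma weak_cokernel_square_zero:
  assumes wc: "weak_cokernel Y Z W g h" and h: "arr C Z W h" and n: "arr C Z Z n"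
    and ng: "n \<star> g = \<zero>\<^bsub>Hom C Y Z\<^esub>" and hn: "h \<star> n = \<zero>\<^bsub>Hom C Z W\<^esub>"
  shows "n \<star> n = \<zero>\<^bsub>Hom C Z Z\<^esub>"
proof -
  obtain n' where n': "arr C W Z n'" "n = n' \<star> h"
    using wc n ng unfolding weak_cokernel_def by blast
  have "n \<star> n = n' \<star> (h \<star> n)" using n'(2) Comp_assoc[OF n h n'(1)] by simp
  then show ?thesis using hn Comp_zero_right[OF n'(1) arr_source[OF n]] by simp
qed

text \<open>For \<open>n = w - 1\<close> the geometric series of \<open>1/(1 + n)\<close> stops at
  \<open>1 - n\<close>.\<close>

lemma unipotent_iso:
  assumes w: "arr C Z Z w"
    and sq: "(w \<ominus>\<^bsub>Hom C Z Z\<^esub> Ident C Z) \<star> (w \<ominus>\<^bsub>Hom C Z Z\<^esub> Ident C Z) = \<zero>\<^bsub>Hom C Z Z\<^esub>"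
  shows "iso_arr C Z Z w"
proof -
  let ?H = "Hom C Z Z" and ?I = "Ident C Z"
  let ?n = "w \<ominus>\<^bsub>?H\<^esub> ?I"
  have Z: "Z \<in> Obj C" using w by (simp add: arr_def)
  note I = Ident_arr[OF Z]
  interpret H: abelian_group ?H by (rule Hom_abelian_group[OF Z Z])
  have n: "arr C Z Z ?n" by (rule minus_arr[OF w I])
  have c: "w \<in> carrier ?H" "?I \<in> carrier ?H" "?n \<in> carrier ?H"
    using w I n by (auto intro: arr_carrier)
  have wn: "w = ?n \<oplus>\<^bsub>?H\<^esub> ?I"
    using c by (simp add: a_minus_def H.a_assoc H.l_neg H.r_zero)
  have "w \<ominus>\<^bsub>?H\<^esub> ?n = ?I"
    using c by (simp add: a_minus_def H.minus_add H.minus_minus H.a_assoc[symmetric] H.r_neg H.l_zero)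
  moreover have "w \<star> ?n = ?n"
    by (subst wn) (use sq Comp_add_left[OF n n I] Ident_Comp[OF n] c in \<open>simp add: H.l_zero\<close>)
  moreover have "?n \<star> w = ?n"
    by (subst (2) wn) (use sq Comp_add_right[OF n I n] Comp_Ident[OF n] c in \<open>simp add: H.l_zero\<close>)
  moreover have v: "arr C Z Z (?I \<ominus>\<^bsub>?H\<^esub> ?n)" by (rule minus_arr[OF I n])
  ultimately have "w \<star> (?I \<ominus>\<^bsub>?H\<^esub> ?n) = ?I" "(?I \<ominus>\<^bsub>?H\<^esub> ?n) \<star> w = ?I"
    using Comp_minus_right[OF I n w] Comp_minus_left[OF w I n] Comp_Ident[OF w] Ident_Comp[OF w]
    by simp_all
  with v w show ?thesis by (auto simp: iso_arr_def)
qed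

text \<open>A substitute for the five lemma: \<open>w - 1\<close> has zero composites with
  \<open>g\<close> before it and with \<open>h\<close> after it, so it squares to zero.\<close>

lemma weak_cokernel_endo_iso:
  assumes wc: "weak_cokernel Y Z W g h" and g: "arr C Y Z g" and h: "arr C Z W h"
    and w: "arr C Z Z w" and wg: "w \<star> g = g" and hw: "h \<star> w = h"
  shows "iso_arr C Z Z w"
proof (rule unipotent_iso[OF w])
  note I = Ident_arr[OF arr_source[OF w]]
  show "(w \<ominus>\<^bsub>Hom C Z Z\<^esub> Ident C Z) \<star> (w \<ominus>\<^bsub>Hom C Z Z\<^esub> Ident C Z) = \<zero>\<^bsub>Hom C Z Z\<^esub>"
    by (rule weak_cokernel_square_zero[OF wc h minus_arr[OF w I]])
      (simp_all add: Comp_minus_left[OF g w I] Comp_minus_right[OF w I h] wg hw Ident_Comp[OF g]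
        Comp_Ident[OF h] minus_self[OF g] minus_self[OF h])
qed

text \<open>
  The polynomial \<open>3c\<^sup>2 - 2c\<^sup>3\<close> fixes the idempotents 0 and 1 to second order, so it is idempotent
  as soon as \<open>(c\<^sup>2 - c)\<^sup>2 = 0\<close>.
\<close>

definition idem_lift :: "'o \<Rightarrow> 'm \<Rightarrow> 'm" where
  "idem_lift Z c = (c \<star> c) \<oplus>\<^bsub>Hom C Z Z\<^esub>
     (((c \<star> c) \<ominus>\<^bsub>Hom C Z Z\<^esub> (c \<star> (c \<star> c))) \<oplus>\<^bsub>Hom C Z Z\<^esub> ((c \<star> c) \<ominus>\<^bsub>Hom C Z Z\<^esub> (c \<star> (c \<star> c))))"

lemma idem_lift_arr: "arr C Z Z c \<Longrightarrow> arr C Z Z (idem_lift Z c)"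
  unfolding idem_lift_def by (intro add_arr minus_arr) (blast intro: Comp_arr)+

lemma idem_lift_idem:
  assumes "arr C Z Z c" "c \<star> c = c"
  shows "idem_lift Z c = c"
proof -
  interpret H: abelian_group "Hom C Z Z" using Hom_abelian_group assms(1) by (auto simp: arr_def)
  show ?thesis
    using assms by (simp add: idem_lift_def minus_self arr_carrier H.r_zero)
qed

text \<open>Every power of \<open>c\<close> is intertwined by \<open>f\<close> with the same power
  of \<open>c'\<close>, hence so is the polynomial. This is why all vertices of a diagram can be
  corrected at once.\<close>

lemma idem_lift_commute:
  assumes c: "arr C X X c" and c': "arr C Y Y c'" and f: "arr C X Y f" and eq: "c' \<star> f = f \<star> c"
  shows "idem_lift Y c' \<star> f = f \<star> idem_lift X c"
proof -
  note cc = Comp_arr[OF c c] and cc' = Comp_arr[OF c' c']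
  note ccc = Comp_arr[OF cc c] and ccc' = Comp_arr[OF cc' c']
  have 2: "(c' \<star> c') \<star> f = f \<star> (c \<star> c)"
    using Comp_assoc[OF f c' c'] Comp_assoc[OF c f c'] Comp_assoc[OF c c f] eq by simp
  have 3: "(c' \<star> (c' \<star> c')) \<star> f = f \<star> (c \<star> (c \<star> c))"
    using Comp_assoc[OF f cc' c'] Comp_assoc[OF cc f c'] Comp_assoc[OF cc c f] eq 2 by simp
  note m = minus_arr[OF cc ccc] and m' = minus_arr[OF cc' ccc']
  show ?thesis
    unfolding idem_lift_def
    by (simp add: Comp_add_left[OF f cc' add_arr[OF m' m']] Comp_add_left[OF f m' m']
        Comp_minus_left[OF f cc' ccc'] Comp_add_right[OF cc add_arr[OF m m] f]
        Comp_add_right[OF m m f] Comp_minus_right[OF cc ccc f] 2 3)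
qed

lemma functor_idem_lift:
  assumes F: "additive_functor C F" and c: "arr C X X c"
  shows "fmor F (idem_lift X c) = idem_lift (fobj F X) (fmor F c)"
proof -
  note fun_F = additive_functor_is_functor[OF F]
  note cc = Comp_arr[OF c c] 
  note ccc = Comp_arr[OF cc c] 
  note m = minus_arr[OF cc ccc]
  show ?thesis
    unfolding idem_lift_def
    by (simp add: functor_add[OF F cc add_arr[OF m m]] functor_add[OF F m m]
        functor_minus[OF F cc ccc] functor_Comp[OF fun_F cc c] functor_Comp[OF fun_F c c])
qed

text \<open>With \<open>q = c^2\<close> and \<open>m = c^2 - c^3\<close> the lift is
  \<open>q + 2m\<close>. For \<open>n = c^2 - c\<close> the assumption reads
  \<open>q n = c n\<close>, and since \<open>m = - c n\<close> this gives \<open>c m = m\<close>.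
  Then \<open>m = c^3 - c^4\<close>, which yields \<open>q q + m = c q\<close> and
  \<open>c q + m = q\<close>; so multiplication by the lift fixes both \<open>q\<close> and
  \<open>m\<close>, and no polynomial of degree six has to be expanded.\<close>

lemma idem_lift_idempotent:
  assumes c: "arr C Z Z c"
    and sq: "((c \<star> c) \<ominus>\<^bsub>Hom C Z Z\<^esub> c) \<star> ((c \<star> c) \<ominus>\<^bsub>Hom C Z Z\<^esub> c) = \<zero>\<^bsub>Hom C Z Z\<^esub>"
  shows "idem_lift Z c \<star> idem_lift Z c = idem_lift Z c"
proof -
  let ?H = "Hom C Z Z"
  have Z: "Z \<in> Obj C" using c by (simp add: arr_def)
  interpret H: abelian_group ?H by (rule Hom_abelian_group[OF Z Z])
  define q n m where "q = c \<star> c" and "n = q \<ominus>\<^bsub>?H\<^esub> c" and "m = q \<ominus>\<^bsub>?H\<^esub> (c \<star> q)"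
  have q: "arr C Z Z q" unfolding q_def by (rule Comp_arr[OF c c])
  note cq = Comp_arr[OF q c]
  have m: "arr C Z Z m" unfolding m_def by (rule minus_arr[OF q cq])
  have n: "arr C Z Z n" unfolding n_def by (rule minus_arr[OF q c])
  note cn = Comp_arr[OF n c] and qn = Comp_arr[OF n q]
  have E: "idem_lift Z c = q \<oplus>\<^bsub>?H\<^esub> (m \<oplus>\<^bsub>?H\<^esub> m)" by (simp add: idem_lift_def q_def m_def)
  have qc: "q \<star> c = c \<star> q" unfolding q_def by (rule Comp_assoc[OF c c c])
  have mc: "m = \<ominus>\<^bsub>?H\<^esub> (c \<star> n)"
    unfolding m_def n_def Comp_minus_right[OF q c c] q_def[symmetric]
    using arr_carrier[OF q] arr_carrier[OF cq]
    by (simp add: a_minus_def H.minus_add H.minus_minus H.a_comm)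
  have "n \<star> n = (q \<star> n) \<ominus>\<^bsub>?H\<^esub> (c \<star> n)"
    using Comp_minus_left[OF n q c] by (simp add: n_def)
  then have qn_eq: "q \<star> n = c \<star> n"
    using sq eq_if_minus_zero[OF qn cn] by (simp add: n_def q_def)
  have "q \<star> (c \<star> n) = c \<star> (q \<star> n)"
    using Comp_assoc[OF n c q] Comp_assoc[OF n q c] qc by simp
  also have "\<dots> = q \<star> n" using Comp_assoc[OF n c c] by (simp add: qn_eq q_def[symmetric])
  finally have "q \<star> (c \<star> n) = c \<star> n" by (simp add: qn_eq)
  then have qm: "q \<star> m = m"
    unfolding mc using Comp_uminus_right[OF cn q] by simp
  have cm: "arr C Z Z (c \<star> m)" by (rule Comp_arr[OF m c])
  have "c \<star> m = \<ominus>\<^bsub>?H\<^esub> (q \<star> n)"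
    unfolding mc Comp_uminus_right[OF cn c] q_def using Comp_assoc[OF n c c] by simp
  then have cm_eq: "c \<star> m = m" using qn_eq mc by simp
  have "c \<star> m = (c \<star> q) \<ominus>\<^bsub>?H\<^esub> (q \<star> q)"
    unfolding m_def Comp_minus_right[OF q cq c] using Comp_assoc[OF q c c] by (simp add: q_def[symmetric])
  then have "m = (c \<star> q) \<ominus>\<^bsub>?H\<^esub> (q \<star> q)" by (simp add: cm_eq)
  then have qqm: "(q \<star> q) \<oplus>\<^bsub>?H\<^esub> m = c \<star> q"
    using arr_carrier[OF cq] arr_carrier[OF Comp_arr[OF q q]]
    by (simp add: a_minus_def H.a_lcomm H.r_neg H.r_zero)
  have "(c \<star> q) \<oplus>\<^bsub>?H\<^esub> m = q"
    unfolding m_def using arr_carrier[OF cq] arr_carrier[OF q]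
    by (simp add: a_minus_def H.a_lcomm H.r_neg H.r_zero)
  then have qq: "(q \<star> q) \<oplus>\<^bsub>?H\<^esub> (m \<oplus>\<^bsub>?H\<^esub> m) = q"
    using qqm arr_carrier[OF m] arr_carrier[OF Comp_arr[OF q q]] by (simp add: H.a_assoc[symmetric])
  let ?E = "q \<oplus>\<^bsub>?H\<^esub> (m \<oplus>\<^bsub>?H\<^esub> m)"
  have mm: "arr C Z Z (m \<oplus>\<^bsub>?H\<^esub> m)" by (rule add_arr[OF m m])
  have e: "arr C Z Z ?E" by (rule add_arr[OF q mm])
  have qE: "q \<star> ?E = q"
    using Comp_add_right[OF q mm q] Comp_add_right[OF m m q] qm qq by simp
  have mE: "m \<star> ?E = m"
    using Comp_minus_left[OF e q cq] Comp_assoc[OF e q c] qE by (simp add: m_def)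
  show ?thesis
    unfolding E using Comp_add_left[OF e q mm] Comp_add_left[OF e m m] qE mE by simp
qed

end

context suspended_category
begin

lemma shift_autoequivalence: "autoequivalence C S"
  by (rule autoequivalence_if_automorphism[OF category_axioms shift_automorphism])

lemma shift_additive: "additive_functor C S"
  by (rule autoequivalence_additive[OF shift_autoequivalence])

lemma shift_functor: "is_functor C C S"
  by (rule additive_functor_is_functor[OF shift_additive])

lemmas shift_obj = functor_obj[OF shift_functor]
  and shift_arr = functor_arr[OF shift_functor]
  and shift_Comp = functor_Comp[OF shift_functor]
  and shift_Ident = functor_Ident[OF shift_functor]

text \<open>The last square contains the shift of \<open>a\<close>; the polynomial commutes with the
  shift because an automorphism is additive.\<close>

lemma triangle_mor_idem_lift:
  assumes t: "is_triangle C S (Triangle X Y Z f g h)"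
    and mor: "triangle_mor C S (Triangle X Y Z f g h) (Triangle X Y Z f g h) a b c"
  shows "triangle_mor C S (Triangle X Y Z f g h) (Triangle X Y Z f g h)
    (idem_lift X a) (idem_lift Y b) (idem_lift Z c)"
proof -
  have fgh: "arr C X Y f" "arr C Y Z g" "arr C Z (fobj S X) h"
    and abc: "arr C X X a" "arr C Y Y b" "arr C Z Z c"
    and eqs: "b \<star> f = f \<star> a" "c \<star> g = g \<star> b" "fmor S a \<star> h = h \<star> c"
    using t mor by auto
  show ?thesis
    using idem_lift_arr abc idem_lift_commute[OF abc(1,2) fgh(1) eqs(1)]
      idem_lift_commute[OF abc(2,3) fgh(2) eqs(2)]
      idem_lift_commute[OF abc(3) shift_arr[OF abc(1)] fgh(3) eqs(3)]
      functor_idem_lift[OF shift_additive abc(1)]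
    by simp
qed

end

section \<open>Retracts of distinguished triangles\<close>

context triangulated_order2
begin

lemma distinguished_arr:
  assumes "Triangle X Y Z f g h \<in> \<Delta>"
  shows "arr C X Y f" "arr C Y Z g" "arr C Z (fobj S X) h"
  using distinguished_is_triangle[OF assms] by auto

text \<open>If \<open>n \<star> g\<close> vanishes, then \<open>n\<close> and the zero arrow to a
  zero object \<open>N\<close> form a base morphism from the rotated triangle to the trivial
  triangle on \<open>N\<close>, \<open>V\<close>, \<open>V\<close>. The third component provided by
  axiom (3) is the factorization.\<close>

lemma distinguished_weak_cokernel:
  assumes t: "Triangle X Y Z f g h \<in> \<Delta>"
  shows "weak_cokernel Y Z (fobj S X) g h"
  unfolding weak_cokernel_def
proof (intro allI impI)
  fix V n assume "arr C Z V n \<and> n \<star> g = \<zero>\<^bsub>Hom C Y V\<^esub>"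
  then have n: "arr C Z V n" and ng: "n \<star> g = \<zero>\<^bsub>Hom C Y V\<^esub>" by auto
  note a = distinguished_arr[OF t]
  have V: "V \<in> Obj C" using n by (simp add: arr_def)
  have Y: "Y \<in> Obj C" using a by (simp add: arr_def)
  obtain N where N: "zero_object C N" using ex_zero_object by blast
  then have NO: "N \<in> Obj C" by (simp add: zero_object_def)
  have rot: "Triangle Y Z (fobj S X) g h (\<ominus>\<^bsub>Hom C (fobj S X) (fobj S Y)\<^esub> fmor S f) \<in> \<Delta>"
    using axiom_1c[OF distinguished_is_triangle[OF t]] t by simp
  have "n \<star> g = \<zero>\<^bsub>Hom C N V\<^esub> \<star> \<zero>\<^bsub>Hom C Y N\<^esub>"
    using ng Comp_zero_right[OF zero_arr[OF NO V] Y] by simp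
  then have "triangle_base_mor C (Triangle Y Z (fobj S X) g h (\<ominus>\<^bsub>Hom C (fobj S X) (fobj S Y)\<^esub> fmor S f))
      (Triangle N V V \<zero>\<^bsub>Hom C N V\<^esub> (Ident C V) \<zero>\<^bsub>Hom C V (fobj S N)\<^esub>) \<zero>\<^bsub>Hom C Y N\<^esub> n"
    using n zero_arr[OF Y NO] by simp
  from axiom_3[OF rot axiom_1b[OF N V] this] obtain c
    where "arr C (fobj S X) V c" "c \<star> h = Ident C V \<star> n" by auto
  then show "\<exists>n'. arr C (fobj S X) V n' \<and> n = n' \<star> h" using Ident_Comp[OF n] by auto
qed

text \<open>The composites \<open>u \<star> v\<close> and \<open>v \<star> u\<close> fix the second
  and third arrows of their triangles, so both are invertible and \<open>u\<close> has an inverse on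
  either side. Arrows in both directions are asked for because the weak cokernel argument speaks of
  endomorphisms. With identities on \<open>X\<close> and \<open>Y\<close>, \<open>u\<close> becomes
  an isomorphism of triangles.\<close>

lemma distinguished_by_comparison:
  assumes t: "Triangle X Y Z0 f g0 h0 \<in> \<Delta>"
    and g: "arr C Y Z g" and h: "arr C Z (fobj S X) h" and wc: "weak_cokernel Y Z (fobj S X) g h"
    and u: "arr C Z Z0 u" "u \<star> g = g0" "h0 \<star> u = h"
    and v: "arr C Z0 Z v" "v \<star> g0 = g" "h \<star> v = h0"
  shows "Triangle X Y Z f g h \<in> \<Delta>"
proof -
  note a = distinguished_arr[OF t]
  note uv = Comp_arr[OF v(1) u(1)] and vu = Comp_arr[OF u(1) v(1)]
  have "iso_arr C Z0 Z0 (u \<star> v)"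
    using Comp_assoc[OF a(2) v(1) u(1)] Comp_assoc[OF v(1) u(1) a(3)] u v
    by (intro weak_cokernel_endo_iso[OF distinguished_weak_cokernel[OF t] a(2,3) uv]) simp_all
  then obtain r where r: "arr C Z0 Z0 r" "(u \<star> v) \<star> r = Ident C Z0" by (auto simp: iso_arr_def)
  have "iso_arr C Z Z (v \<star> u)"
    using Comp_assoc[OF g u(1) v(1)] Comp_assoc[OF u(1) v(1) h] u v
    by (intro weak_cokernel_endo_iso[OF wc g h vu]) simp_all
  then obtain l where l: "arr C Z Z l" "l \<star> (v \<star> u) = Ident C Z" by (auto simp: iso_arr_def)
  have "iso_arr C Z Z0 u"
    using iso_arr_by_both_sides[OF u(1) Comp_arr[OF v(1) l(1)] _ Comp_arr[OF r(1) v(1)]]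
      Comp_assoc[OF u(1) v(1) l(1)] Comp_assoc[OF r(1) v(1) u(1)] l r by simp
  moreover have XY: "X \<in> Obj C" "Y \<in> Obj C" using a by (auto simp: arr_def)
  ultimately have "triangle_iso C S (Triangle X Y Z f g h) (Triangle X Y Z0 f g0 h0)"
    unfolding triangle_iso.simps
    using iso_arr_Ident Ident_arr Comp_Ident[OF a(1)] Ident_Comp[OF a(1)] u Comp_Ident[OF a(2)]
      shift_Ident[OF XY(1)] Ident_Comp[OF h]
    by (intro exI[of _ "Ident C X"] exI[of _ "Ident C Y"] exI[of _ u]) auto
  then show ?thesis using axiom_1a[OF _ t] a g h by auto
qed

text \<open>Specializes both to finite direct sums and to direct summands of distinguished triangles.\<close>

lemma distinguished_by_resolution:
  assumes fin: "finite J" and s: "is_triangle C S (Triangle X Y Z f g h)"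
    and t: "\<And>j. j \<in> J \<Longrightarrow> Triangle (X' j) (Y' j) (Z' j) (f' j) (g' j) (h' j) \<in> \<Delta>"
    and to: "\<And>j. j \<in> J \<Longrightarrow> triangle_mor C S (Triangle X Y Z f g h)
      (Triangle (X' j) (Y' j) (Z' j) (f' j) (g' j) (h' j)) (a j) (b j) (c j)"
    and from_t: "\<And>j. j \<in> J \<Longrightarrow> triangle_mor C S (Triangle (X' j) (Y' j) (Z' j) (f' j) (g' j) (h' j))
      (Triangle X Y Z f g h) (a' j) (b' j) (c' j)"
    and resX: "(\<Oplus>\<^bsub>Hom C X X\<^esub>j\<in>J. a' j \<star> a j) = Ident C X"
    and resY: "(\<Oplus>\<^bsub>Hom C Y Y\<^esub>j\<in>J. b' j \<star> b j) = Ident C Y"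
    and resZ: "(\<Oplus>\<^bsub>Hom C Z Z\<^esub>j\<in>J. c' j \<star> c j) = Ident C Z"
  shows "Triangle X Y Z f g h \<in> \<Delta>"
proof -
  have f: "arr C X Y f" and g: "arr C Y Z g" and h: "arr C Z (fobj S X) h" using s by auto
  have XYZ: "X \<in> Obj C" "Y \<in> Obj C" "Z \<in> Obj C" using f g by (auto simp: arr_def)
  have a: "arr C X (X' j) (a j)" "arr C Y (Y' j) (b j)" "arr C Z (Z' j) (c j)"
    "b j \<star> f = f' j \<star> a j" "c j \<star> g = g' j \<star> b j" "fmor S (a j) \<star> h = h' j \<star> c j" if "j \<in> J" for j
    using to[OF that] by auto
  have a': "arr C (X' j) X (a' j)" "arr C (Y' j) Y (b' j)" "arr C (Z' j) Z (c' j)"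
    "b' j \<star> f' j = f \<star> a' j" "c' j \<star> g' j = g \<star> b' j" "fmor S (a' j) \<star> h' j = h \<star> c' j" if "j \<in> J" for j
    using from_t[OF that] by auto
  note t_arr = distinguished_arr[OF t]
  note S_a = shift_arr[OF a(1)] and S_a' = shift_arr[OF a'(1)]
  have SX: "fobj S X \<in> Obj C" by (rule shift_obj[OF XYZ(1)])
  have resSX: "(\<Oplus>\<^bsub>Hom C (fobj S X) (fobj S X)\<^esub>j\<in>J. fmor S (a' j) \<star> fmor S (a j)) = Ident C (fobj S X)"
  proof -
    have "(\<Oplus>\<^bsub>Hom C (fobj S X) (fobj S X)\<^esub>j\<in>J. fmor S (a' j) \<star> fmor S (a j))
        = (\<Oplus>\<^bsub>Hom C (fobj S X) (fobj S X)\<^esub>j\<in>J. fmor S (a' j \<star> a j))"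
      by (intro finsum_eq SX shift_arr Comp_arr[OF a(1) a'(1)]) (simp_all add: shift_Comp[OF a(1) a'(1)])
    also have "\<dots> = fmor S (Ident C X)"
      using functor_finsum[where A = J, OF shift_additive XYZ(1,1) Comp_arr[OF a(1) a'(1)], symmetric]
        resX by simp
    finally show ?thesis using shift_Ident[OF XYZ(1)] by simp
  qed
  have wc: "weak_cokernel Y Z (fobj S X) g h"
    unfolding weak_cokernel_def
  proof (intro allI impI)
    fix V n assume "arr C Z V n \<and> n \<star> g = \<zero>\<^bsub>Hom C Y V\<^esub>"
    then have n: "arr C Z V n" and ng: "n \<star> g = \<zero>\<^bsub>Hom C Y V\<^esub>" by auto
    have V: "V \<in> Obj C" using n by (simp add: arr_def)
    have "\<exists>n'. arr C (fobj S (X' j)) V n' \<and> n \<star> c' j = n' \<star> h' j" if j: "j \<in> J" for j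
    proof -
      have "(n \<star> c' j) \<star> g' j = n \<star> (g \<star> b' j)"
        using Comp_assoc[OF t_arr(2)[OF j] a'(3)[OF j] n] a'(5)[OF j] by simp
      also have "\<dots> = \<zero>\<^bsub>Hom C (Y' j) V\<^esub>"
        using Comp_assoc[OF a'(2)[OF j] g n] ng Comp_zero_left[OF a'(2)[OF j] V] by simp
      finally show ?thesis
        using distinguished_weak_cokernel[OF t[OF j]] Comp_arr[OF a'(3)[OF j] n]
        unfolding weak_cokernel_def by blast
    qed
    then obtain n' where n': "\<And>j. j \<in> J \<Longrightarrow> arr C (fobj S (X' j)) V (n' j)"
      "\<And>j. j \<in> J \<Longrightarrow> n \<star> c' j = n' j \<star> h' j" by metis
    \<comment> \<open>The factorizations \<open>n' j\<close> over the single triangles are glued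
      along the shifts of the \<open>a j\<close>; the last square turns
      \<open>fmor S (a j) \<star> h\<close> into \<open>h' j \<star> c j\<close>, after which the
      resolution of \<open>Z\<close> applies.\<close>
    let ?m = "\<Oplus>\<^bsub>Hom C (fobj S X) V\<^esub>j\<in>J. n' j \<star> fmor S (a j)"
    have m: "arr C (fobj S X) V ?m"
      by (rule finsum_arr[OF SX V Comp_arr[OF S_a n'(1)]])
    have "?m \<star> h = (\<Oplus>\<^bsub>Hom C Z V\<^esub>j\<in>J. (n' j \<star> fmor S (a j)) \<star> h)"
      by (rule Comp_finsum_left[OF V h Comp_arr[OF S_a n'(1)]])
    also have "\<dots> = (\<Oplus>\<^bsub>Hom C Z V\<^esub>j\<in>J. n \<star> (c' j \<star> c j))"
    proof (rule finsum_eq[OF XYZ(3) V])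
      fix j assume j: "j \<in> J"
      show "arr C Z V (n \<star> (c' j \<star> c j))" by (rule Comp_arr[OF Comp_arr[OF a(3)[OF j] a'(3)[OF j]] n])
      show "(n' j \<star> fmor S (a j)) \<star> h = n \<star> (c' j \<star> c j)"
        using Comp_assoc[OF h S_a[OF j] n'(1)[OF j]] Comp_assoc[OF a(3)[OF j] t_arr(3)[OF j] n'(1)[OF j]]
          Comp_assoc[OF a(3)[OF j] a'(3)[OF j] n] a(6)[OF j] n'(2)[OF j] by simp
    qed
    also have "\<dots> = n \<star> (\<Oplus>\<^bsub>Hom C Z Z\<^esub>j\<in>J. c' j \<star> c j)"
      by (rule Comp_finsum_right[OF XYZ(3) n Comp_arr[OF a(3) a'(3)], symmetric])
    also have "\<dots> = n" using resZ Comp_Ident[OF n] by simp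
    finally show "\<exists>n'. arr C (fobj S X) V n' \<and> n = n' \<star> h" using m by metis
  qed
  \<comment> \<open>The candidate is compared with a distinguished triangle on the same base. Axiom
    (3) maps the latter to and from every member of the family, and the \<open>c j\<close> and
    \<open>c' j\<close> connect the members with \<open>Z\<close>.\<close>
  obtain Z0 g0 h0 where D: "Triangle X Y Z0 f g0 h0 \<in> \<Delta>" using axiom_2[OF f] by blast
  note d = distinguished_arr[OF D]
  have Z0: "Z0 \<in> Obj C" using d by (simp add: arr_def)
  have "\<exists>p. triangle_mor C S (Triangle X Y Z0 f g0 h0)
      (Triangle (X' j) (Y' j) (Z' j) (f' j) (g' j) (h' j)) (a j) (b j) p" if "j \<in> J" for j
    by (rule axiom_3[OF D t[OF that]]) (use a[OF that] in simp)
  then obtain p where p: "\<And>j. j \<in> J \<Longrightarrow> arr C Z0 (Z' j) (p j)"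
    "\<And>j. j \<in> J \<Longrightarrow> p j \<star> g0 = g' j \<star> b j" "\<And>j. j \<in> J \<Longrightarrow> fmor S (a j) \<star> h0 = h' j \<star> p j"
    by simp metis
  have "\<exists>q. triangle_mor C S (Triangle (X' j) (Y' j) (Z' j) (f' j) (g' j) (h' j))
      (Triangle X Y Z0 f g0 h0) (a' j) (b' j) q" if "j \<in> J" for j
    by (rule axiom_3[OF t[OF that] D]) (use a'[OF that] in simp)
  then obtain q where q: "\<And>j. j \<in> J \<Longrightarrow> arr C (Z' j) Z0 (q j)"
    "\<And>j. j \<in> J \<Longrightarrow> q j \<star> g' j = g0 \<star> b' j" "\<And>j. j \<in> J \<Longrightarrow> fmor S (a' j) \<star> h' j = h0 \<star> q j"
    by simp metis
  note Y = XYZ(2)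
  \<comment> \<open>This and \<open>coextend\<close> are stated for arbitrary ends because each
    serves twice, for the arrow from \<open>Z\<close> to \<open>Z0\<close> and for the one
    back.\<close>
  have extend: "(\<Oplus>\<^bsub>Hom C V W\<^esub>j\<in>J. s j \<star> r j) \<star> x = y"
    if "arr C Y V x" "arr C Y W y" "\<And>j. j \<in> J \<Longrightarrow> arr C V (Z' j) (r j)" "\<And>j. j \<in> J \<Longrightarrow> arr C (Z' j) W (s j)"
      "\<And>j. j \<in> J \<Longrightarrow> r j \<star> x = g' j \<star> b j" "\<And>j. j \<in> J \<Longrightarrow> s j \<star> g' j = y \<star> b' j" for V W x y r s
  proof -
    have W: "W \<in> Obj C" using that(2) by (simp add: arr_def)
    have "(\<Oplus>\<^bsub>Hom C V W\<^esub>j\<in>J. s j \<star> r j) \<star> x = (\<Oplus>\<^bsub>Hom C Y W\<^esub>j\<in>J. (s j \<star> r j) \<star> x)"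
      by (rule Comp_finsum_left[OF W that(1) Comp_arr[OF that(3,4)]])
    also have "\<dots> = (\<Oplus>\<^bsub>Hom C Y W\<^esub>j\<in>J. y \<star> (b' j \<star> b j))"
    proof (rule finsum_eq[OF Y W])
      fix j assume j: "j \<in> J"
      show "arr C Y W (y \<star> (b' j \<star> b j))" by (rule Comp_arr[OF Comp_arr[OF a(2)[OF j] a'(2)[OF j]] that(2)])
      show "(s j \<star> r j) \<star> x = y \<star> (b' j \<star> b j)"
        using Comp_assoc[OF that(1) that(3)[OF j] that(4)[OF j]] that(5)[OF j] that(6)[OF j]
          Comp_assoc[OF a(2)[OF j] t_arr(2)[OF j] that(4)[OF j]]
          Comp_assoc[OF a(2)[OF j] a'(2)[OF j] that(2)] by simp
    qed
    also have "\<dots> = y \<star> (\<Oplus>\<^bsub>Hom C Y Y\<^esub>j\<in>J. b' j \<star> b j)"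
      by (rule Comp_finsum_right[OF Y that(2) Comp_arr[OF a(2) a'(2)], symmetric])
    finally show ?thesis using resY Comp_Ident[OF that(2)] by simp
  qed
  have coextend: "y \<star> (\<Oplus>\<^bsub>Hom C V W\<^esub>j\<in>J. s j \<star> r j) = x"
    if "arr C V (fobj S X) x" "arr C W (fobj S X) y" "\<And>j. j \<in> J \<Longrightarrow> arr C V (Z' j) (r j)"
      "\<And>j. j \<in> J \<Longrightarrow> arr C (Z' j) W (s j)"
      "\<And>j. j \<in> J \<Longrightarrow> fmor S (a j) \<star> x = h' j \<star> r j" "\<And>j. j \<in> J \<Longrightarrow> fmor S (a' j) \<star> h' j = y \<star> s j" for V W x y r s
  proof -
    have V: "V \<in> Obj C" using that(1) by (simp add: arr_def)
    have "y \<star> (\<Oplus>\<^bsub>Hom C V W\<^esub>j\<in>J. s j \<star> r j) = (\<Oplus>\<^bsub>Hom C V (fobj S X)\<^esub>j\<in>J. y \<star> (s j \<star> r j))"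
      by (rule Comp_finsum_right[OF V that(2) Comp_arr[OF that(3,4)]])
    also have "\<dots> = (\<Oplus>\<^bsub>Hom C V (fobj S X)\<^esub>j\<in>J. (fmor S (a' j) \<star> fmor S (a j)) \<star> x)"
    proof (rule finsum_eq[OF V SX])
      fix j assume j: "j \<in> J"
      show "arr C V (fobj S X) ((fmor S (a' j) \<star> fmor S (a j)) \<star> x)"
        by (rule Comp_arr[OF that(1) Comp_arr[OF S_a[OF j] S_a'[OF j]]])
      show "y \<star> (s j \<star> r j) = (fmor S (a' j) \<star> fmor S (a j)) \<star> x"
        using Comp_assoc[OF that(3)[OF j] that(4)[OF j] that(2)] that(5)[OF j] that(6)[OF j]
          Comp_assoc[OF that(3)[OF j] t_arr(3)[OF j] S_a'[OF j]]
          Comp_assoc[OF that(1) S_a[OF j] S_a'[OF j]] by simp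
    qed
    also have "\<dots> = (\<Oplus>\<^bsub>Hom C (fobj S X) (fobj S X)\<^esub>j\<in>J. fmor S (a' j) \<star> fmor S (a j)) \<star> x"
      by (rule Comp_finsum_left[OF SX that(1) Comp_arr[OF S_a S_a'], symmetric])
    finally show ?thesis using resSX Ident_Comp[OF that(1)] by simp
  qed
  let ?u = "\<Oplus>\<^bsub>Hom C Z Z0\<^esub>j\<in>J. q j \<star> c j" and ?v = "\<Oplus>\<^bsub>Hom C Z0 Z\<^esub>j\<in>J. c' j \<star> p j"
  show ?thesis
  proof (rule distinguished_by_comparison[OF D g h wc])
    show "arr C Z Z0 ?u" by (rule finsum_arr[OF XYZ(3) Z0 Comp_arr[OF a(3) q(1)]])
    show "arr C Z0 Z ?v" by (rule finsum_arr[OF Z0 XYZ(3) Comp_arr[OF p(1) a'(3)]])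
    show "?u \<star> g = g0" by (rule extend[OF g d(2) a(3) q(1) a(5) q(2)])
    show "?v \<star> g0 = g" by (rule extend[OF d(2) g p(1) a'(3) p(2) a'(5)])
    show "h0 \<star> ?u = h" by (rule coextend[OF h d(3) a(3) q(1) a(6) q(3)])
    show "h \<star> ?v = h0" by (rule coextend[OF d(3) h p(1) a'(3) p(3) a'(6)])
  qed
qed

text \<open>Both base components contribute: idempotency of \<open>b\<close> gives
  \<open>(c^2 - c) g = 0\<close>, and idempotency of \<open>a\<close> gives
  \<open>h (c^2 - c) = 0\<close>.\<close>

lemma distinguished_idem_lift_idempotent:
  assumes t: "Triangle X Y Z f g h \<in> \<Delta>"
    and mor: "triangle_mor C S (Triangle X Y Z f g h) (Triangle X Y Z f g h) a b c"
    and a: "a \<star> a = a" and b: "b \<star> b = b"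
  shows "idem_lift Z c \<star> idem_lift Z c = idem_lift Z c"
proof -
  note t_arr = distinguished_arr[OF t]
  have abc: "arr C X X a" "arr C Y Y b" "arr C Z Z c"
    and eqs: "c \<star> g = g \<star> b" "fmor S a \<star> h = h \<star> c" using mor by auto
  note cc = Comp_arr[OF abc(3) abc(3)]
  have "(c \<star> c) \<star> g = g \<star> b"
    using Comp_assoc[OF t_arr(2) abc(3) abc(3)] Comp_assoc[OF abc(2) t_arr(2) abc(3)]
      Comp_assoc[OF abc(2) abc(2) t_arr(2)] eqs b by simp
  moreover have "h \<star> (c \<star> c) = fmor S a \<star> h"
    using Comp_assoc[OF abc(3) abc(3) t_arr(3)] Comp_assoc[OF abc(3) t_arr(3) shift_arr[OF abc(1)]]
      Comp_assoc[OF t_arr(3) shift_arr[OF abc(1)] shift_arr[OF abc(1)]] eqs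
      shift_Comp[OF abc(1) abc(1)] a by simp
  ultimately have
    "((c \<star> c) \<ominus>\<^bsub>Hom C Z Z\<^esub> c) \<star> ((c \<star> c) \<ominus>\<^bsub>Hom C Z Z\<^esub> c) = \<zero>\<^bsub>Hom C Z Z\<^esub>"
    using Comp_minus_left[OF t_arr(2) cc abc(3)] Comp_minus_right[OF cc abc(3) t_arr(3)] eqs
      minus_self[OF Comp_arr[OF abc(2) t_arr(2)]] minus_self[OF Comp_arr[OF abc(3) t_arr(3)]]
    by (intro weak_cokernel_square_zero[OF distinguished_weak_cokernel[OF t] t_arr(3) minus_arr[OF cc abc(3)]])
      simp_all
  then show ?thesis by (rule idem_lift_idempotent[OF abc(3)])
qed

end

section \<open>The equivariant category\<close>

text \<open>Collects what can be said without distinguished triangles: the additive structure, the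
  shift, averaging and induction.\<close>

locale equivariant_setting =
  suspended_category T S + lin: linear_category k T + act: right_action T G \<phi> \<epsilon>
  for k :: "('k, 'r) ring_scheme" and T :: "('k, 'o, 'm) cat" (structure)
    and S :: "('o, 'm, 'o, 'm) cfunctor" and G :: "('g, 'b) monoid_scheme"
    and \<phi> :: "'g \<Rightarrow> ('o, 'm, 'o, 'm) cfunctor" and \<epsilon> :: "'g \<Rightarrow> 'g \<Rightarrow> 'o \<Rightarrow> 'm" +
  assumes finite_G: "finite (carrier G)"
    and action_stable: "g \<in> carrier G \<Longrightarrow> stable_functor T S (\<phi> g)"
    and commutes_with_shift: "action_commutes_with_shift T S G \<epsilon>"
    and order_Unit: "add_pow k (order G) \<one>\<^bsub>k\<^esub> \<in> Units k"
begin

abbreviation "E \<equiv> equivariant_category T G \<phi> \<epsilon>"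

abbreviation "SE \<equiv> equivariant_shift S G"

lemma action_additive: "g \<in> carrier G \<Longrightarrow> additive_functor T (\<phi> g)"
  by (rule autoequivalence_additive[OF act.action_autoequivalence])

lemma action_functor: "g \<in> carrier G \<Longrightarrow> is_functor T T (\<phi> g)"
  by (rule additive_functor_is_functor[OF action_additive])

lemmas action_obj = functor_obj[OF action_functor]
  and action_arr = functor_arr[OF action_functor]
  and action_Comp = functor_Comp[OF action_functor]
  and action_Ident = functor_Ident[OF action_functor]

lemma epsilon_arr: "\<lbrakk>g \<in> carrier G; h \<in> carrier G; X \<in> Obj T\<rbrakk> \<Longrightarrow>
    arr T (fobj (\<phi> g) (fobj (\<phi> h) X)) (fobj (\<phi> (h \<otimes>\<^bsub>G\<^esub> g)) X) (\<epsilon> g h X)"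
  using act.action_natural_iso[of g h] by (simp add: natural_iso_def comp_functor_def iso_arr_def)

lemma epsilon_iso: "\<lbrakk>g \<in> carrier G; h \<in> carrier G; X \<in> Obj T\<rbrakk> \<Longrightarrow>
    iso_arr T (fobj (\<phi> g) (fobj (\<phi> h) X)) (fobj (\<phi> (h \<otimes>\<^bsub>G\<^esub> g)) X) (\<epsilon> g h X)"
  using act.action_natural_iso[of g h] by (simp add: natural_iso_def comp_functor_def)

lemma epsilon_natural: "\<lbrakk>g \<in> carrier G; h \<in> carrier G; arr T X Y f\<rbrakk> \<Longrightarrow>
    \<epsilon> g h Y \<star> fmor (\<phi> g) (fmor (\<phi> h) f) = fmor (\<phi> (h \<otimes>\<^bsub>G\<^esub> g)) f \<star> \<epsilon> g h X"
  using act.action_natural_iso[of g h] by (simp add: natural_iso_def comp_functor_def)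

lemma action_shift_obj: "\<lbrakk>g \<in> carrier G; X \<in> Obj T\<rbrakk> \<Longrightarrow>
    fobj (\<phi> g) (fobj S X) = fobj S (fobj (\<phi> g) X)"
  using action_stable[of g] by (simp add: stable_functor_def)

lemma action_shift_mor: "\<lbrakk>g \<in> carrier G; arr T X Y f\<rbrakk> \<Longrightarrow>
    fmor (\<phi> g) (fmor S f) = fmor S (fmor (\<phi> g) f)"
  using action_stable[of g] unfolding stable_functor_def by metis

lemma epsilon_shift: "\<lbrakk>g \<in> carrier G; h \<in> carrier G; X \<in> Obj T\<rbrakk> \<Longrightarrow>
    \<epsilon> g h (fobj S X) = fmor S (\<epsilon> g h X)"
  using commutes_with_shift by (simp add: action_commutes_with_shift_def)

section \<open>Objects and hom-groups of the equivariant category\<close>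

lemma Obj_E: "X \<in> Obj E \<longleftrightarrow> fst X \<in> Obj T \<and> snd X \<in> extensional (carrier G) \<and>
    (\<forall>g\<in>carrier G. iso_arr T (fst X) (fobj (\<phi> g) (fst X)) (snd X g)) \<and>
    (\<forall>g\<in>carrier G. \<forall>h\<in>carrier G. snd X (h \<otimes>\<^bsub>G\<^esub> g)
       = \<epsilon> g h (fst X) \<star> (fmor (\<phi> g) (snd X h) \<star> snd X g))"
  by (auto simp: equivariant_category_def equivariant_objects_def)

lemma Obj_E_D:
  assumes "X \<in> Obj E"
  shows "fst X \<in> Obj T"
    and "g \<in> carrier G \<Longrightarrow> iso_arr T (fst X) (fobj (\<phi> g) (fst X)) (snd X g)"
    and "g \<in> carrier G \<Longrightarrow> arr T (fst X) (fobj (\<phi> g) (fst X)) (snd X g)"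
    and "\<lbrakk>g \<in> carrier G; h \<in> carrier G\<rbrakk> \<Longrightarrow>
      snd X (h \<otimes>\<^bsub>G\<^esub> g) = \<epsilon> g h (fst X) \<star> (fmor (\<phi> g) (snd X h) \<star> snd X g)"
  using assms unfolding Obj_E iso_arr_def by auto

lemma E_simps [simp]:
  "Comp E = Comp T"
  "Ident E X = Ident T (fst X)"
  "\<zero>\<^bsub>Hom E X Y\<^esub> = \<zero>\<^bsub>Hom T (fst X) (fst Y)\<^esub>"
  "add (Hom E X Y) = add (Hom T (fst X) (fst Y))"
  by (auto simp: equivariant_category_def split: prod.split)

lemma carrier_E: "carrier (Hom E X Y) = {f \<in> carrier (Hom T (fst X) (fst Y)).
    \<forall>g\<in>carrier G. snd Y g \<star> f = fmor (\<phi> g) f \<star> snd X g}"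
  by (auto simp: equivariant_category_def split: prod.splits)

lemma arr_E: "arr E X Y f \<longleftrightarrow> X \<in> Obj E \<and> Y \<in> Obj E \<and> arr T (fst X) (fst Y) f \<and>
    (\<forall>g\<in>carrier G. snd Y g \<star> f = fmor (\<phi> g) f \<star> snd X g)"
  by (auto simp: arr_def carrier_E Obj_E)

lemma arr_E_D:
  assumes "arr E X Y f"
  shows "X \<in> Obj E" "Y \<in> Obj E" "arr T (fst X) (fst Y) f"
    and "g \<in> carrier G \<Longrightarrow> snd Y g \<star> f = fmor (\<phi> g) f \<star> snd X g"
  using assms unfolding arr_E by auto

lemma zero_arr_E:
  assumes X: "X \<in> Obj E" and Y: "Y \<in> Obj E"
  shows "arr E X Y \<zero>\<^bsub>Hom T (fst X) (fst Y)\<^esub>"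
proof -
  note x = Obj_E_D[OF X] and y = Obj_E_D[OF Y]
  show ?thesis
    using X Y zero_arr x(1) y(1) Comp_zero_right[OF y(3)] Comp_zero_left[OF x(3)]
      functor_zero[OF action_additive] action_obj
    unfolding arr_E by simp
qed

lemma Comp_arr_E:
  assumes "arr E X Y f" "arr E Y Z g"
  shows "arr E X Z (g \<star> f)"
  unfolding arr_E
proof (intro conjI ballI)
  note f = arr_E_D[OF assms(1)] and g = arr_E_D[OF assms(2)]
  show "X \<in> Obj E" "Z \<in> Obj E" by (fact f g)+
  show "arr T (fst X) (fst Z) (g \<star> f)" by (rule Comp_arr[OF f(3) g(3)])
  fix h assume h: "h \<in> carrier G"
  note x = Obj_E_D(3)[OF f(1) h] and y = Obj_E_D(3)[OF f(2) h] and z = Obj_E_D(3)[OF g(2) h]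
  show "snd Z h \<star> (g \<star> f) = fmor (\<phi> h) (g \<star> f) \<star> snd X h"
    using Comp_assoc[OF f(3) g(3) z] Comp_assoc[OF f(3) y action_arr[OF h g(3)]]
      Comp_assoc[OF x action_arr[OF h f(3)] action_arr[OF h g(3)]] f(4)[OF h] g(4)[OF h]
      action_Comp[OF h f(3) g(3)] by simp
qed

lemma add_arr_E:
  assumes "arr E X Y f" "arr E X Y g"
  shows "arr E X Y (f \<oplus>\<^bsub>Hom T (fst X) (fst Y)\<^esub> g)"
  unfolding arr_E
proof (intro conjI ballI)
  note f = arr_E_D[OF assms(1)] and g = arr_E_D[OF assms(2)]
  show "X \<in> Obj E" "Y \<in> Obj E" by (fact f)+
  show "arr T (fst X) (fst Y) (f \<oplus>\<^bsub>Hom T (fst X) (fst Y)\<^esub> g)" by (rule add_arr[OF f(3) g(3)])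
  fix h assume h: "h \<in> carrier G"
  note x = Obj_E_D(3)[OF f(1) h] and y = Obj_E_D(3)[OF f(2) h]
  show "snd Y h \<star> (f \<oplus>\<^bsub>Hom T (fst X) (fst Y)\<^esub> g) = fmor (\<phi> h) (f \<oplus>\<^bsub>Hom T (fst X) (fst Y)\<^esub> g) \<star> snd X h"
    using Comp_add_right[OF f(3) g(3) y] functor_add[OF action_additive[OF h] f(3) g(3)]
      Comp_add_left[OF x action_arr[OF h f(3)] action_arr[OF h g(3)]] f(4)[OF h] g(4)[OF h] by simp
qed

lemma uminus_arr_E:
  assumes "arr E X Y f"
  shows "arr E X Y (\<ominus>\<^bsub>Hom T (fst X) (fst Y)\<^esub> f)"
  unfolding arr_E
proof (intro conjI ballI)
  note f = arr_E_D[OF assms(1)]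
  show "X \<in> Obj E" "Y \<in> Obj E" by (fact f)+
  show "arr T (fst X) (fst Y) (\<ominus>\<^bsub>Hom T (fst X) (fst Y)\<^esub> f)" by (rule uminus_arr[OF f(3)])
  fix h assume h: "h \<in> carrier G"
  note x = Obj_E_D(3)[OF f(1) h] and y = Obj_E_D(3)[OF f(2) h]
  show "snd Y h \<star> (\<ominus>\<^bsub>Hom T (fst X) (fst Y)\<^esub> f) = fmor (\<phi> h) (\<ominus>\<^bsub>Hom T (fst X) (fst Y)\<^esub> f) \<star> snd X h"
    using Comp_uminus_right[OF f(3) y] functor_uminus[OF action_additive[OF h] f(3)]
      Comp_uminus_left[OF x action_arr[OF h f(3)]] f(4)[OF h] by simp
qed

lemma E_category: "category E"
proof
  fix X assume X: "X \<in> Obj E"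
  note x = Obj_E_D[OF X]
  show "arr E X X (Ident E X)"
    using X Ident_arr[OF x(1)] Comp_Ident[OF x(3)] Ident_Comp[OF x(3)] action_Ident[OF _ x(1)]
    unfolding arr_E by simp
next
  fix X Y Z f g assume "arr E X Y f" "arr E Y Z g"
  then show "arr E X Z (g \<star>\<^bsub>E\<^esub> f)" by (simp add: Comp_arr_E)
next
  fix X Y f assume f: "arr E X Y f"
  show "f \<star>\<^bsub>E\<^esub> Ident E X = f" using Comp_Ident[OF arr_E_D(3)[OF f]] by simp
  show "Ident E Y \<star>\<^bsub>E\<^esub> f = f" using Ident_Comp[OF arr_E_D(3)[OF f]] by simp
next
  fix X Y Z W f g h assume a: "arr E X Y f" "arr E Y Z g" "arr E Z W h"
  show "(h \<star>\<^bsub>E\<^esub> g) \<star>\<^bsub>E\<^esub> f = h \<star>\<^bsub>E\<^esub> (g \<star>\<^bsub>E\<^esub> f)"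
    using Comp_assoc[OF a[THEN arr_E_D(3)]] by simp
qed

lemma E_Hom_abelian_group:
  assumes X: "X \<in> Obj E" and Y: "Y \<in> Obj E"
  shows "abelian_group (Hom E X Y)"
proof (rule abelian_groupI)
  interpret H: abelian_group "Hom T (fst X) (fst Y)"
    by (rule Hom_abelian_group[OF Obj_E_D(1)[OF X] Obj_E_D(1)[OF Y]])
  have c: "f \<in> carrier (Hom E X Y) \<longleftrightarrow> arr E X Y f" for f
    using X Y by (simp add: arr_def)
  note sub = arr_carrier[OF arr_E_D(3)]
  show "\<zero>\<^bsub>Hom E X Y\<^esub> \<in> carrier (Hom E X Y)" using zero_arr_E[OF X Y] by (simp add: c)
  fix x assume "x \<in> carrier (Hom E X Y)"
  then have x: "arr E X Y x" by (simp add: c)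
  show "\<zero>\<^bsub>Hom E X Y\<^esub> \<oplus>\<^bsub>Hom E X Y\<^esub> x = x" using sub[OF x] by (simp add: H.l_zero)
  show "\<exists>y\<in>carrier (Hom E X Y). y \<oplus>\<^bsub>Hom E X Y\<^esub> x = \<zero>\<^bsub>Hom E X Y\<^esub>"
    using uminus_arr_E[OF x] sub[OF x]
    by (intro bexI[of _ "\<ominus>\<^bsub>Hom T (fst X) (fst Y)\<^esub> x"]) (simp_all add: c H.l_neg)
  fix y assume "y \<in> carrier (Hom E X Y)"
  then have y: "arr E X Y y" by (simp add: c)
  show "x \<oplus>\<^bsub>Hom E X Y\<^esub> y \<in> carrier (Hom E X Y)" using add_arr_E[OF x y] by (simp add: c)
  show "x \<oplus>\<^bsub>Hom E X Y\<^esub> y = y \<oplus>\<^bsub>Hom E X Y\<^esub> x" using sub[OF x] sub[OF y] by (simp add: H.a_comm)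
  fix z assume "z \<in> carrier (Hom E X Y)"
  then have z: "arr E X Y z" by (simp add: c)
  show "x \<oplus>\<^bsub>Hom E X Y\<^esub> y \<oplus>\<^bsub>Hom E X Y\<^esub> z = x \<oplus>\<^bsub>Hom E X Y\<^esub> (y \<oplus>\<^bsub>Hom E X Y\<^esub> z)"
    using sub[OF x] sub[OF y] sub[OF z] by (simp add: H.a_assoc)
qed

lemma E_preadditive: "preadditive_category E"
  using arr_E_D(3) Comp_add_left Comp_add_right
  by (intro preadditive_category.intro E_category preadditive_category_axioms.intro E_Hom_abelian_group)
    auto

text \<open>Addition and zero are record fields inherited from the original hom-group, but negation
  is a derived operation that refers to the carrier, and the carrier has shrunk. Uniqueness of
  negatives makes the two agree.\<close>

lemma E_uminus:
  assumes f: "arr E X Y f"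
  shows "\<ominus>\<^bsub>Hom E X Y\<^esub> f = \<ominus>\<^bsub>Hom T (fst X) (fst Y)\<^esub> f"
proof -
  interpret HE: abelian_group "Hom E X Y" by (rule E_Hom_abelian_group[OF arr_E_D(1,2)[OF f]])
  interpret H: abelian_group "Hom T (fst X) (fst Y)"
    using Hom_abelian_group arr_E_D(3)[OF f] by (auto simp: arr_def)
  show ?thesis
    using arr_carrier[OF f] arr_carrier[OF uminus_arr_E[OF f]] arr_carrier[OF arr_E_D(3)[OF f]]
    by (intro HE.minus_equality) (simp_all add: H.l_neg)
qed

text \<open>
  The empty family gives a zero object, a family of two the biproduct, and a single object the
  splitting of an idempotent.
\<close>

lemma equivariant_by_resolution:
  assumes fin: "finite J" and W: "W \<in> Obj T" and A: "\<And>j. j \<in> J \<Longrightarrow> A j \<in> Obj E"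
    and a: "\<And>j. j \<in> J \<Longrightarrow> arr T W (fst (A j)) (a j)"
    and b: "\<And>j. j \<in> J \<Longrightarrow> arr T (fst (A j)) W (b j)"
    and res: "(\<Oplus>\<^bsub>Hom T W W\<^esub>j\<in>J. b j \<star> a j) = Ident T W"
    and ab: "\<And>j l. \<lbrakk>j \<in> J; l \<in> J\<rbrakk> \<Longrightarrow> arr E (A j) (A l) (a l \<star> b j)"
  obtains \<theta> where "(W, \<theta>) \<in> Obj E" "\<And>j. j \<in> J \<Longrightarrow> arr E (W, \<theta>) (A j) (a j)"
    "\<And>j. j \<in> J \<Longrightarrow> arr E (A j) (W, \<theta>) (b j)"
proof -
  \<comment> \<open>The formula is forced: if the \<open>b j\<close> are to be equivariant, then
    composing \<open>\<theta> g\<close> with the resolution of the identity produces exactly these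
    terms.\<close>
  define \<theta> where "\<theta> = (\<lambda>g\<in>carrier G. \<Oplus>\<^bsub>Hom T W (fobj (\<phi> g) W)\<^esub>j\<in>J.
    fmor (\<phi> g) (b j) \<star> (snd (A j) g \<star> a j))"
  have main: "iso_arr T W (fobj (\<phi> g) W) (\<theta> g) \<and>
      (\<forall>j\<in>J. \<theta> g \<star> b j = fmor (\<phi> g) (b j) \<star> snd (A j) g \<and>
        snd (A j) g \<star> a j = fmor (\<phi> g) (a j) \<star> \<theta> g)"
    if g: "g \<in> carrier G" for g
  proof -
    let ?W = "fobj (\<phi> g) W" and ?t = "\<lambda>j. snd (A j) g"
    let ?V = "\<lambda>j. fobj (\<phi> g) (fst (A j))"
    let ?a = "\<lambda>j. fmor (\<phi> g) (a j)" and ?b = "\<lambda>j. fmor (\<phi> g) (b j)"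
    have gW: "?W \<in> Obj T" by (rule action_obj[OF g W])
    have t: "arr T (fst (A j)) (?V j) (?t j)" if "j \<in> J" for j
      by (rule Obj_E_D(3)[OF A[OF that] g])
    note pb = action_arr[OF g b] and pa = action_arr[OF g a]
    have th_eq: "\<theta> g = (\<Oplus>\<^bsub>Hom T W ?W\<^esub>j\<in>J. ?b j \<star> (?t j \<star> a j))" using g by (simp add: \<theta>_def)
    have ta: "arr T W (?V j) (?t j \<star> a j)" if "j \<in> J" for j
      by (rule Comp_arr[OF a[OF that] t[OF that]])
    have th: "arr T W ?W (\<theta> g)" unfolding th_eq by (rule finsum_arr[OF W gW Comp_arr[OF ta pb]])
    have res_g: "(\<Oplus>\<^bsub>Hom T ?W ?W\<^esub>j\<in>J. ?b j \<star> ?a j) = Ident T ?W"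
    proof -
      have "(\<Oplus>\<^bsub>Hom T ?W ?W\<^esub>j\<in>J. ?b j \<star> ?a j) = (\<Oplus>\<^bsub>Hom T ?W ?W\<^esub>j\<in>J. fmor (\<phi> g) (b j \<star> a j))"
        by (intro finsum_eq gW action_arr[OF g Comp_arr[OF a b]]) (simp_all add: action_Comp[OF g a b])
      then show ?thesis
        using functor_finsum[where A = J, OF action_additive[OF g] W W Comp_arr[OF a b], symmetric]
          res action_Ident[OF g W] by simp
    qed
    have th_b: "\<theta> g \<star> b l = ?b l \<star> ?t l" if l: "l \<in> J" for l
    proof -
      have Al: "fst (A l) \<in> Obj T" by (rule arr_source[OF b[OF l]])
      note bt = Comp_arr[OF t[OF l] pb[OF l]]
      have "\<theta> g \<star> b l = (\<Oplus>\<^bsub>Hom T (fst (A l)) ?W\<^esub>j\<in>J. (?b j \<star> (?t j \<star> a j)) \<star> b l)"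
        unfolding th_eq by (rule Comp_finsum_left[OF gW b[OF l] Comp_arr[OF ta pb]])
      also have "\<dots> = (\<Oplus>\<^bsub>Hom T (fst (A l)) ?W\<^esub>j\<in>J. (?b j \<star> ?a j) \<star> (?b l \<star> ?t l))"
      proof (rule finsum_eq[OF Al gW])
        fix j assume j: "j \<in> J"
        show "arr T (fst (A l)) ?W ((?b j \<star> ?a j) \<star> (?b l \<star> ?t l))"
          by (rule Comp_arr[OF bt Comp_arr[OF pa[OF j] pb[OF j]]])
        have "(?b j \<star> (?t j \<star> a j)) \<star> b l = ?b j \<star> (?t j \<star> (a j \<star> b l))"
          using Comp_assoc[OF b[OF l] ta[OF j] pb[OF j]] Comp_assoc[OF b[OF l] a[OF j] t[OF j]] by simp
        also have "\<dots> = ?b j \<star> ((?a j \<star> ?b l) \<star> ?t l)"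
          using arr_E_D(4)[OF ab[OF l j] g] action_Comp[OF g b[OF l] a[OF j]] by simp
        also have "\<dots> = (?b j \<star> ?a j) \<star> (?b l \<star> ?t l)"
          using Comp_assoc[OF t[OF l] pb[OF l] pa[OF j]] Comp_assoc[OF bt pa[OF j] pb[OF j]] by simp
        finally show "(?b j \<star> (?t j \<star> a j)) \<star> b l = (?b j \<star> ?a j) \<star> (?b l \<star> ?t l)" .
      qed
      also have "\<dots> = (\<Oplus>\<^bsub>Hom T ?W ?W\<^esub>j\<in>J. ?b j \<star> ?a j) \<star> (?b l \<star> ?t l)"
        by (rule Comp_finsum_left[OF gW bt Comp_arr[OF pa pb], symmetric])
      also have "\<dots> = ?b l \<star> ?t l" unfolding res_g by (rule Ident_Comp[OF bt])
      finally show ?thesis .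
    qed
    have a_th: "?t l \<star> a l = ?a l \<star> \<theta> g" if l: "l \<in> J" for l
    proof (rule eq_by_resolution_right[where V = "\<lambda>j. fst (A j)", OF res a b ta[OF l] Comp_arr[OF th pa[OF l]]])
      fix j assume j: "j \<in> J"
      show "(?t l \<star> a l) \<star> b j = (?a l \<star> \<theta> g) \<star> b j"
        using Comp_assoc[OF b[OF j] a[OF l] t[OF l]] Comp_assoc[OF b[OF j] th pa[OF l]] th_b[OF j]
          arr_E_D(4)[OF ab[OF j l] g] action_Comp[OF g b[OF j] a[OF l]]
          Comp_assoc[OF t[OF j] pb[OF j] pa[OF l]] by simp
    qed
    have "\<exists>t'. \<forall>j\<in>J. inverse_arr T (fst (A j)) (?V j) (?t j) (t' j)"
      using Obj_E_D(2)[OF A g] by (intro bchoice) (simp add: iso_arr_iff)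
    then obtain t' where inv: "\<And>j. j \<in> J \<Longrightarrow> inverse_arr T (fst (A j)) (?V j) (?t j) (t' j)" by blast
    then have t': "arr T (?V j) (fst (A j)) (t' j)" "t' j \<star> ?t j = Ident T (fst (A j))"
      "?t j \<star> t' j = Ident T (?V j)" if "j \<in> J" for j
      using that by (auto simp: inverse_arr_def)
    have ta': "arr T ?W (fst (A j)) (t' j \<star> ?a j)" if "j \<in> J" for j
      by (rule Comp_arr[OF pa[OF that] t'(1)[OF that]])
    \<comment> \<open>The same construction for the inverse structure isomorphisms, with
      \<open>\<phi> g\<close> applied to the \<open>a j\<close> instead of the
      \<open>b j\<close>.\<close>
    let ?s = "\<Oplus>\<^bsub>Hom T ?W W\<^esub>j\<in>J. b j \<star> (t' j \<star> ?a j)"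
    have s: "arr T ?W W ?s" by (rule finsum_arr[OF gW W Comp_arr[OF ta' b]])
    have "\<theta> g \<star> ?s = (\<Oplus>\<^bsub>Hom T ?W ?W\<^esub>j\<in>J. \<theta> g \<star> (b j \<star> (t' j \<star> ?a j)))"
      by (rule Comp_finsum_right[OF gW th Comp_arr[OF ta' b]])
    also have "\<dots> = (\<Oplus>\<^bsub>Hom T ?W ?W\<^esub>j\<in>J. ?b j \<star> ?a j)"
    proof (rule finsum_eq[OF gW gW Comp_arr[OF pa pb]])
      fix j assume j: "j \<in> J"
      show "\<theta> g \<star> (b j \<star> (t' j \<star> ?a j)) = ?b j \<star> ?a j"
        using Comp_assoc[OF ta'[OF j] b[OF j] th] th_b[OF j] Comp_assoc[OF ta'[OF j] t[OF j] pb[OF j]]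
          Comp_assoc[OF pa[OF j] t'(1)[OF j] t[OF j]] t'(3)[OF j] Ident_Comp[OF pa[OF j]] by simp
    qed
    finally have 1: "\<theta> g \<star> ?s = Ident T ?W" using res_g by simp
    have "?s \<star> \<theta> g = (\<Oplus>\<^bsub>Hom T W W\<^esub>j\<in>J. (b j \<star> (t' j \<star> ?a j)) \<star> \<theta> g)"
      by (rule Comp_finsum_left[OF W th Comp_arr[OF ta' b]])
    also have "\<dots> = (\<Oplus>\<^bsub>Hom T W W\<^esub>j\<in>J. b j \<star> a j)"
    proof (rule finsum_eq[OF W W Comp_arr[OF a b]])
      fix j assume j: "j \<in> J"
      show "(b j \<star> (t' j \<star> ?a j)) \<star> \<theta> g = b j \<star> a j"
        using Comp_assoc[OF th ta'[OF j] b[OF j]] Comp_assoc[OF th pa[OF j] t'(1)[OF j]]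
          a_th[OF j, symmetric] Comp_assoc[OF a[OF j] t[OF j] t'(1)[OF j]] t'(2)[OF j]
          Ident_Comp[OF a[OF j]] by simp
    qed
    finally have "?s \<star> \<theta> g = Ident T W" using res by simp
    with 1 s th th_b a_th show ?thesis by (auto simp: iso_arr_def)
  qed
  have th: "arr T W (fobj (\<phi> g) W) (\<theta> g)" if "g \<in> carrier G" for g
    using main[OF that] by (simp add: iso_arr_def)
  have cocycle: "\<theta> (h \<otimes>\<^bsub>G\<^esub> g) = \<epsilon> g h W \<star> (fmor (\<phi> g) (\<theta> h) \<star> \<theta> g)"
    if g: "g \<in> carrier G" and h: "h \<in> carrier G" for g h
  \<comment> \<open>After composition with \<open>b j\<close> both sides reduce to the cocycle
    condition of \<open>A j\<close>, transported by naturality of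
    \<open>\<epsilon> g h\<close>.\<close>
  proof (rule eq_by_resolution_right[where V = "\<lambda>j. fst (A j)", OF res a b])
    let ?W = "fobj (\<phi> g) (fobj (\<phi> h) W)"
    have hg: "h \<otimes>\<^bsub>G\<^esub> g \<in> carrier G" using g h by (rule act.m_closed[rotated])
    note e = epsilon_arr[OF g h W]
    note gth = action_arr[OF g th[OF h]]
    show "arr T W (fobj (\<phi> (h \<otimes>\<^bsub>G\<^esub> g)) W) (\<theta> (h \<otimes>\<^bsub>G\<^esub> g))" by (rule th[OF hg])
    show "arr T W (fobj (\<phi> (h \<otimes>\<^bsub>G\<^esub> g)) W) (\<epsilon> g h W \<star> (fmor (\<phi> g) (\<theta> h) \<star> \<theta> g))"
      by (rule Comp_arr[OF Comp_arr[OF th[OF g] gth] e])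
    fix j assume j: "j \<in> J"
    note bj = b[OF j] and Aj = Obj_E_D[OF A[OF j]]
    note tg = Aj(3)[OF g] and th_h = Aj(3)[OF h]
    let ?bb = "fmor (\<phi> g) (fmor (\<phi> h) (b j))" and ?t = "snd (A j)"
    note bb = action_arr[OF g action_arr[OF h bj]]
    note gt = action_arr[OF g th_h]
    have "\<theta> (h \<otimes>\<^bsub>G\<^esub> g) \<star> b j = fmor (\<phi> (h \<otimes>\<^bsub>G\<^esub> g)) (b j) \<star> ?t (h \<otimes>\<^bsub>G\<^esub> g)"
      using main[OF hg] j by blast
    also have "\<dots> = (fmor (\<phi> (h \<otimes>\<^bsub>G\<^esub> g)) (b j) \<star> \<epsilon> g h (fst (A j))) \<star> (fmor (\<phi> g) (?t h) \<star> ?t g)"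
      unfolding Aj(4)[OF g h]
      by (rule Comp_assoc[OF Comp_arr[OF tg gt] epsilon_arr[OF g h Aj(1)] action_arr[OF hg bj], symmetric])
    also have "\<dots> = \<epsilon> g h W \<star> (?bb \<star> (fmor (\<phi> g) (?t h) \<star> ?t g))"
      unfolding epsilon_natural[OF g h bj, symmetric] by (rule Comp_assoc[OF Comp_arr[OF tg gt] bb e])
    also have "?bb \<star> (fmor (\<phi> g) (?t h) \<star> ?t g) = fmor (\<phi> g) (fmor (\<phi> h) (b j) \<star> ?t h) \<star> ?t g"
      using Comp_assoc[OF tg gt bb] action_Comp[OF g th_h action_arr[OF h bj]] by simp
    also have "fmor (\<phi> h) (b j) \<star> ?t h = \<theta> h \<star> b j" using main[OF h] j by auto
    also have "fmor (\<phi> g) (\<theta> h \<star> b j) \<star> ?t g = fmor (\<phi> g) (\<theta> h) \<star> (\<theta> g \<star> b j)"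
      using action_Comp[OF g bj th[OF h]] Comp_assoc[OF tg action_arr[OF g bj] gth] main[OF g] j by auto
    also have "\<epsilon> g h W \<star> (fmor (\<phi> g) (\<theta> h) \<star> (\<theta> g \<star> b j)) = (\<epsilon> g h W \<star> (fmor (\<phi> g) (\<theta> h) \<star> \<theta> g)) \<star> b j"
      using Comp_assoc[OF bj th[OF g] gth] Comp_assoc[OF bj Comp_arr[OF th[OF g] gth] e] by simp
    finally show "\<theta> (h \<otimes>\<^bsub>G\<^esub> g) \<star> b j = (\<epsilon> g h W \<star> (fmor (\<phi> g) (\<theta> h) \<star> \<theta> g)) \<star> b j" .
  qed
  have W_E: "(W, \<theta>) \<in> Obj E"
    using W main cocycle by (simp add: Obj_E \<theta>_def)
  then show thesis
    using that A a b main by (simp add: arr_E)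
qed

section \<open>Zero object, biproducts and split idempotents\<close>

lemma E_ex_zero_object: "\<exists>N. zero_object E N"
proof -
  interpret E: preadditive_category E by (rule E_preadditive)
  obtain N where N: "zero_object T N" using ex_zero_object by blast
  then have NO: "N \<in> Obj T" "Ident T N = \<zero>\<^bsub>Hom T N N\<^esub>" by (auto simp: zero_object_iff)
  interpret H: abelian_group "Hom T N N" by (rule Hom_abelian_group[OF NO(1,1)])
  obtain \<theta> where "(N, \<theta>) \<in> Obj E"
    \<comment> \<open>Over the empty family the objects and arrows are never evaluated, and the
      resolution of the identity says that the identity of \<open>N\<close> is zero.\<close>
    by (rule equivariant_by_resolution[of "{}" N undefined undefined undefined]) (simp_all add: NO)
  then show ?thesis using NO by (auto simp: E.zero_object_iff)
qed

text \<open>Identities and zero arrows are those of the original category. It is required because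
  axiom (1b) ranges over every zero object, not only over the one constructed.\<close>

lemma zero_object_E:
  assumes "zero_object E N"
  shows "zero_object T (fst N)"
proof -
  interpret E: preadditive_category E by (rule E_preadditive)
  show ?thesis using assms by (simp add: E.zero_object_iff zero_object_iff Obj_E)
qed

lemma E_additive: "additive_category E"
proof (intro additive_category.intro E_preadditive additive_category_axioms.intro E_ex_zero_object)
  interpret E: category E by (rule E_category)
  fix X Y assume X: "X \<in> Obj E" and Y: "Y \<in> Obj E"
  note x = Obj_E_D[OF X] and y = Obj_E_D[OF Y]
  obtain W i j p q where i: "arr T (fst X) W i" and j: "arr T (fst Y) W j"
    and p: "arr T W (fst X) p" and q: "arr T W (fst Y) q"
    and eqs: "p \<star> i = Ident T (fst X)" "q \<star> j = Ident T (fst Y)"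
      "q \<star> i = \<zero>\<^bsub>Hom T (fst X) (fst Y)\<^esub>" "p \<star> j = \<zero>\<^bsub>Hom T (fst Y) (fst X)\<^esub>"
      "(i \<star> p) \<oplus>\<^bsub>Hom T W W\<^esub> (j \<star> q) = Ident T W"
    using ex_biproduct[OF x(1) y(1)] by blast
  have W: "W \<in> Obj T" using i by (simp add: arr_def)
  interpret H: abelian_group "Hom T W W" by (rule Hom_abelian_group[OF W W])
  let ?A = "\<lambda>l. if l then X else Y" and ?a = "\<lambda>l. if l then p else q" and ?b = "\<lambda>l. if l then i else j"
  have "i \<star> p \<in> carrier (Hom T W W)" "j \<star> q \<in> carrier (Hom T W W)"
    using Comp_arr[OF p i] Comp_arr[OF q j] by (auto intro: arr_carrier)
  then have sum: "(\<Oplus>\<^bsub>Hom T W W\<^esub>l\<in>{True, False}. ?b l \<star> ?a l) = Ident T W"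
    using eqs(5) by (simp add: H.finsum_insert H.r_zero)
  have IX: "arr E X X (Ident T (fst X))" and IY: "arr E Y Y (Ident T (fst Y))"
    using E.Ident_arr[OF X] E.Ident_arr[OF Y] by simp_all
  obtain \<theta> where \<theta>: "(W, \<theta>) \<in> Obj E" "\<And>l. l \<in> {True, False} \<Longrightarrow> arr E (W, \<theta>) (?A l) (?a l)"
    "\<And>l. l \<in> {True, False} \<Longrightarrow> arr E (?A l) (W, \<theta>) (?b l)"
  proof (rule equivariant_by_resolution[where J = "{True, False}" and W = W and A = ?A and a = ?a and b = ?b])
    fix l m
    show "arr E (?A l) (?A m) (?a m \<star> ?b l)"
      using eqs IX IY zero_arr_E[OF X Y] zero_arr_E[OF Y X] by simp
  qed (use X Y W i j p q sum in auto)
  from \<theta>(2)[of True] \<theta>(2)[of False] \<theta>(3)[of True] \<theta>(3)[of False] eqs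
  show "\<exists>W i j p q. arr E X W i \<and> arr E Y W j \<and> arr E W X p \<and> arr E W Y q \<and>
      p \<star>\<^bsub>E\<^esub> i = Ident E X \<and> q \<star>\<^bsub>E\<^esub> j = Ident E Y \<and>
      q \<star>\<^bsub>E\<^esub> i = \<zero>\<^bsub>Hom E X Y\<^esub> \<and> p \<star>\<^bsub>E\<^esub> j = \<zero>\<^bsub>Hom E Y X\<^esub> \<and>
      (i \<star>\<^bsub>E\<^esub> p) \<oplus>\<^bsub>Hom E W W\<^esub> (j \<star>\<^bsub>E\<^esub> q) = Ident E W"
    by (intro exI[of _ "(W, \<theta>)"] exI[of _ i] exI[of _ j] exI[of _ p] exI[of _ q]) simp
qed

lemma E_idempotent_complete:
  assumes "idempotent_complete T"
  shows "idempotent_complete E"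
  unfolding idempotent_complete_def
proof (intro allI impI)
  fix X e assume "arr E X X e \<and> e \<star>\<^bsub>E\<^esub> e = e"
  then have e: "arr E X X e" and ee: "e \<star> e = e" by auto
  note eT = arr_E_D[OF e]
  obtain Y p i where p: "arr T (fst X) Y p" and i: "arr T Y (fst X) i"
    and pi: "p \<star> i = Ident T Y" and ip: "i \<star> p = e"
    using assms eT(3) ee unfolding idempotent_complete_def by blast
  have Y: "Y \<in> Obj T" using p by (simp add: arr_def)
  interpret H: abelian_group "Hom T Y Y" by (rule Hom_abelian_group[OF Y Y])
  obtain \<theta> where "(Y, \<theta>) \<in> Obj E" "\<And>j. j \<in> {()} \<Longrightarrow> arr E (Y, \<theta>) X i"
    "\<And>j. j \<in> {()} \<Longrightarrow> arr E X (Y, \<theta>) p"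
  proof (rule equivariant_by_resolution[where J = "{()}" and W = Y and A = "\<lambda>_. X" and a = "\<lambda>_. i" and b = "\<lambda>_. p"])
    show "(\<Oplus>\<^bsub>Hom T Y Y\<^esub>j\<in>{()}. p \<star> i) = Ident T Y"
      using pi arr_carrier[OF Ident_arr[OF Y]] by (simp add: H.finsum_insert H.r_zero)
  qed (use Y eT(1) i p ip e in auto)
  with pi ip show "\<exists>Y p i. arr E X Y p \<and> arr E Y X i \<and> p \<star>\<^bsub>E\<^esub> i = Ident E Y \<and> i \<star>\<^bsub>E\<^esub> p = e"
    by (intro exI[of _ "(Y, \<theta>)"] exI[of _ p] exI[of _ i]) simp
qed

text \<open>Each condition on an equivariant object or morphism is carried through \<open>K\<close>
  by strict commutation with the action and with \<open>\<epsilon>\<close>. The general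
  \<open>K\<close> covers both the shift and its inverse.\<close>

lemma equivariant_lift_functor:
  assumes K: "is_functor T T K"
    and Kobj: "\<And>g X. \<lbrakk>g \<in> carrier G; X \<in> Obj T\<rbrakk> \<Longrightarrow> fobj (\<phi> g) (fobj K X) = fobj K (fobj (\<phi> g) X)"
    and Kmor: "\<And>g X Y f. \<lbrakk>g \<in> carrier G; arr T X Y f\<rbrakk> \<Longrightarrow> fmor (\<phi> g) (fmor K f) = fmor K (fmor (\<phi> g) f)"
    and Keps: "\<And>g h X. \<lbrakk>g \<in> carrier G; h \<in> carrier G; X \<in> Obj T\<rbrakk> \<Longrightarrow> \<epsilon> g h (fobj K X) = fmor K (\<epsilon> g h X)"
  shows "is_functor E E (equivariant_shift K G)"
proof -
  let ?K = "equivariant_shift K G"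
  have simps: "fst (fobj ?K X) = fobj K (fst X)" "fmor ?K = fmor K"
    "g \<in> carrier G \<Longrightarrow> snd (fobj ?K X) g = fmor K (snd X g)" for X g
    by (auto simp: equivariant_shift_def split: prod.split)
  have obj: "fobj ?K X \<in> Obj E" if X: "X \<in> Obj E" for X
  proof -
    note x = Obj_E_D[OF X]
    have "snd (fobj ?K X) \<in> extensional (carrier G)"
      by (auto simp: equivariant_shift_def split: prod.split)
    moreover have "iso_arr T (fobj K (fst X)) (fobj (\<phi> g) (fobj K (fst X))) (fmor K (snd X g))"
      if g: "g \<in> carrier G" for g
      using functor_iso_arr[OF K x(2)[OF g]] Kobj[OF g x(1)] by simp
    moreover have "fmor K (snd X (h \<otimes>\<^bsub>G\<^esub> g))
        = \<epsilon> g h (fobj K (fst X)) \<star> (fmor (\<phi> g) (fmor K (snd X h)) \<star> fmor K (snd X g))"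
      if g: "g \<in> carrier G" and h: "h \<in> carrier G" for g h
    proof -
      note xg = x(3)[OF g] and xh = action_arr[OF g x(3)[OF h]]
      show ?thesis
        using x(4)[OF g h] functor_Comp[OF K Comp_arr[OF xg xh] epsilon_arr[OF g h x(1)]]
          functor_Comp[OF K xg xh] Kmor[OF g x(3)[OF h]] Keps[OF g h x(1)] by simp
    qed
    ultimately show ?thesis
      using functor_obj[OF K x(1)] act.m_closed unfolding Obj_E by (simp add: simps)
  qed
  have arr: "arr E (fobj ?K X) (fobj ?K Y) (fmor K f)" if f: "arr E X Y f" for X Y f
  proof -
    note fE = arr_E_D[OF f]
    have "fmor K (snd Y g) \<star> fmor K f = fmor (\<phi> g) (fmor K f) \<star> fmor K (snd X g)"
      if g: "g \<in> carrier G" for g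
      using functor_Comp[OF K fE(3) Obj_E_D(3)[OF fE(2) g]] fE(4)[OF g]
        functor_Comp[OF K Obj_E_D(3)[OF fE(1) g] action_arr[OF g fE(3)]] Kmor[OF g fE(3)] by simp
    then show ?thesis
      using obj fE functor_arr[OF K fE(3)] by (simp add: arr_E simps)
  qed
  show ?thesis
    unfolding is_functor_def
    using obj arr functor_Ident[OF K] functor_Comp[OF K arr_E_D(3) arr_E_D(3)]
    by (auto simp: simps Obj_E_D(1))
qed

lemma SE_simps [simp]: "fst (fobj SE X) = fobj S (fst X)" "fmor SE = fmor S"
  "g \<in> carrier G \<Longrightarrow> snd (fobj SE X) g = fmor S (snd X g)"
  by (auto simp: equivariant_shift_def split: prod.split)

lemma SE_functor: "is_functor E E SE"
  by (rule equivariant_lift_functor[OF shift_functor action_shift_obj action_shift_mor epsilon_shift])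

lemma SE_obj: "X \<in> Obj E \<Longrightarrow> fobj SE X \<in> Obj E"
  by (rule functor_obj[OF SE_functor])

lemma SE_arr: "arr E X Y f \<Longrightarrow> arr E (fobj SE X) (fobj SE Y) (fmor S f)"
  using functor_arr[OF SE_functor] by simp

text \<open>The inverse \<open>H\<close> of the shift commutes strictly with the action as well:
  apply the commutation of the shift to the image under \<open>H\<close> and cancel. That the lifted
  functors are inverse to each other on objects on the nose uses the extensionality of the families
  \<open>\<theta>\<close>.\<close>

lemma SE_automorphism: "automorphism E SE"
proof -
  obtain H where H: "is_functor T T H"
    and obj: "\<And>X. X \<in> Obj T \<Longrightarrow> fobj H (fobj S X) = X" "\<And>X. X \<in> Obj T \<Longrightarrow> fobj S (fobj H X) = X"
    and mor: "\<And>X Y f. arr T X Y f \<Longrightarrow> fmor H (fmor S f) = f" "\<And>X Y f. arr T X Y f \<Longrightarrow> fmor S (fmor H f) = f"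
    using shift_automorphism unfolding automorphism_def by metis
  have Hobj: "fobj (\<phi> g) (fobj H X) = fobj H (fobj (\<phi> g) X)" if "g \<in> carrier G" "X \<in> Obj T" for g X
    using that obj action_shift_obj[OF that(1) functor_obj[OF H that(2)]] action_obj functor_obj[OF H]
    by metis
  have Hmor: "fmor (\<phi> g) (fmor H f) = fmor H (fmor (\<phi> g) f)" if "g \<in> carrier G" "arr T X Y f" for g X Y f
    using that mor action_shift_mor[OF that(1) functor_arr[OF H that(2)]]
      action_arr[OF that(1) functor_arr[OF H that(2)]] by metis
  have Heps: "\<epsilon> g h (fobj H X) = fmor H (\<epsilon> g h X)"
    if "g \<in> carrier G" "h \<in> carrier G" "X \<in> Obj T" for g h X
    using that mor(1)[OF epsilon_arr[OF that(1,2) functor_obj[OF H that(3)]]]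
      epsilon_shift[OF that(1,2) functor_obj[OF H that(3)]] obj(2) by simp
  let ?H = "equivariant_shift H G"
  have simps: "fobj ?H X = (fobj H (fst X), \<lambda>g\<in>carrier G. fmor H (snd X g))"
    "fobj SE X = (fobj S (fst X), \<lambda>g\<in>carrier G. fmor S (snd X g))" "fmor ?H = fmor H" for X
    by (auto simp: equivariant_shift_def split: prod.split)
  have "fobj ?H (fobj SE X) = X \<and> fobj SE (fobj ?H X) = X" if X: "X \<in> Obj E" for X
  proof -
    note x = Obj_E_D[OF X]
    have "snd X \<in> extensional (carrier G)" using X by (simp add: Obj_E)
    then have "(\<lambda>g\<in>carrier G. fmor H ((\<lambda>g\<in>carrier G. fmor S (snd X g)) g)) = snd X"
      "(\<lambda>g\<in>carrier G. fmor S ((\<lambda>g\<in>carrier G. fmor H (snd X g)) g)) = snd X"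
      using mor[OF x(3)] by (auto intro!: extensionalityI[where A = "carrier G"])
    then show ?thesis
      using obj x(1) by (simp add: simps prod_eq_iff)
  qed
  moreover have "fmor ?H (fmor SE f) = f \<and> fmor SE (fmor ?H f) = f" if "arr E X Y f" for X Y f
    using mor[OF arr_E_D(3)[OF that]] by (simp add: simps)
  moreover have "is_functor E E ?H" by (rule equivariant_lift_functor[OF H Hobj Hmor Heps])
  ultimately show ?thesis unfolding automorphism_def using SE_functor by blast
qed

lemma E_suspended: "suspended_category E SE"
  by (intro suspended_category.intro E_additive suspended_category_axioms.intro SE_automorphism)

end

section \<open>Averaging\<close>

context linear_category
begin

lemma numeral_smult:
  assumes f: "arr C X Y f"
  shows "add_pow k (n::nat) \<one>\<^bsub>k\<^esub> \<odot>\<^bsub>Hom C X Y\<^esub> f = add_pow (Hom C X Y) n f"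
proof -
  interpret H: abelian_group "Hom C X Y" using Hom_abelian_group f by (auto simp: arr_def)
  note fc = arr_carrier[OF f]
  have z: "\<zero>\<^bsub>k\<^esub> \<odot>\<^bsub>Hom C X Y\<^esub> f = \<zero>\<^bsub>Hom C X Y\<^esub>"
  proof -
    let ?z = "\<zero>\<^bsub>k\<^esub> \<odot>\<^bsub>Hom C X Y\<^esub> f"
    have "?z \<in> carrier (Hom C X Y)" using smult_arr[OF _ f] by (auto intro: arr_carrier)
    moreover have "?z = ?z \<oplus>\<^bsub>Hom C X Y\<^esub> ?z" using smult_add_scalar[OF _ _ f, of "\<zero>\<^bsub>k\<^esub>" "\<zero>\<^bsub>k\<^esub>"] by simp
    ultimately show ?thesis by simp
  qed
  show ?thesis
    by (induction n)
      (use z fc smult_add_scalar[OF _ _ f] smult_one[OF f] in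
        \<open>simp_all add: add.nat_pow_Suc H.add.nat_pow_Suc\<close>)
qed

text \<open>A constant sum over \<open>A\<close> is multiplication by the scalar
  \<open>card A\<close>, whose inverse can be applied after or before summing. The second form
  expresses division through addition alone, which additive functors see.\<close>

lemma unit_smult_finsum_const:
  assumes unit: "add_pow k (card A) \<one>\<^bsub>k\<^esub> \<in> Units k" and f: "arr C X Y f"
  shows "inv\<^bsub>k\<^esub> (add_pow k (card A) \<one>\<^bsub>k\<^esub>) \<odot>\<^bsub>Hom C X Y\<^esub> (\<Oplus>\<^bsub>Hom C X Y\<^esub>a\<in>A. f) = f"
    and "(\<Oplus>\<^bsub>Hom C X Y\<^esub>a\<in>A. inv\<^bsub>k\<^esub> (add_pow k (card A) \<one>\<^bsub>k\<^esub>) \<odot>\<^bsub>Hom C X Y\<^esub> f) = f"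
proof -
  interpret H: abelian_group "Hom C X Y" using Hom_abelian_group f by (auto simp: arr_def)
  let ?n = "add_pow k (card A) \<one>\<^bsub>k\<^esub>"
  have n: "?n \<in> carrier k" "inv\<^bsub>k\<^esub> ?n \<in> carrier k" using unit by auto
  have const: "(\<Oplus>\<^bsub>Hom C X Y\<^esub>a\<in>A. g) = ?n \<odot>\<^bsub>Hom C X Y\<^esub> g" if "arr C X Y g" for g
    using H.add.finprod_const[OF arr_carrier[OF that], of A] numeral_smult[OF that] by simp
  show "inv\<^bsub>k\<^esub> ?n \<odot>\<^bsub>Hom C X Y\<^esub> (\<Oplus>\<^bsub>Hom C X Y\<^esub>a\<in>A. f) = f"
    using const[OF f] smult_mult[OF n(2,1) f] smult_one[OF f] Units_l_inv[OF unit] by simp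
  show "(\<Oplus>\<^bsub>Hom C X Y\<^esub>a\<in>A. inv\<^bsub>k\<^esub> ?n \<odot>\<^bsub>Hom C X Y\<^esub> f) = f"
    using const[OF smult_arr[OF n(2) f]] smult_mult[OF n f] smult_one[OF f] Units_r_inv[OF unit] by simp
qed

end

context equivariant_setting
begin

definition scale :: "'o \<Rightarrow> 'o \<Rightarrow> 'm \<Rightarrow> 'm" where
  "scale X Y f = inv\<^bsub>k\<^esub> (add_pow k (order G) \<one>\<^bsub>k\<^esub>) \<odot>\<^bsub>Hom T X Y\<^esub> f"

lemma scale_arr: "arr T X Y f \<Longrightarrow> arr T X Y (scale X Y f)"
  unfolding scale_def using order_Unit by (intro lin.smult_arr) auto

lemma scale_finsum_const: "arr T X Y f \<Longrightarrow> scale X Y (\<Oplus>\<^bsub>Hom T X Y\<^esub>g\<in>carrier G. f) = f"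
  and finsum_const_scale: "arr T X Y f \<Longrightarrow> (\<Oplus>\<^bsub>Hom T X Y\<^esub>g\<in>carrier G. scale X Y f) = f"
  using lin.unit_smult_finsum_const[of "carrier G" X Y f] order_Unit
  unfolding scale_def order_def by auto

lemma scale_Comp_left: "\<lbrakk>arr T X Y f; arr T Y Z g\<rbrakk> \<Longrightarrow> scale Y Z g \<star> f = scale X Z (g \<star> f)"
  and scale_Comp_right: "\<lbrakk>arr T X Y f; arr T Y Z g\<rbrakk> \<Longrightarrow> g \<star> scale X Y f = scale X Z (g \<star> f)"
  unfolding scale_def using order_Unit by (auto intro!: lin.smult_Comp_left lin.smult_Comp_right)

text \<open>
  Division by the order of \<open>G\<close> is determined by the addition, so additive functors commute with it.
\<close>

lemma functor_scale:
  assumes F: "additive_functor T F" and f: "arr T X Y f"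
  shows "fmor F (scale X Y f) = scale (fobj F X) (fobj F Y) (fmor F f)"
proof -
  have XY: "X \<in> Obj T" "Y \<in> Obj T" using f by (auto simp: arr_def)
  note Ff = functor_arr[OF additive_functor_is_functor[OF F] scale_arr[OF f]]
  have "fmor F f = fmor F (\<Oplus>\<^bsub>Hom T X Y\<^esub>g\<in>carrier G. scale X Y f)"
    using finsum_const_scale[OF f] by simp
  also have "\<dots> = (\<Oplus>\<^bsub>Hom T (fobj F X) (fobj F Y)\<^esub>g\<in>carrier G. fmor F (scale X Y f))"
    by (rule functor_finsum[OF F XY scale_arr[OF f]])
  finally show ?thesis using scale_finsum_const[OF Ff] by simp
qed

section \<open>Traces of morphisms between equivariant objects\<close>

definition struct_inv :: "'o \<times> ('g \<Rightarrow> 'm) \<Rightarrow> 'g \<Rightarrow> 'm" where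
  "struct_inv X g = (SOME t. inverse_arr T (fst X) (fobj (\<phi> g) (fst X)) (snd X g) t)"

lemma struct_inv:
  assumes "X \<in> Obj E" "g \<in> carrier G"
  shows "inverse_arr T (fst X) (fobj (\<phi> g) (fst X)) (snd X g) (struct_inv X g)"
  using someI_ex[of "inverse_arr T (fst X) (fobj (\<phi> g) (fst X)) (snd X g)"] Obj_E_D(2)[OF assms]
  unfolding struct_inv_def iso_arr_iff by blast

lemma struct_inv_D:
  assumes "X \<in> Obj E" "g \<in> carrier G"
  shows "arr T (fobj (\<phi> g) (fst X)) (fst X) (struct_inv X g)"
    and "struct_inv X g \<star> snd X g = Ident T (fst X)"
    and "snd X g \<star> struct_inv X g = Ident T (fobj (\<phi> g) (fst X))"
  using struct_inv[OF assms] by (auto simp: inverse_arr_def)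

lemma struct_inv_natural:
  assumes f: "arr E X Y f" and g: "g \<in> carrier G"
  shows "struct_inv Y g \<star> fmor (\<phi> g) f = f \<star> struct_inv X g"
proof -
  note fE = arr_E_D[OF f]
  note x = struct_inv_D[OF fE(1) g] and y = struct_inv_D[OF fE(2) g] and tx = Obj_E_D(3)[OF fE(1) g]
    and ty = Obj_E_D(3)[OF fE(2) g] and pf = action_arr[OF g fE(3)]
  show ?thesis
  proof (rule inverse_arr_right_cancel[OF struct_inv[OF fE(1) g] Comp_arr[OF pf y(1)] Comp_arr[OF x(1) fE(3)]])
    show "(struct_inv Y g \<star> fmor (\<phi> g) f) \<star> snd X g = (f \<star> struct_inv X g) \<star> snd X g"
      using Comp_assoc[OF tx pf y(1)] Comp_assoc[OF tx x(1) fE(3)] fE(4)[OF g, symmetric] x(2)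
        Comp_assoc[OF fE(3) ty y(1)] y(2) Ident_Comp[OF fE(3)] Comp_Ident[OF fE(3)] by simp
  qed
qed

lemma struct_inv_shift:
  assumes X: "X \<in> Obj E" and g: "g \<in> carrier G"
  shows "struct_inv (fobj SE X) g = fmor S (struct_inv X g)"
proof (rule inverse_arr_unique)
  show "inverse_arr T (fobj S (fst X)) (fobj S (fobj (\<phi> g) (fst X))) (fmor S (snd X g)) (struct_inv (fobj SE X) g)"
    using struct_inv[OF SE_obj[OF X] g] action_shift_obj[OF g Obj_E_D(1)[OF X]] g by simp
  show "inverse_arr T (fobj S (fst X)) (fobj S (fobj (\<phi> g) (fst X))) (fmor S (snd X g)) (fmor S (struct_inv X g))"
    by (rule functor_inverse_arr[OF shift_functor struct_inv[OF X g]])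
qed

text \<open>The relative trace, or transfer: the sum of the conjugates
  \<open>\<theta>_g^{-1} \<phi>_g(f) \<theta>_g\<close>.\<close>

definition trace :: "'o \<times> ('g \<Rightarrow> 'm) \<Rightarrow> 'o \<times> ('g \<Rightarrow> 'm) \<Rightarrow> 'm \<Rightarrow> 'm" where
  "trace X Y f = (\<Oplus>\<^bsub>Hom T (fst X) (fst Y)\<^esub>g\<in>carrier G.
     struct_inv Y g \<star> (fmor (\<phi> g) f \<star> snd X g))"

lemma trace_term_arr:
  assumes "X \<in> Obj E" "Y \<in> Obj E" "arr T (fst X) (fst Y) f" "g \<in> carrier G"
  shows "arr T (fst X) (fst Y) (struct_inv Y g \<star> (fmor (\<phi> g) f \<star> snd X g))"
  using assms struct_inv_D(1) Obj_E_D(3) action_arr by (blast intro: Comp_arr)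

lemma right_mult_image:
  assumes h: "h \<in> carrier G"
  shows "(\<lambda>g. g \<otimes>\<^bsub>G\<^esub> h) ` carrier G = carrier G" "inj_on (\<lambda>g. g \<otimes>\<^bsub>G\<^esub> h) (carrier G)"
proof -
  show "(\<lambda>g. g \<otimes>\<^bsub>G\<^esub> h) ` carrier G = carrier G"
  proof
    show "carrier G \<subseteq> (\<lambda>g. g \<otimes>\<^bsub>G\<^esub> h) ` carrier G"
    proof
      fix x assume "x \<in> carrier G"
      then have "x = (x \<otimes>\<^bsub>G\<^esub> inv\<^bsub>G\<^esub> h) \<otimes>\<^bsub>G\<^esub> h" "x \<otimes>\<^bsub>G\<^esub> inv\<^bsub>G\<^esub> h \<in> carrier G"
        using h by (simp_all add: act.m_assoc)
      then show "x \<in> (\<lambda>g. g \<otimes>\<^bsub>G\<^esub> h) ` carrier G" by blast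
    qed
  qed (use h in auto)
  show "inj_on (\<lambda>g. g \<otimes>\<^bsub>G\<^esub> h) (carrier G)" using h by (auto simp: inj_on_def)
qed

text \<open>Passing the structure isomorphism at \<open>h\<close> through the sum turns the term at
  \<open>g\<close> into the term at \<open>g \<otimes> h\<close>, and right multiplication by
  \<open>h\<close> permutes the group.\<close>

lemma trace_arr_E:
  assumes X: "X \<in> Obj E" and Y: "Y \<in> Obj E" and f: "arr T (fst X) (fst Y) f"
  shows "arr E X Y (trace X Y f)"
proof -
  note xo = Obj_E_D(1)[OF X] and yo = Obj_E_D(1)[OF Y]
  let ?c = "\<lambda>g. struct_inv Y g \<star> (fmor (\<phi> g) f \<star> snd X g)"
  note c_arr = trace_term_arr[OF X Y f]
  have tr: "arr T (fst X) (fst Y) (trace X Y f)"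
    unfolding trace_def by (rule finsum_arr[OF xo yo c_arr])
  have "snd Y h \<star> trace X Y f = fmor (\<phi> h) (trace X Y f) \<star> snd X h" if h: "h \<in> carrier G" for h
  proof -
    let ?Y = "fobj (\<phi> h) (fst Y)"
    note tx = Obj_E_D(3)[OF X h] and ty = Obj_E_D(3)[OF Y h]
    have hY: "?Y \<in> Obj T" by (rule action_obj[OF h yo])
    interpret H: abelian_group "Hom T (fst X) ?Y" by (rule Hom_abelian_group[OF xo hY])
    have key: "fmor (\<phi> h) (?c g) \<star> snd X h = snd Y h \<star> ?c (g \<otimes>\<^bsub>G\<^esub> h)" if g: "g \<in> carrier G" for g
    proof -
      have gh: "g \<otimes>\<^bsub>G\<^esub> h \<in> carrier G" using g h by simp
      note e_x = epsilon_arr[OF h g xo] and e_y = epsilon_arr[OF h g yo]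
      note si = struct_inv_D[OF Y g] and si_gh = struct_inv_D[OF Y gh]
      note txg = Obj_E_D(3)[OF X g] and tyg = Obj_E_D(3)[OF Y g]
      note pf = action_arr[OF g f]
      note ppf = action_arr[OF h pf] and ptx = action_arr[OF h txg] and psi = action_arr[OF h si(1)]
        and pty = action_arr[OF h tyg]
      note p = Comp_arr[OF e_y si_gh(1)]
      \<comment> \<open>The cocycle condition of \<open>Y\<close> at \<open>g \<otimes> h\<close>,
        solved for the inverses. It is checked after composition with two invertible arrows, so that
        the condition is used in its original form.\<close>
      have inv_eq: "snd Y h \<star> (struct_inv Y (g \<otimes>\<^bsub>G\<^esub> h) \<star> \<epsilon> h g (fst Y)) = fmor (\<phi> h) (struct_inv Y g)"
      proof (rule inverse_arr_right_cancel[OF functor_inverse_arr[OF action_functor[OF h] struct_inv[OF Y g]]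
            Comp_arr[OF p ty] psi])
        let ?p = "struct_inv Y (g \<otimes>\<^bsub>G\<^esub> h) \<star> \<epsilon> h g (fst Y)"
        let ?q = "fmor (\<phi> h) (snd Y g)"
        note py = Comp_arr[OF p ty]
        have "(snd Y h \<star> ?p) \<star> ?q = Ident T ?Y"
        proof (rule inverse_arr_right_cancel[OF struct_inv[OF Y h] Comp_arr[OF pty py] Ident_arr[OF hY]])
          have "((snd Y h \<star> ?p) \<star> ?q) \<star> snd Y h = snd Y h \<star> (?p \<star> (?q \<star> snd Y h))"
            using Comp_assoc[OF ty pty py] Comp_assoc[OF Comp_arr[OF ty pty] p ty] by simp
          also have "?p \<star> (?q \<star> snd Y h) = Ident T (fst Y)"
            using Comp_assoc[OF Comp_arr[OF ty pty] e_y si_gh(1)] Obj_E_D(4)[OF Y h g] si_gh(2) by simp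
          finally show "((snd Y h \<star> ?p) \<star> ?q) \<star> snd Y h = Ident T ?Y \<star> snd Y h"
            using Comp_Ident[OF ty] Ident_Comp[OF ty] by simp
        qed
        then show "(snd Y h \<star> ?p) \<star> ?q = fmor (\<phi> h) (struct_inv Y g) \<star> ?q"
          using action_Comp[OF h tyg si(1)] si(2) action_Ident[OF h yo] by simp
      qed
      let ?R = "fmor (\<phi> h) (fmor (\<phi> g) f) \<star> (fmor (\<phi> h) (snd X g) \<star> snd X h)"
      note r = Comp_arr[OF tx ptx]
      note R = Comp_arr[OF r ppf]
      have "fmor (\<phi> h) (?c g) \<star> snd X h = fmor (\<phi> h) (struct_inv Y g) \<star> ?R"
        using action_Comp[OF h Comp_arr[OF txg pf] si(1)] action_Comp[OF h txg pf]
          Comp_assoc[OF tx Comp_arr[OF ptx ppf] psi] Comp_assoc[OF tx ptx ppf] by simp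
      also have "\<dots> = snd Y h \<star> (struct_inv Y (g \<otimes>\<^bsub>G\<^esub> h) \<star> (\<epsilon> h g (fst Y) \<star> ?R))"
        unfolding inv_eq[symmetric]
        using Comp_assoc[OF R p ty] Comp_assoc[OF R e_y si_gh(1)] by simp
      also have "\<epsilon> h g (fst Y) \<star> ?R = fmor (\<phi> (g \<otimes>\<^bsub>G\<^esub> h)) f \<star> snd X (g \<otimes>\<^bsub>G\<^esub> h)"
        using Comp_assoc[OF r ppf e_y] Comp_assoc[OF r e_x action_arr[OF gh f]] epsilon_natural[OF h g f]
          Obj_E_D(4)[OF X h g] by simp
      finally show ?thesis .
    qed
    have yc: "arr T (fst X) ?Y (snd Y h \<star> ?c g)" if "g \<in> carrier G" for g
      by (rule Comp_arr[OF c_arr[OF that] ty])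
    have "fmor (\<phi> h) (trace X Y f) \<star> snd X h
        = (\<Oplus>\<^bsub>Hom T (fobj (\<phi> h) (fst X)) ?Y\<^esub>g\<in>carrier G. fmor (\<phi> h) (?c g)) \<star> snd X h"
      using functor_finsum[where A = "carrier G", OF action_additive[OF h] xo yo c_arr] by (simp add: trace_def)
    also have "\<dots> = (\<Oplus>\<^bsub>Hom T (fst X) ?Y\<^esub>g\<in>carrier G. fmor (\<phi> h) (?c g) \<star> snd X h)"
      by (rule Comp_finsum_left[OF hY tx action_arr[OF h c_arr]])
    also have "\<dots> = (\<Oplus>\<^bsub>Hom T (fst X) ?Y\<^esub>g\<in>carrier G. snd Y h \<star> ?c (g \<otimes>\<^bsub>G\<^esub> h))"
      by (rule finsum_eq[OF xo hY yc key]) (use h in auto)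
    also have "\<dots> = (\<Oplus>\<^bsub>Hom T (fst X) ?Y\<^esub>g\<in>carrier G. snd Y h \<star> ?c g)"
      using H.finsum_reindex[of "\<lambda>g. snd Y h \<star> ?c g" "\<lambda>g. g \<otimes>\<^bsub>G\<^esub> h" "carrier G"]
        right_mult_image[OF h] arr_carrier[OF yc] by (simp add: Pi_iff)
    also have "\<dots> = snd Y h \<star> trace X Y f"
      unfolding trace_def by (rule Comp_finsum_right[OF xo ty c_arr, symmetric])
    finally show ?thesis by simp
  qed
  with X Y tr show ?thesis by (simp add: arr_E)
qed

text \<open>The structure isomorphisms slide past the equivariant \<open>a\<close>, so conjugation
  acts on \<open>f \<star> a\<close> through \<open>f\<close> only. Together with the version for
  the other side, this preserves a commutative square when two opposite sides are traced and the
  other two are equivariant.\<close>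

lemma trace_Comp_right:
  assumes a: "arr E X Y a" and f: "arr T (fst Y) (fst Z) f" and Z: "Z \<in> Obj E"
  shows "trace X Z (f \<star> a) = trace Y Z f \<star> a"
proof -
  note aE = arr_E_D[OF a]
  note xo = Obj_E_D(1)[OF aE(1)] and zo = Obj_E_D(1)[OF Z]
  have "trace X Z (f \<star> a) = (\<Oplus>\<^bsub>Hom T (fst X) (fst Z)\<^esub>g\<in>carrier G.
      (struct_inv Z g \<star> (fmor (\<phi> g) f \<star> snd Y g)) \<star> a)"
    unfolding trace_def
  proof (rule finsum_eq[OF xo zo Comp_arr[OF aE(3) trace_term_arr[OF aE(2) Z f]]])
    fix g assume g: "g \<in> carrier G"
    note ty = Obj_E_D(3)[OF aE(2) g] and tx = Obj_E_D(3)[OF aE(1) g] and si = struct_inv_D(1)[OF Z g]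
    note pf = action_arr[OF g f] and pa = action_arr[OF g aE(3)]
    show "struct_inv Z g \<star> (fmor (\<phi> g) (f \<star> a) \<star> snd X g)
        = (struct_inv Z g \<star> (fmor (\<phi> g) f \<star> snd Y g)) \<star> a"
      using Comp_assoc[OF aE(3) Comp_arr[OF ty pf] si] Comp_assoc[OF aE(3) ty pf] aE(4)[OF g]
        Comp_assoc[OF tx pa pf] action_Comp[OF g aE(3) f] by simp
  qed
  also have "\<dots> = trace Y Z f \<star> a"
    unfolding trace_def by (rule Comp_finsum_left[OF zo aE(3) trace_term_arr[OF aE(2) Z f], symmetric])
  finally show ?thesis .
qed

lemma trace_Comp_left:
  assumes b: "arr E Y Z b" and f: "arr T (fst X) (fst Y) f" and X: "X \<in> Obj E"
  shows "trace X Z (b \<star> f) = b \<star> trace X Y f"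
proof -
  note bE = arr_E_D[OF b]
  note xo = Obj_E_D(1)[OF X] and zo = Obj_E_D(1)[OF bE(2)]
  have "trace X Z (b \<star> f) = (\<Oplus>\<^bsub>Hom T (fst X) (fst Z)\<^esub>g\<in>carrier G.
      b \<star> (struct_inv Y g \<star> (fmor (\<phi> g) f \<star> snd X g)))"
    unfolding trace_def
  proof (rule finsum_eq[OF xo zo Comp_arr[OF trace_term_arr[OF X bE(1) f] bE(3)]])
    fix g assume g: "g \<in> carrier G"
    note tx = Obj_E_D(3)[OF X g] and si = struct_inv_D(1)[OF bE(1) g] and siz = struct_inv_D(1)[OF bE(2) g]
    note pf = action_arr[OF g f] and pb = action_arr[OF g bE(3)]
    note ft = Comp_arr[OF tx pf]
    show "struct_inv Z g \<star> (fmor (\<phi> g) (b \<star> f) \<star> snd X g)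
        = b \<star> (struct_inv Y g \<star> (fmor (\<phi> g) f \<star> snd X g))"
      using action_Comp[OF g f bE(3)] Comp_assoc[OF tx pf pb] Comp_assoc[OF ft pb siz]
        struct_inv_natural[OF b g] Comp_assoc[OF ft si bE(3)] by simp
  qed
  also have "\<dots> = b \<star> trace X Y f"
    unfolding trace_def by (rule Comp_finsum_right[OF xo bE(3) trace_term_arr[OF X bE(1) f], symmetric])
  finally show ?thesis .
qed

definition average :: "'o \<times> ('g \<Rightarrow> 'm) \<Rightarrow> 'o \<times> ('g \<Rightarrow> 'm) \<Rightarrow> 'm \<Rightarrow> 'm" where
  "average X Y f = trace X Y (scale (fst X) (fst Y) f)"

lemma average_arr_E: "\<lbrakk>X \<in> Obj E; Y \<in> Obj E; arr T (fst X) (fst Y) f\<rbrakk> \<Longrightarrow> arr E X Y (average X Y f)"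
  unfolding average_def by (intro trace_arr_E scale_arr)

lemma average_Comp_right:
  assumes a: "arr E X Y a" and f: "arr T (fst Y) (fst Z) f" and Z: "Z \<in> Obj E"
  shows "average X Z (f \<star> a) = average Y Z f \<star> a"
  unfolding average_def
  using trace_Comp_right[OF a scale_arr[OF f] Z] scale_Comp_left[OF arr_E_D(3)[OF a] f] by simp

lemma average_Comp_left:
  assumes b: "arr E Y Z b" and f: "arr T (fst X) (fst Y) f" and X: "X \<in> Obj E"
  shows "average X Z (b \<star> f) = b \<star> average X Y f"
  unfolding average_def
  using trace_Comp_left[OF b scale_arr[OF f] X] scale_Comp_right[OF f arr_E_D(3)[OF b]] by simp

text \<open>Each conjugate of an equivariant \<open>f\<close> is \<open>f\<close> itself, and the
  number of terms cancels against the division by the group order.\<close>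

lemma average_equivariant:
  assumes f: "arr E X Y f"
  shows "average X Y f = f"
proof -
  note fE = arr_E_D[OF f]
  note xo = Obj_E_D(1)[OF fE(1)] and yo = Obj_E_D(1)[OF fE(2)]
  have "average X Y f = (\<Oplus>\<^bsub>Hom T (fst X) (fst Y)\<^esub>g\<in>carrier G. scale (fst X) (fst Y) f)"
    unfolding average_def trace_def
  proof (rule finsum_eq[OF xo yo scale_arr[OF fE(3)]])
    fix g assume g: "g \<in> carrier G"
    note tx = Obj_E_D(3)[OF fE(1) g] and ty = Obj_E_D(3)[OF fE(2) g] and si = struct_inv_D[OF fE(2) g]
    note pf = action_arr[OF g fE(3)]
    have "struct_inv Y g \<star> (fmor (\<phi> g) (scale (fst X) (fst Y) f) \<star> snd X g)
        = scale (fst X) (fst Y) (struct_inv Y g \<star> (fmor (\<phi> g) f \<star> snd X g))"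
      using functor_scale[OF action_additive[OF g] fE(3)] scale_Comp_left[OF tx pf]
        scale_Comp_right[OF Comp_arr[OF tx pf] si(1)] by simp
    also have "struct_inv Y g \<star> (fmor (\<phi> g) f \<star> snd X g) = f"
      using fE(4)[OF g, symmetric] Comp_assoc[OF fE(3) ty si(1)] si(2) Ident_Comp[OF fE(3)] by simp
    finally show "struct_inv Y g \<star> (fmor (\<phi> g) (scale (fst X) (fst Y) f) \<star> snd X g)
        = scale (fst X) (fst Y) f" .
  qed
  then show ?thesis using finsum_const_scale[OF fE(3)] by simp
qed

text \<open>Serves the last square of a triangle morphism, which contains the shift of the first
  component. It holds because the inverse structure isomorphisms of a shifted object are the shifted
  ones.\<close>

lemma average_shift:
  assumes X: "X \<in> Obj E" and Y: "Y \<in> Obj E" and f: "arr T (fst X) (fst Y) f"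
  shows "average (fobj SE X) (fobj SE Y) (fmor S f) = fmor S (average X Y f)"
proof -
  note xo = Obj_E_D(1)[OF X] and yo = Obj_E_D(1)[OF Y]
  let ?f = "scale (fst X) (fst Y) f"
  note uf = scale_arr[OF f]
  have "fmor S (trace X Y ?f) = (\<Oplus>\<^bsub>Hom T (fobj S (fst X)) (fobj S (fst Y))\<^esub>g\<in>carrier G.
      fmor S (struct_inv Y g \<star> (fmor (\<phi> g) ?f \<star> snd X g)))"
    unfolding trace_def by (rule functor_finsum[OF shift_additive xo yo trace_term_arr[OF X Y uf]])
  also have "\<dots> = trace (fobj SE X) (fobj SE Y) (fmor S ?f)"
    unfolding trace_def SE_simps
  proof (rule finsum_eq[symmetric, OF shift_obj[OF xo] shift_obj[OF yo] shift_arr[OF trace_term_arr[OF X Y uf]]])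
    fix g assume g: "g \<in> carrier G"
    note tx = Obj_E_D(3)[OF X g] and si = struct_inv_D[OF Y g] and pf = action_arr[OF g uf]
    show "struct_inv (fobj SE Y) g \<star> (fmor (\<phi> g) (fmor S ?f) \<star> snd (fobj SE X) g)
        = fmor S (struct_inv Y g \<star> (fmor (\<phi> g) ?f \<star> snd X g))"
      using struct_inv_shift[OF Y g] action_shift_mor[OF g uf] g shift_Comp[OF Comp_arr[OF tx pf] si(1)]
        shift_Comp[OF tx pf] by simp
  qed
  finally show ?thesis
    unfolding average_def using functor_scale[OF shift_additive f] by simp
qed

lemma functor_triangle_forgetful [simp]:
  "functor_triangle forgetful (Triangle X Y Z f g h) = Triangle (fst X) (fst Y) (fst Z) f g h"
  by (auto simp: functor_triangle_def forgetful_def split: prod.split)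

lemma average_triangle_mor:
  assumes s: "is_triangle E SE (Triangle X Y Z f g h)"
    and t: "is_triangle E SE (Triangle X' Y' Z' f' g' h')"
    and mor: "triangle_mor T S (functor_triangle forgetful (Triangle X Y Z f g h))
      (functor_triangle forgetful (Triangle X' Y' Z' f' g' h')) a b c"
  shows "triangle_mor E SE (Triangle X Y Z f g h) (Triangle X' Y' Z' f' g' h')
    (average X X' a) (average Y Y' b) (average Z Z' c)"
proof -
  have fgh: "arr E X Y f" "arr E Y Z g" "arr E Z (fobj SE X) h" using s by auto
  have fgh': "arr E X' Y' f'" "arr E Y' Z' g'" "arr E Z' (fobj SE X') h'" using t by auto
  note obj = arr_E_D(1)[OF fgh(1)] arr_E_D(1)[OF fgh(2)] arr_E_D(1)[OF fgh(3)]
    and obj' = arr_E_D(1)[OF fgh'(1)] arr_E_D(1)[OF fgh'(2)] arr_E_D(1)[OF fgh'(3)]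
  have abc: "arr T (fst X) (fst X') a" "arr T (fst Y) (fst Y') b" "arr T (fst Z) (fst Z') c"
    and eqs: "b \<star> f = f' \<star> a" "c \<star> g = g' \<star> b" "fmor S a \<star> h = h' \<star> c"
    using mor by auto
  have Sa: "arr T (fst (fobj SE X)) (fst (fobj SE X')) (fmor S a)" using shift_arr[OF abc(1)] by simp
  show ?thesis
    using average_arr_E[OF obj(1) obj'(1) abc(1)] average_arr_E[OF obj(2) obj'(2) abc(2)]
      average_arr_E[OF obj(3) obj'(3) abc(3)] eqs
      average_Comp_right[OF fgh(1) abc(2) obj'(2)] average_Comp_left[OF fgh'(1) abc(1) obj(1)]
      average_Comp_right[OF fgh(2) abc(3) obj'(3)] average_Comp_left[OF fgh'(2) abc(2) obj(2)]
      average_Comp_right[OF fgh(3) Sa SE_obj[OF obj'(1)]] average_Comp_left[OF fgh'(3) abc(3) obj(3)]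
      average_shift[OF obj(1) obj'(1) abc(1)]
    by simp
qed

end

section \<open>Induced objects\<close>

context equivariant_setting
begin

text \<open>
  \<open>A\<close> is the sum of all \<open>\<phi>\<^sub>g X\<close>, with inclusions \<open>i\<close> and projections \<open>p\<close>; its structure isomorphism at
  \<open>h\<close> has the components \<open>\<epsilon>\<^sub>h\<^sub>,\<^sub>g\<^sup>-\<^sup>1\<close> from \<open>\<phi>\<^sub>g\<^sub>h X\<close> to \<open>\<phi>\<^sub>h \<phi>\<^sub>g X\<close>, which the last clause states
  without inverses.
\<close>

definition induced :: "'o \<Rightarrow> 'o \<times> ('g \<Rightarrow> 'm) \<Rightarrow> ('g \<Rightarrow> 'm) \<Rightarrow> ('g \<Rightarrow> 'm) \<Rightarrow> bool" where
  "induced X A i p \<longleftrightarrow> X \<in> Obj T \<and> A \<in> Obj E \<and>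
     biproduct T (carrier G) (\<lambda>g. fobj (\<phi> g) X) (fst A) i p \<and>
     (\<forall>g\<in>carrier G. \<forall>h\<in>carrier G.
        \<epsilon> h g X \<star> (fmor (\<phi> h) (p g) \<star> snd A h) = p (g \<otimes>\<^bsub>G\<^esub> h))"

lemma inducedD:
  assumes "induced X A i p"
  shows "X \<in> Obj T" "A \<in> Obj E" "fst A \<in> Obj T"
    and "biproduct T (carrier G) (\<lambda>g. fobj (\<phi> g) X) (fst A) i p"
    and "\<lbrakk>g \<in> carrier G; h \<in> carrier G\<rbrakk> \<Longrightarrow>
      \<epsilon> h g X \<star> (fmor (\<phi> h) (p g) \<star> snd A h) = p (g \<otimes>\<^bsub>G\<^esub> h)"
    and "g \<in> carrier G \<Longrightarrow> arr T (fobj (\<phi> g) X) (fst A) (i g)"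
    and "g \<in> carrier G \<Longrightarrow> arr T (fst A) (fobj (\<phi> g) X) (p g)"
  using assms biproductD[of T "carrier G" "\<lambda>g. fobj (\<phi> g) X" "fst A" i p] Obj_E_D(1)
  unfolding induced_def by blast+

lemma action_biproduct:
  assumes X: "X \<in> Obj T" and bp: "biproduct T (carrier G) (\<lambda>g. fobj (\<phi> g) X) W i p"
    and h: "h \<in> carrier G"
  shows "biproduct T (carrier G) (\<lambda>g. fobj (\<phi> h) (fobj (\<phi> g) X)) (fobj (\<phi> h) W)
    (\<lambda>g. fmor (\<phi> h) (i g)) (\<lambda>g. fmor (\<phi> h) (p g))"
  by (rule additive_functor_biproduct[OF action_additive[OF h] bp action_obj[OF _ X]])

lemma biproduct_joint_mono:
  assumes bp: "biproduct T J V W i p" and u: "arr T Z W u" and v: "arr T Z W v"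
    and eq: "\<And>j. j \<in> J \<Longrightarrow> p j \<star> u = p j \<star> v"
  shows "u = v"
  by (rule eq_by_resolution_left[OF biproductD(6)[OF bp] biproductD(3)[OF bp] biproductD(2)[OF bp] u v eq])

text \<open>The invertible \<open>\<epsilon> h g X\<close> cancels, so arrows into
  \<open>fobj (\<phi> h) W\<close> can be compared in the very form in which \<open>induced\<close>
  prescribes the structure isomorphisms.\<close>

lemma action_biproduct_joint_mono:
  assumes X: "X \<in> Obj T" and bp: "biproduct T (carrier G) (\<lambda>g. fobj (\<phi> g) X) W i p"
    and h: "h \<in> carrier G" and u: "arr T Z (fobj (\<phi> h) W) u" and v: "arr T Z (fobj (\<phi> h) W) v"
    and eq: "\<And>g. g \<in> carrier G \<Longrightarrow>
      \<epsilon> h g X \<star> (fmor (\<phi> h) (p g) \<star> u) = \<epsilon> h g X \<star> (fmor (\<phi> h) (p g) \<star> v)"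
  shows "u = v"
proof (rule biproduct_joint_mono[OF action_biproduct[OF X bp h] u v])
  fix g assume g: "g \<in> carrier G"
  note hp = action_arr[OF h biproductD(3)[OF bp g]]
  obtain e where "inverse_arr T (fobj (\<phi> h) (fobj (\<phi> g) X)) (fobj (\<phi> (g \<otimes>\<^bsub>G\<^esub> h)) X) (\<epsilon> h g X) e"
    using epsilon_iso[OF h g X] by (auto simp: iso_arr_iff)
  then show "fmor (\<phi> h) (p g) \<star> u = fmor (\<phi> h) (p g) \<star> v"
    by (rule inverse_arr_left_cancel[OF _ Comp_arr[OF u hp] Comp_arr[OF v hp] eq[OF g]])
qed

lemma ex_induced:
  assumes X: "X \<in> Obj T"
  shows "\<exists>A i p. induced X A i p"
proof -
  obtain W i p where bp: "biproduct T (carrier G) (\<lambda>g. fobj (\<phi> g) X) W i p"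
    using ex_finite_biproduct[of "carrier G" "\<lambda>g. fobj (\<phi> g) X"] finite_G action_obj[OF _ X] by blast
  note W = biproductD(1)[OF bp] and i = biproductD(2)[OF bp] and p = biproductD(3)[OF bp]
  have "\<forall>h\<in>carrier G. \<exists>e. \<forall>g\<in>carrier G.
      inverse_arr T (fobj (\<phi> h) (fobj (\<phi> g) X)) (fobj (\<phi> (g \<otimes>\<^bsub>G\<^esub> h)) X) (\<epsilon> h g X) (e g)"
    using epsilon_iso[OF _ _ X] by (intro ballI bchoice) (simp add: iso_arr_iff)
  from bchoice[OF this] obtain e where "\<forall>h\<in>carrier G. \<forall>g\<in>carrier G.
      inverse_arr T (fobj (\<phi> h) (fobj (\<phi> g) X)) (fobj (\<phi> (g \<otimes>\<^bsub>G\<^esub> h)) X) (\<epsilon> h g X) (e h g)"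
    by blast
  then have e: "arr T (fobj (\<phi> (g \<otimes>\<^bsub>G\<^esub> h)) X) (fobj (\<phi> h) (fobj (\<phi> g) X)) (e h g)"
    "\<epsilon> h g X \<star> e h g = Ident T (fobj (\<phi> (g \<otimes>\<^bsub>G\<^esub> h)) X)"
    if "h \<in> carrier G" "g \<in> carrier G" for g h
    using that by (auto simp: inverse_arr_def)
  \<comment> \<open>The component at \<open>g\<close> is what the last clause of
    \<open>induced\<close> dictates once \<open>\<epsilon> h g X\<close> is inverted.\<close>
  define \<theta> where "\<theta> = (\<lambda>h\<in>carrier G. \<Oplus>\<^bsub>Hom T W (fobj (\<phi> h) W)\<^esub>g\<in>carrier G.
    fmor (\<phi> h) (i g) \<star> (e h g \<star> p (g \<otimes>\<^bsub>G\<^esub> h)))"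
  have ep: "arr T W (fobj (\<phi> h) (fobj (\<phi> g) X)) (e h g \<star> p (g \<otimes>\<^bsub>G\<^esub> h))"
    if "h \<in> carrier G" "g \<in> carrier G" for g h
    by (rule Comp_arr[OF p e(1)[OF that]]) (use that in simp)
  have th: "arr T W (fobj (\<phi> h) W) (\<theta> h)" if h: "h \<in> carrier G" for h
    unfolding \<theta>_def using h
    by (simp add: finsum_arr[OF W action_obj[OF h W] Comp_arr[OF ep[OF h] action_arr[OF h i]]])
  have p_th: "\<epsilon> h g X \<star> (fmor (\<phi> h) (p g) \<star> \<theta> h) = p (g \<otimes>\<^bsub>G\<^esub> h)"
    if h: "h \<in> carrier G" and g: "g \<in> carrier G" for g h
  proof -
    have gh: "g \<otimes>\<^bsub>G\<^esub> h \<in> carrier G" using g h by simp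
    have "fmor (\<phi> h) (p g) \<star> \<theta> h = e h g \<star> p (g \<otimes>\<^bsub>G\<^esub> h)"
      using biproduct_proj_finsum[OF action_biproduct[OF X bp h] finite_G g ep[OF h] W] h
      by (simp add: \<theta>_def)
    then show ?thesis
      using Comp_assoc[OF p[OF gh] e(1)[OF h g] epsilon_arr[OF h g X]] e(2)[OF h g] Ident_Comp[OF p[OF gh]]
      by simp
  qed
  have iso: "iso_arr T W (fobj (\<phi> h) W) (\<theta> h)" if h: "h \<in> carrier G" for h
  proof -
    let ?W = "fobj (\<phi> h) W" and ?k = "\<lambda>g. g \<otimes>\<^bsub>G\<^esub> inv\<^bsub>G\<^esub> h"
    have hW: "?W \<in> Obj T" by (rule action_obj[OF h W])
    have k: "?k g \<in> carrier G" "?k g \<otimes>\<^bsub>G\<^esub> h = g" "?k (g \<otimes>\<^bsub>G\<^esub> h) = g" if "g \<in> carrier G" for g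
      using that h by (simp_all add: act.m_assoc)
    have term_arr: "arr T ?W (fobj (\<phi> g) X) (\<epsilon> h (?k g) X \<star> fmor (\<phi> h) (p (?k g)))"
      if "g \<in> carrier G" for g
      using Comp_arr[OF action_arr[OF h p[OF k(1)[OF that]]] epsilon_arr[OF h k(1)[OF that] X]] k(2)[OF that]
      by simp
    \<comment> \<open>The inverse by components: \<open>p_th\<close> is read at the index
      \<open>?k g\<close>, so that its right-hand side becomes \<open>p g\<close>.\<close>
    define \<psi> where "\<psi> = (\<Oplus>\<^bsub>Hom T ?W W\<^esub>g\<in>carrier G. i g \<star> (\<epsilon> h (?k g) X \<star> fmor (\<phi> h) (p (?k g))))"
    have psi: "arr T ?W W \<psi>" unfolding \<psi>_def by (rule finsum_arr[OF hW W Comp_arr[OF term_arr i]])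
    have p_psi: "p g \<star> \<psi> = \<epsilon> h (?k g) X \<star> fmor (\<phi> h) (p (?k g))" if g: "g \<in> carrier G" for g
      unfolding \<psi>_def by (rule biproduct_proj_finsum[OF bp finite_G g term_arr hW])
    have "\<theta> h \<star> \<psi> = Ident T ?W"
    proof (rule action_biproduct_joint_mono[OF X bp h Comp_arr[OF psi th[OF h]] Ident_arr[OF hW]])
      fix g assume g: "g \<in> carrier G"
      note hp = action_arr[OF h p[OF g]]
      have "\<epsilon> h g X \<star> (fmor (\<phi> h) (p g) \<star> (\<theta> h \<star> \<psi>)) = p (g \<otimes>\<^bsub>G\<^esub> h) \<star> \<psi>"
        using Comp_assoc[OF psi th[OF h] hp] p_th[OF h g]
          Comp_assoc[OF psi Comp_arr[OF th[OF h] hp] epsilon_arr[OF h g X]] by simp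
      then show "\<epsilon> h g X \<star> (fmor (\<phi> h) (p g) \<star> (\<theta> h \<star> \<psi>)) = \<epsilon> h g X \<star> (fmor (\<phi> h) (p g) \<star> Ident T ?W)"
        using p_psi[of "g \<otimes>\<^bsub>G\<^esub> h"] k(3)[OF g] g h Comp_Ident[OF hp] by simp
    qed
    moreover have "\<psi> \<star> \<theta> h = Ident T W"
    proof (rule biproduct_joint_mono[OF bp Comp_arr[OF th[OF h] psi] Ident_arr[OF W]])
      fix g assume g: "g \<in> carrier G"
      note hp = action_arr[OF h p[OF k(1)[OF g]]]
      show "p g \<star> (\<psi> \<star> \<theta> h) = p g \<star> Ident T W"
        using Comp_assoc[OF th[OF h] psi p[OF g]] p_psi[OF g]
          Comp_assoc[OF th[OF h] hp epsilon_arr[OF h k(1)[OF g] X]] p_th[OF h k(1)[OF g]] k(2)[OF g]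
          Comp_Ident[OF p[OF g]] by simp
    qed
    ultimately show ?thesis using th[OF h] psi by (auto simp: iso_arr_def)
  qed
  have cocycle: "\<theta> (h \<otimes>\<^bsub>G\<^esub> g) = \<epsilon> g h W \<star> (fmor (\<phi> g) (\<theta> h) \<star> \<theta> g)"
    if g: "g \<in> carrier G" and h: "h \<in> carrier G" for g h
  proof -
    have hg: "h \<otimes>\<^bsub>G\<^esub> g \<in> carrier G" using g h by simp
    note gth = action_arr[OF g th[OF h]] and e_W = epsilon_arr[OF g h W]
    note tt = Comp_arr[OF th[OF g] gth]
    show ?thesis
    proof (rule action_biproduct_joint_mono[OF X bp hg th[OF hg] Comp_arr[OF tt e_W]])
      fix f assume f: "f \<in> carrier G"
      have fh: "f \<otimes>\<^bsub>G\<^esub> h \<in> carrier G" using f h by simp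
      have fX: "fobj (\<phi> f) X \<in> Obj T" by (rule action_obj[OF f X])
      note pf = p[OF f]
      note gh_p = action_arr[OF g action_arr[OF h pf]] and hp = action_arr[OF h pf]
      note e1 = epsilon_arr[OF hg f X] and e2 = epsilon_arr[OF g h fX] and e3 = epsilon_arr[OF h f X]
        and e4 = epsilon_arr[OF g fh X]
      note ge3 = action_arr[OF g e3]
      note w = Comp_arr[OF tt gh_p]
      let ?t = "fmor (\<phi> g) (\<theta> h) \<star> \<theta> g" and ?pp = "fmor (\<phi> g) (fmor (\<phi> h) (p f))"
      have assoc: "f \<otimes>\<^bsub>G\<^esub> (h \<otimes>\<^bsub>G\<^esub> g) = (f \<otimes>\<^bsub>G\<^esub> h) \<otimes>\<^bsub>G\<^esub> g" using f g h by (simp add: act.m_assoc)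
      have "\<epsilon> (h \<otimes>\<^bsub>G\<^esub> g) f X \<star> (fmor (\<phi> (h \<otimes>\<^bsub>G\<^esub> g)) (p f) \<star> (\<epsilon> g h W \<star> ?t))
          = \<epsilon> (h \<otimes>\<^bsub>G\<^esub> g) f X \<star> (\<epsilon> g h (fobj (\<phi> f) X) \<star> (?pp \<star> ?t))"
        using Comp_assoc[OF tt e_W action_arr[OF hg pf]] epsilon_natural[OF g h pf, symmetric]
          Comp_assoc[OF tt gh_p e2] by simp
      also have "\<dots> = (\<epsilon> (h \<otimes>\<^bsub>G\<^esub> g) f X \<star> \<epsilon> g h (fobj (\<phi> f) X)) \<star> (?pp \<star> ?t)"
        by (rule Comp_assoc[OF w e2 e1, symmetric])
      \<comment> \<open>Here the cocycle condition of the action at \<open>X\<close> enters; it is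
        the source of the cocycle condition of the induced object.\<close>
      also have "\<dots> = (\<epsilon> g (f \<otimes>\<^bsub>G\<^esub> h) X \<star> fmor (\<phi> g) (\<epsilon> h f X)) \<star> (?pp \<star> ?t)"
        using act.action_cocycle[OF g h f X] by simp
      also have "\<dots> = \<epsilon> g (f \<otimes>\<^bsub>G\<^esub> h) X \<star> (fmor (\<phi> g) (\<epsilon> h f X) \<star> (?pp \<star> ?t))"
        using Comp_assoc[OF w ge3] e4 assoc by simp
      also have "?pp \<star> ?t = fmor (\<phi> g) (fmor (\<phi> h) (p f) \<star> \<theta> h) \<star> \<theta> g"
        using Comp_assoc[OF th[OF g] gth gh_p] action_Comp[OF g th[OF h] hp] by simp
      also have "fmor (\<phi> g) (\<epsilon> h f X) \<star> (fmor (\<phi> g) (fmor (\<phi> h) (p f) \<star> \<theta> h) \<star> \<theta> g)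
          = fmor (\<phi> g) (\<epsilon> h f X \<star> (fmor (\<phi> h) (p f) \<star> \<theta> h)) \<star> \<theta> g"
        using Comp_assoc[OF th[OF g] action_arr[OF g Comp_arr[OF th[OF h] hp]] ge3]
          action_Comp[OF g Comp_arr[OF th[OF h] hp] e3] by simp
      also have "\<dots> = fmor (\<phi> g) (p (f \<otimes>\<^bsub>G\<^esub> h)) \<star> \<theta> g" using p_th[OF h f] by simp
      also have "\<epsilon> g (f \<otimes>\<^bsub>G\<^esub> h) X \<star> \<dots> = p (f \<otimes>\<^bsub>G\<^esub> (h \<otimes>\<^bsub>G\<^esub> g))" using p_th[OF g fh] assoc by simp
      finally show "\<epsilon> (h \<otimes>\<^bsub>G\<^esub> g) f X \<star> (fmor (\<phi> (h \<otimes>\<^bsub>G\<^esub> g)) (p f) \<star> \<theta> (h \<otimes>\<^bsub>G\<^esub> g))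
          = \<epsilon> (h \<otimes>\<^bsub>G\<^esub> g) f X \<star> (fmor (\<phi> (h \<otimes>\<^bsub>G\<^esub> g)) (p f) \<star> (\<epsilon> g h W \<star> ?t))"
        using p_th[OF hg f] by simp
    qed
  qed
  have "(W, \<theta>) \<in> Obj E" using W iso cocycle by (simp add: Obj_E \<theta>_def)
  then have "induced X (W, \<theta>) i p" using X bp p_th by (simp add: induced_def)
  then show ?thesis by blast
qed

text \<open>Gives the last arrow of an induced triangle its target. Strict stability matches the
  summands with their shifts, and the shift compatibility of \<open>\<epsilon>\<close> carries over
  the last clause of \<open>induced\<close>.\<close>

lemma induced_shift:
  assumes ind: "induced X A i p"
  shows "induced (fobj S X) (fobj SE A) (\<lambda>g. fmor S (i g)) (\<lambda>g. fmor S (p g))"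
proof -
  note D = inducedD[OF ind]
  have "biproduct T (carrier G) (\<lambda>g. fobj S (fobj (\<phi> g) X)) (fobj S (fst A))
      (\<lambda>g. fmor S (i g)) (\<lambda>g. fmor S (p g))"
    by (rule additive_functor_biproduct[OF shift_additive D(4) action_obj[OF _ D(1)]])
  then have "biproduct T (carrier G) (\<lambda>g. fobj (\<phi> g) (fobj S X)) (fst (fobj SE A))
      (\<lambda>g. fmor S (i g)) (\<lambda>g. fmor S (p g))"
    using action_shift_obj[OF _ D(1)] by (simp add: biproduct_def)
  moreover have "\<epsilon> h g (fobj S X) \<star> (fmor (\<phi> h) (fmor S (p g)) \<star> snd (fobj SE A) h)
      = fmor S (p (g \<otimes>\<^bsub>G\<^esub> h))" if g: "g \<in> carrier G" and h: "h \<in> carrier G" for g h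
  proof -
    note ta = Obj_E_D(3)[OF D(2) h] and hp = action_arr[OF h D(7)[OF g]]
    show ?thesis
      using epsilon_shift[OF h g D(1)] action_shift_mor[OF h D(7)[OF g]] D(5)[OF g h] h
        shift_Comp[OF Comp_arr[OF ta hp] epsilon_arr[OF h g D(1)]] shift_Comp[OF ta hp] by simp
  qed
  ultimately show ?thesis
    using shift_obj[OF D(1)] SE_obj[OF D(2)] by (simp add: induced_def)
qed

section \<open>Induction on morphisms\<close>

definition ind_mor :: "'o \<times> ('g \<Rightarrow> 'm) \<Rightarrow> ('g \<Rightarrow> 'm) \<Rightarrow> 'o \<times> ('g \<Rightarrow> 'm) \<Rightarrow> ('g \<Rightarrow> 'm) \<Rightarrow> 'm \<Rightarrow> 'm" where
  "ind_mor A p B j f = (\<Oplus>\<^bsub>Hom T (fst A) (fst B)\<^esub>g\<in>carrier G. j g \<star> (fmor (\<phi> g) f \<star> p g))"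

text \<open>The arrow is a diagonal matrix with entries \<open>\<phi>_g(f)\<close>; component by
  component, its equivariance is naturality of \<open>\<epsilon> h g\<close>. The equations for
  projections and for inclusions say that both are compatible with the single copies of
  \<open>f\<close>, which is what recognises an induced triangle as a direct sum.\<close>

lemma ind_mor:
  assumes A: "induced X A i p" and B: "induced Y B j q" and f: "arr T X Y f"
  shows "arr E A B (ind_mor A p B j f)"
    and "g \<in> carrier G \<Longrightarrow> q g \<star> ind_mor A p B j f = fmor (\<phi> g) f \<star> p g"
    and "g \<in> carrier G \<Longrightarrow> ind_mor A p B j f \<star> i g = j g \<star> fmor (\<phi> g) f"
proof -
  note a = inducedD[OF A] and b = inducedD[OF B]
  let ?m = "ind_mor A p B j f"
  have fp: "arr T (fst A) (fobj (\<phi> g) Y) (fmor (\<phi> g) f \<star> p g)" if "g \<in> carrier G" for g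
    by (rule Comp_arr[OF a(7)[OF that] action_arr[OF that f]])
  have m: "arr T (fst A) (fst B) ?m"
    unfolding ind_mor_def by (rule finsum_arr[OF a(3) b(3) Comp_arr[OF fp b(6)]])
  have qm: "q g \<star> ?m = fmor (\<phi> g) f \<star> p g" if "g \<in> carrier G" for g
    unfolding ind_mor_def by (rule biproduct_proj_finsum[OF b(4) finite_G that fp a(3)])
  then show "g \<in> carrier G \<Longrightarrow> q g \<star> ?m = fmor (\<phi> g) f \<star> p g" .
  show "?m \<star> i g = j g \<star> fmor (\<phi> g) f" if g: "g \<in> carrier G"
  proof (rule biproduct_joint_mono[OF b(4) Comp_arr[OF a(6)[OF g] m] Comp_arr[OF action_arr[OF g f] b(6)[OF g]]])
    fix h assume h: "h \<in> carrier G"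
    have "q h \<star> (?m \<star> i g) = fmor (\<phi> h) f \<star> (p h \<star> i g)"
      using Comp_assoc[OF a(6)[OF g] m b(7)[OF h]] qm[OF h]
        Comp_assoc[OF a(6)[OF g] a(7)[OF h] action_arr[OF h f]] by simp
    moreover have "q h \<star> (j g \<star> fmor (\<phi> g) f) = (q h \<star> j g) \<star> fmor (\<phi> g) f"
      by (rule Comp_assoc[OF action_arr[OF g f] b(6)[OF g] b(7)[OF h], symmetric])
    moreover have "fmor (\<phi> h) f \<star> (p h \<star> i g) = (q h \<star> j g) \<star> fmor (\<phi> g) f"
    proof (cases "g = h")
      case True
      then show ?thesis
        using biproductD(4)[OF a(4) g] biproductD(4)[OF b(4) g] Comp_Ident[OF action_arr[OF g f]]
          Ident_Comp[OF action_arr[OF g f]] by simp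
    next
      case False
      then show ?thesis
        using biproductD(5)[OF a(4) g h] biproductD(5)[OF b(4) g h]
          Comp_zero_right[OF action_arr[OF h f] action_obj[OF g a(1)]]
          Comp_zero_left[OF action_arr[OF g f] action_obj[OF h b(1)]] by simp
    qed
    ultimately show "q h \<star> (?m \<star> i g) = q h \<star> (j g \<star> fmor (\<phi> g) f)" by simp
  qed
  have "snd B h \<star> ?m = fmor (\<phi> h) ?m \<star> snd A h" if h: "h \<in> carrier G" for h
  proof -
    note ta = Obj_E_D(3)[OF a(2) h] and tb = Obj_E_D(3)[OF b(2) h] and hm = action_arr[OF h m]
    show ?thesis
    proof (rule action_biproduct_joint_mono[OF b(1,4) h Comp_arr[OF m tb] Comp_arr[OF ta hm]])
      fix g assume g: "g \<in> carrier G"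
      have gh: "g \<otimes>\<^bsub>G\<^esub> h \<in> carrier G" using g h by simp
      note hq = action_arr[OF h b(7)[OF g]] and hp = action_arr[OF h a(7)[OF g]] and gf = action_arr[OF g f]
      note hgf = action_arr[OF h gf]
      note ea = epsilon_arr[OF h g a(1)] and eb = epsilon_arr[OF h g b(1)]
      have "\<epsilon> h g Y \<star> (fmor (\<phi> h) (q g) \<star> (snd B h \<star> ?m)) = q (g \<otimes>\<^bsub>G\<^esub> h) \<star> ?m"
        using Comp_assoc[OF m tb hq] Comp_assoc[OF m Comp_arr[OF tb hq] eb] b(5)[OF g h] by simp
      also have "\<dots> = fmor (\<phi> (g \<otimes>\<^bsub>G\<^esub> h)) f \<star> p (g \<otimes>\<^bsub>G\<^esub> h)" by (rule qm[OF gh])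
      also have "\<dots> = (fmor (\<phi> (g \<otimes>\<^bsub>G\<^esub> h)) f \<star> \<epsilon> h g X) \<star> (fmor (\<phi> h) (p g) \<star> snd A h)"
        using Comp_assoc[OF Comp_arr[OF ta hp] ea action_arr[OF gh f]] a(5)[OF g h] by simp
      also have "\<dots> = \<epsilon> h g Y \<star> (fmor (\<phi> h) (fmor (\<phi> g) f) \<star> (fmor (\<phi> h) (p g) \<star> snd A h))"
        using Comp_assoc[OF Comp_arr[OF ta hp] hgf eb] epsilon_natural[OF h g f] by simp
      also have "fmor (\<phi> h) (fmor (\<phi> g) f) \<star> (fmor (\<phi> h) (p g) \<star> snd A h)
          = fmor (\<phi> h) (fmor (\<phi> g) f \<star> p g) \<star> snd A h"
        using Comp_assoc[OF ta hp hgf] action_Comp[OF h a(7)[OF g] gf] by simp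
      also have "\<dots> = fmor (\<phi> h) (q g) \<star> (fmor (\<phi> h) ?m \<star> snd A h)"
        unfolding qm[OF g, symmetric] using action_Comp[OF h m b(7)[OF g]] Comp_assoc[OF ta hm hq] by simp
      finally show "\<epsilon> h g Y \<star> (fmor (\<phi> h) (q g) \<star> (snd B h \<star> ?m))
          = \<epsilon> h g Y \<star> (fmor (\<phi> h) (q g) \<star> (fmor (\<phi> h) ?m \<star> snd A h))" .
    qed
  qed
  then show "arr E A B ?m" using a(2) b(2) m by (simp add: arr_E)
qed

lemma ind_mor_eqI:
  assumes B: "induced Y B j q" and u: "arr T Z (fst B) u" and v: "arr T Z (fst B) v"
    and eq: "\<And>g. g \<in> carrier G \<Longrightarrow> q g \<star> u = q g \<star> v"
  shows "u = v"
  by (rule biproduct_joint_mono[OF inducedD(4)[OF B] u v eq])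

lemma ind_mor_Comp:
  assumes A: "induced X A i p" and B: "induced Y B j q" and C: "induced Z C l r"
    and f: "arr T X Y f" and f': "arr T Y Z f'"
  shows "ind_mor B q C l f' \<star> ind_mor A p B j f = ind_mor A p C l (f' \<star> f)"
proof -
  note m = ind_mor[OF A B f] and m' = ind_mor[OF B C f'] and m'' = ind_mor[OF A C Comp_arr[OF f f']]
  note mT = arr_E_D(3)[OF m(1)] and mT' = arr_E_D(3)[OF m'(1)] and mT'' = arr_E_D(3)[OF m''(1)]
  show ?thesis
  proof (rule ind_mor_eqI[OF C Comp_arr[OF mT mT'] mT''])
    fix g assume g: "g \<in> carrier G"
    note p = inducedD(7)[OF A g] and q = inducedD(7)[OF B g] and r = inducedD(7)[OF C g]
    show "r g \<star> (ind_mor B q C l f' \<star> ind_mor A p B j f) = r g \<star> ind_mor A p C l (f' \<star> f)"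
      using Comp_assoc[OF mT mT' r] m'(2)[OF g] Comp_assoc[OF mT q action_arr[OF g f']] m(2)[OF g]
        Comp_assoc[OF p action_arr[OF g f] action_arr[OF g f']] action_Comp[OF g f f'] m''(2)[OF g] by simp
  qed
qed

lemma ind_mor_shift:
  assumes A: "induced X A i p" and B: "induced Y B j q" and f: "arr T X Y f"
  shows "ind_mor (fobj SE A) (\<lambda>g. fmor S (p g)) (fobj SE B) (\<lambda>g. fmor S (j g)) (fmor S f)
    = fmor S (ind_mor A p B j f)"
proof -
  note m = ind_mor[OF A B f] and m' = ind_mor[OF induced_shift[OF A] induced_shift[OF B] shift_arr[OF f]]
  note mT = arr_E_D(3)[OF m(1)]
  have Sm: "arr T (fst (fobj SE A)) (fst (fobj SE B)) (fmor S (ind_mor A p B j f))"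
    using shift_arr[OF mT] by simp
  show ?thesis
  proof (rule ind_mor_eqI[OF induced_shift[OF B] arr_E_D(3)[OF m'(1)] Sm])
    fix g assume g: "g \<in> carrier G"
    show "fmor S (q g) \<star> ind_mor (fobj SE A) (\<lambda>g. fmor S (p g)) (fobj SE B) (\<lambda>g. fmor S (j g)) (fmor S f)
      = fmor S (q g) \<star> fmor S (ind_mor A p B j f)"
      using m'(2)[OF g] shift_Comp[OF mT inducedD(7)[OF B g]] m(2)[OF g]
        shift_Comp[OF inducedD(7)[OF A g] action_arr[OF g f]] action_shift_mor[OF g f] by simp
  qed
qed

section \<open>Equivariant objects as retracts of induced objects\<close>

definition ind_unit :: "'o \<times> ('g \<Rightarrow> 'm) \<Rightarrow> 'o \<times> ('g \<Rightarrow> 'm) \<Rightarrow> ('g \<Rightarrow> 'm) \<Rightarrow> 'm" where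
  "ind_unit X A i = (\<Oplus>\<^bsub>Hom T (fst X) (fst A)\<^esub>g\<in>carrier G. i g \<star> snd X g)"

text \<open>In the original category the unit is already split by its component at
  \<open>\<one>\<close>, followed by the inverse of the structure isomorphism there:
  \<open>\<phi> \<one>\<close> is not assumed to be the identity functor.\<close>

definition ind_retraction :: "'o \<times> ('g \<Rightarrow> 'm) \<Rightarrow> 'o \<times> ('g \<Rightarrow> 'm) \<Rightarrow> ('g \<Rightarrow> 'm) \<Rightarrow> 'm" where
  "ind_retraction X A p = average A X (struct_inv X \<one>\<^bsub>G\<^esub> \<star> p \<one>\<^bsub>G\<^esub>)"

text \<open>The column with entries \<open>snd X g\<close> is the unit of the adjunction in which
  induction is right adjoint to the forgetful functor. Its equivariance is, component by component,
  the cocycle condition of \<open>X\<close>.\<close>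

lemma ind_unit:
  assumes X: "X \<in> Obj E" and A: "induced (fst X) A i p"
  shows "arr E X A (ind_unit X A i)"
    and "g \<in> carrier G \<Longrightarrow> p g \<star> ind_unit X A i = snd X g"
proof -
  note x = Obj_E_D[OF X] and a = inducedD[OF A]
  let ?m = "ind_unit X A i"
  have m: "arr T (fst X) (fst A) ?m"
    unfolding ind_unit_def by (rule finsum_arr[OF x(1) a(3) Comp_arr[OF x(3) a(6)]])
  have pm: "p g \<star> ?m = snd X g" if "g \<in> carrier G" for g
    unfolding ind_unit_def by (rule biproduct_proj_finsum[OF a(4) finite_G that x(3) x(1)])
  then show "g \<in> carrier G \<Longrightarrow> p g \<star> ?m = snd X g" .
  have "snd A h \<star> ?m = fmor (\<phi> h) ?m \<star> snd X h" if h: "h \<in> carrier G" for h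
  proof -
    note ta = Obj_E_D(3)[OF a(2) h] and hm = action_arr[OF h m]
    show ?thesis
    proof (rule action_biproduct_joint_mono[OF a(1,4) h Comp_arr[OF m ta] Comp_arr[OF x(3)[OF h] hm]])
      fix g assume g: "g \<in> carrier G"
      have gh: "g \<otimes>\<^bsub>G\<^esub> h \<in> carrier G" using g h by simp
      note hp = action_arr[OF h a(7)[OF g]]
      note e = epsilon_arr[OF h g a(1)]
      show "\<epsilon> h g (fst X) \<star> (fmor (\<phi> h) (p g) \<star> (snd A h \<star> ?m))
          = \<epsilon> h g (fst X) \<star> (fmor (\<phi> h) (p g) \<star> (fmor (\<phi> h) ?m \<star> snd X h))"
        using Comp_assoc[OF m ta hp] Comp_assoc[OF m Comp_arr[OF ta hp] e] a(5)[OF g h] pm[OF gh]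
          Comp_assoc[OF x(3)[OF h] hm hp] action_Comp[OF h m a(7)[OF g]] pm[OF g] x(4)[OF h g] by simp
    qed
  qed
  then show "arr E X A ?m" using X a(2) m by (simp add: arr_E)
qed

text \<open>The unit is equivariant and can be moved inside the average; what is averaged is then
  the identity.\<close>

lemma ind_retraction:
  assumes X: "X \<in> Obj E" and A: "induced (fst X) A i p"
  shows "arr E A X (ind_retraction X A p)"
    and "ind_retraction X A p \<star> ind_unit X A i = Ident T (fst X)"
proof -
  interpret E: category E by (rule E_category)
  note a = inducedD[OF A] and s = struct_inv_D[OF X act.one_closed]
  note sp = Comp_arr[OF a(7)[OF act.one_closed] s(1)]
  show "arr E A X (ind_retraction X A p)"
    unfolding ind_retraction_def by (rule average_arr_E[OF a(2) X sp])
  have "ind_retraction X A p \<star> ind_unit X A i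
      = average X X ((struct_inv X \<one>\<^bsub>G\<^esub> \<star> p \<one>\<^bsub>G\<^esub>) \<star> ind_unit X A i)"
    unfolding ind_retraction_def by (rule average_Comp_right[OF ind_unit(1)[OF X A] sp X, symmetric])
  also have "(struct_inv X \<one>\<^bsub>G\<^esub> \<star> p \<one>\<^bsub>G\<^esub>) \<star> ind_unit X A i = Ident T (fst X)"
    using Comp_assoc[OF arr_E_D(3)[OF ind_unit(1)[OF X A]] a(7)[OF act.one_closed] s(1)]
      ind_unit(2)[OF X A act.one_closed] s(2) by simp
  also have "average X X (Ident T (fst X)) = Ident T (fst X)"
    using average_equivariant E.Ident_arr[OF X] by simp
  finally show "ind_retraction X A p \<star> ind_unit X A i = Ident T (fst X)" .
qed

lemma ind_unit_natural:
  assumes f: "arr E X Y f" and A: "induced (fst X) A i p" and B: "induced (fst Y) B j q"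
  shows "ind_mor A p B j f \<star> ind_unit X A i = ind_unit Y B j \<star> f"
proof -
  note fE = arr_E_D[OF f]
  note uX = ind_unit[OF fE(1) A] and uY = ind_unit[OF fE(2) B] and m = ind_mor[OF A B fE(3)]
  note uXT = arr_E_D(3)[OF uX(1)] and uYT = arr_E_D(3)[OF uY(1)] and mT = arr_E_D(3)[OF m(1)]
  show ?thesis
  proof (rule ind_mor_eqI[OF B Comp_arr[OF uXT mT] Comp_arr[OF fE(3) uYT]])
    fix g assume g: "g \<in> carrier G"
    show "q g \<star> (ind_mor A p B j f \<star> ind_unit X A i) = q g \<star> (ind_unit Y B j \<star> f)"
      using Comp_assoc[OF uXT mT inducedD(7)[OF B g]] m(2)[OF g] uX(2)[OF g] fE(4)[OF g]
        Comp_assoc[OF uXT inducedD(7)[OF A g] action_arr[OF g fE(3)]]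
        Comp_assoc[OF fE(3) uYT inducedD(7)[OF B g]] uY(2)[OF g] by simp
  qed
qed

lemma ind_retraction_natural:
  assumes f: "arr E X Y f" and A: "induced (fst X) A i p" and B: "induced (fst Y) B j q"
  shows "ind_retraction Y B q \<star> ind_mor A p B j f = f \<star> ind_retraction X A p"
proof -
  note fE = arr_E_D[OF f]
  note m = ind_mor[OF A B fE(3)]
  note mT = arr_E_D(3)[OF m(1)]
  note one = act.one_closed
  note pA = inducedD(7)[OF A one] and qB = inducedD(7)[OF B one]
    and sX = struct_inv_D(1)[OF fE(1) one] and sY = struct_inv_D(1)[OF fE(2) one]
  have "ind_retraction Y B q \<star> ind_mor A p B j f
      = average A Y ((struct_inv Y \<one>\<^bsub>G\<^esub> \<star> q \<one>\<^bsub>G\<^esub>) \<star> ind_mor A p B j f)"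
    unfolding ind_retraction_def by (rule average_Comp_right[OF m(1) Comp_arr[OF qB sY] fE(2), symmetric])
  also have "(struct_inv Y \<one>\<^bsub>G\<^esub> \<star> q \<one>\<^bsub>G\<^esub>) \<star> ind_mor A p B j f = f \<star> (struct_inv X \<one>\<^bsub>G\<^esub> \<star> p \<one>\<^bsub>G\<^esub>)"
    using Comp_assoc[OF mT qB sY] m(2)[OF one] Comp_assoc[OF pA action_arr[OF one fE(3)] sY]
      struct_inv_natural[OF f one] Comp_assoc[OF pA sX fE(3)] by simp
  also have "average A Y \<dots> = f \<star> ind_retraction X A p"
    unfolding ind_retraction_def by (rule average_Comp_left[OF f Comp_arr[OF pA sX] inducedD(2)[OF A]])
  finally show ?thesis .
qed

end

section \<open>The triangulation\<close>

locale equivariant_triangulated = equivariant_setting k T S G \<phi> \<epsilon> + triangulated_order2 T S \<Delta>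
  for k :: "('k, 'r) ring_scheme" and T :: "('k, 'o, 'm) cat" (structure)
    and S :: "('o, 'm, 'o, 'm) cfunctor" and \<Delta> :: "('o, 'm) triangle set"
    and G :: "('g, 'b) monoid_scheme"
    and \<phi> :: "'g \<Rightarrow> ('o, 'm, 'o, 'm) cfunctor" and \<epsilon> :: "'g \<Rightarrow> 'g \<Rightarrow> 'o \<Rightarrow> 'm" +
  assumes action_exact: "g \<in> carrier G \<Longrightarrow> exact_functor T S \<Delta> (\<phi> g)"
    and idem_complete: "idempotent_complete T"
begin

abbreviation "\<Delta>E \<equiv> equivariant_distinguished T S \<Delta> G \<phi> \<epsilon>"

lemma DeltaE_iff: "Triangle X Y Z f g h \<in> \<Delta>E \<longleftrightarrow>
    arr E X Y f \<and> arr E Y Z g \<and> arr E Z (fobj SE X) h \<and> Triangle (fst X) (fst Y) (fst Z) f g h \<in> \<Delta>"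
  by (auto simp: equivariant_distinguished_def)

lemma action_distinguished:
  assumes g: "g \<in> carrier G" and t: "Triangle X Y Z f f' f'' \<in> \<Delta>"
  shows "Triangle (fobj (\<phi> g) X) (fobj (\<phi> g) Y) (fobj (\<phi> g) Z)
    (fmor (\<phi> g) f) (fmor (\<phi> g) f') (fmor (\<phi> g) f'') \<in> \<Delta>"
  using action_exact[OF g] t unfolding exact_functor_def functor_triangle_def by force

text \<open>Underneath the equivariant structure lies the direct sum over \<open>g\<close> of the
  images of the given triangle under the exact functors \<open>\<phi> g\<close>, with projections
  and inclusions as the resolution.\<close>

lemma ind_triangle:
  assumes t: "Triangle X Y Z f g h \<in> \<Delta>"
    and A: "induced X A i p" and B: "induced Y B j q" and C: "induced Z C l r"
  shows "Triangle A B C (ind_mor A p B j f) (ind_mor B q C l g)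
    (ind_mor C r (fobj SE A) (\<lambda>g. fmor S (i g)) h) \<in> \<Delta>E"
proof -
  note fgh = distinguished_arr[OF t] and SA = induced_shift[OF A]
  note F = ind_mor[OF A B fgh(1)] and G' = ind_mor[OF B C fgh(2)] and H = ind_mor[OF C SA fgh(3)]
  note a = inducedD[OF A] and b = inducedD[OF B] and c = inducedD[OF C]
  have "Triangle (fst A) (fst B) (fst C) (ind_mor A p B j f) (ind_mor B q C l g)
      (ind_mor C r (fobj SE A) (\<lambda>g. fmor S (i g)) h) \<in> \<Delta>"
  proof (rule distinguished_by_resolution[OF finite_G _ action_distinguished[OF _ t]])
    show "is_triangle T S (Triangle (fst A) (fst B) (fst C) (ind_mor A p B j f) (ind_mor B q C l g)
        (ind_mor C r (fobj SE A) (\<lambda>g. fmor S (i g)) h))"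
      using arr_E_D(3)[OF F(1)] arr_E_D(3)[OF G'(1)] arr_E_D(3)[OF H(1)] by simp
  qed (use a(6,7) b(6,7) c(6,7) F(2,3) G'(2,3) H(2,3) biproductD(6)[OF a(4)] biproductD(6)[OF b(4)]
      biproductD(6)[OF c(4)] in auto)
  then show ?thesis using F(1) G'(1) H(1) by (simp add: DeltaE_iff)
qed

section \<open>Retracts and compression of arrows to them\<close>

definition retract :: "'o \<times> ('g \<Rightarrow> 'm) \<Rightarrow> 'o \<times> ('g \<Rightarrow> 'm) \<Rightarrow> 'm \<Rightarrow> 'm \<Rightarrow> bool" where
  "retract X A i r \<longleftrightarrow> arr E X A i \<and> arr E A X r \<and> r \<star> i = Ident T (fst X)"

lemma retractD:
  assumes "retract X A i r"
  shows "arr E X A i" "arr E A X r" "r \<star> i = Ident T (fst X)"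
    and "arr T (fst X) (fst A) i" "arr T (fst A) (fst X) r"
  using assms arr_E_D(3) unfolding retract_def by auto

lemma retract_idempotent:
  assumes "retract X A i r"
  shows "arr E A A (i \<star> r)" "(i \<star> r) \<star> (i \<star> r) = i \<star> r"
proof -
  note R = retractD[OF assms]
  show "arr E A A (i \<star> r)" by (rule Comp_arr_E[OF R(2,1)])
  show "(i \<star> r) \<star> (i \<star> r) = i \<star> r"
    using Comp_assoc[OF Comp_arr[OF R(5,4)] R(5,4)] Comp_assoc[OF R(5,4,5)] R(3) Ident_Comp[OF R(5)] by simp
qed

lemma retract_shift:
  assumes "retract X A i r"
  shows "retract (fobj SE X) (fobj SE A) (fmor S i) (fmor S r)"
  using retractD[OF assms] SE_arr shift_Comp[OF retractD(4,5)[OF assms]]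
    shift_Ident[OF arr_source[OF retractD(4)[OF assms]]]
  unfolding retract_def by simp

lemma split_idempotent_E:
  assumes "arr E A A e" "e \<star> e = e"
  obtains X i r where "retract X A i r" "i \<star> r = e"
  using E_idempotent_complete[OF idem_complete] assms
  unfolding idempotent_complete_def retract_def by fastforce

text \<open>The compression of \<open>f\<close> to direct summands. Compatibility with composition
  requires absorbing the idempotent in between, whence the commutation premise \<open>comm\<close>
  in the lemmas that follow.\<close>

definition cut :: "'m \<Rightarrow> 'm \<Rightarrow> 'm \<Rightarrow> 'm" where
  "cut r f i = r \<star> (f \<star> i)"

lemma cut_arr:
  assumes "retract X A i r" "retract Y B j q" "arr E A B f"
  shows "arr E X Y (cut q f i)"
  unfolding cut_def by (rule Comp_arr_E[OF Comp_arr_E[OF retractD(1)[OF assms(1)] assms(3)] retractD(2)[OF assms(2)]])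

lemma cut_inclusion:
  assumes X: "retract X A i r" and Y: "retract Y B j q" and f: "arr E A B f"
    and comm: "(j \<star> q) \<star> f = f \<star> (i \<star> r)"
  shows "j \<star> cut q f i = f \<star> i"
proof -
  note x = retractD[OF X] and y = retractD[OF Y] and fT = arr_E_D(3)[OF f]
  have "j \<star> cut q f i = (f \<star> (i \<star> r)) \<star> i"
    unfolding cut_def using Comp_assoc[OF Comp_arr[OF x(4) fT] y(5,4)]
      Comp_assoc[OF x(4) fT Comp_arr[OF y(5,4)]] comm by simp
  also have "\<dots> = f \<star> i"
    using Comp_assoc[OF x(4) Comp_arr[OF x(5,4)] fT] Comp_assoc[OF x(4,5,4)] x(3) Comp_Ident[OF x(4)] by simp
  finally show ?thesis .
qed

lemma cut_retraction:
  assumes X: "retract X A i r" and Y: "retract Y B j q" and f: "arr E A B f"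
    and comm: "(j \<star> q) \<star> f = f \<star> (i \<star> r)"
  shows "cut q f i \<star> r = q \<star> f"
proof -
  note x = retractD[OF X] and y = retractD[OF Y] and fT = arr_E_D(3)[OF f]
  have "cut q f i \<star> r = q \<star> ((j \<star> q) \<star> f)"
    unfolding cut_def comm using Comp_assoc[OF x(5) Comp_arr[OF x(4) fT] y(5)] Comp_assoc[OF x(5,4) fT] by simp
  also have "\<dots> = q \<star> f"
    using Comp_assoc[OF fT Comp_arr[OF y(5,4)] y(5)] Comp_assoc[OF y(5,4,5)] y(3) Ident_Comp[OF y(5)] by simp
  finally show ?thesis .
qed

lemma cut_Comp:
  assumes X: "retract X A i r" and Y: "retract Y B j q" and Z: "retract Z C l s"
    and f: "arr E A B f" and g: "arr E B C g" and comm: "(j \<star> q) \<star> f = f \<star> (i \<star> r)"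
  shows "cut s g j \<star> cut q f i = cut s (g \<star> f) i"
proof -
  note x = retractD[OF X] and y = retractD[OF Y] and z = retractD[OF Z]
    and fT = arr_E_D(3)[OF f] and gT = arr_E_D(3)[OF g] and cT = arr_E_D(3)[OF cut_arr[OF X Y f]]
  show ?thesis
    using Comp_assoc[OF cT Comp_arr[OF y(4) gT] z(5)] Comp_assoc[OF cT y(4) gT] cut_inclusion[OF X Y f comm]
      Comp_assoc[OF x(4) fT gT] by (simp add: cut_def)
qed

lemma cut_shift:
  assumes X: "retract X A i r" and Y: "retract Y B j q" and f: "arr E A B f"
  shows "fmor S (cut q f i) = cut (fmor S q) (fmor S f) (fmor S i)"
  unfolding cut_def using retractD[OF X] retractD[OF Y] arr_E_D(3)[OF f]
    shift_Comp[OF Comp_arr[OF retractD(4)[OF X] arr_E_D(3)[OF f]] retractD(5)[OF Y]]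
    shift_Comp[OF retractD(4)[OF X] arr_E_D(3)[OF f]] by simp

text \<open>Inclusions and retractions are morphisms to and from the ambient triangle because its
  arrows commute with the idempotents. They form a resolution with a single member, hence the index
  set \<open>{()}\<close>.\<close>

lemma retract_triangle:
  assumes t: "Triangle A B C f g h \<in> \<Delta>E"
    and X: "retract X A i r" and Y: "retract Y B j q" and Z: "retract Z C l s"
    and mor: "triangle_mor E SE (Triangle A B C f g h) (Triangle A B C f g h) (i \<star> r) (j \<star> q) (l \<star> s)"
  shows "Triangle X Y Z (cut q f i) (cut s g j) (cut (fmor S r) h l) \<in> \<Delta>E"
proof -
  have fgh: "arr E A B f" "arr E B C g" "arr E C (fobj SE A) h"
    and tT: "Triangle (fst A) (fst B) (fst C) f g h \<in> \<Delta>" using t by (auto simp: DeltaE_iff)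
  note x = retractD[OF X] and y = retractD[OF Y] and z = retractD[OF Z]
  note SX = retract_shift[OF X]
  have comm: "(j \<star> q) \<star> f = f \<star> (i \<star> r)" "(l \<star> s) \<star> g = g \<star> (j \<star> q)"
    "(fmor S i \<star> fmor S r) \<star> h = h \<star> (l \<star> s)"
    using mor shift_Comp[OF x(5,4)] by auto
  note arrs = cut_arr[OF X Y fgh(1)] cut_arr[OF Y Z fgh(2)] cut_arr[OF Z SX fgh(3)]
  have xyz: "fst X \<in> Obj T" "fst Y \<in> Obj T" "fst Z \<in> Obj T"
    using x(4) y(4) z(4) by (auto simp: arr_def)
  have "Triangle (fst X) (fst Y) (fst Z) (cut q f i) (cut s g j) (cut (fmor S r) h l) \<in> \<Delta>"
  proof (rule distinguished_by_resolution[where J = "{()}" and a = "\<lambda>_. i" and a' = "\<lambda>_. r"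
        and b = "\<lambda>_. j" and b' = "\<lambda>_. q" and c = "\<lambda>_. l" and c' = "\<lambda>_. s", OF _ _ tT])
    show "is_triangle T S (Triangle (fst X) (fst Y) (fst Z) (cut q f i) (cut s g j) (cut (fmor S r) h l))"
      using arrs[THEN arr_E_D(3)] by simp
    show "triangle_mor T S (Triangle (fst X) (fst Y) (fst Z) (cut q f i) (cut s g j) (cut (fmor S r) h l))
        (Triangle (fst A) (fst B) (fst C) f g h) i j l"
      using x y z cut_inclusion[OF X Y fgh(1) comm(1)] cut_inclusion[OF Y Z fgh(2) comm(2)]
        cut_inclusion[OF Z SX fgh(3) comm(3)] by simp
    show "triangle_mor T S (Triangle (fst A) (fst B) (fst C) f g h)
        (Triangle (fst X) (fst Y) (fst Z) (cut q f i) (cut s g j) (cut (fmor S r) h l)) r q s"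
      using x y z cut_retraction[OF X Y fgh(1) comm(1)] cut_retraction[OF Y Z fgh(2) comm(2)]
        cut_retraction[OF Z SX fgh(3) comm(3)] by simp
    have "(\<Oplus>\<^bsub>Hom T V V\<^esub>j\<in>{()}. Ident T V) = Ident T V" if V: "V \<in> Obj T" for V
    proof -
      interpret H: abelian_group "Hom T V V" by (rule Hom_abelian_group[OF V V])
      show ?thesis using arr_carrier[OF Ident_arr[OF V]] by (simp add: H.finsum_insert H.r_zero)
    qed
    then show "(\<Oplus>\<^bsub>Hom T (fst X) (fst X)\<^esub>j\<in>{()}. r \<star> i) = Ident T (fst X)"
      "(\<Oplus>\<^bsub>Hom T (fst Y) (fst Y)\<^esub>_\<in>{()}. q \<star> j) = Ident T (fst Y)"
      "(\<Oplus>\<^bsub>Hom T (fst Z) (fst Z)\<^esub>_\<in>{()}. s \<star> l) = Ident T (fst Z)"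
      using x(3) y(3) z(3) xyz by simp_all
  qed simp
  then show ?thesis using arrs by (simp add: DeltaE_iff)
qed

section \<open>Equivariant splitting of corrected idempotents\<close>

lemma idem_lift_arr_E:
  assumes c: "arr E A A c"
  shows "arr E A A (idem_lift (fst A) c)"
proof -
  note cc = Comp_arr_E[OF c c]
  note ccc = Comp_arr_E[OF cc c]
  have "arr E A A ((c \<star> c) \<ominus>\<^bsub>Hom T (fst A) (fst A)\<^esub> (c \<star> (c \<star> c)))"
    unfolding a_minus_def by (rule add_arr_E[OF cc uminus_arr_E[OF ccc]])
  then show ?thesis unfolding idem_lift_def by (intro add_arr_E cc)
qed

lemma forgetful_triangle_mor:
  assumes "triangle_mor E SE s t a b c"
  shows "triangle_mor T S (functor_triangle forgetful s) (functor_triangle forgetful t) a b c"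
  using assms arr_E_D(3) by (cases s; cases t) auto

lemma triangle_mor_idem_lift_E:
  assumes t: "Triangle A B C f g h \<in> \<Delta>E"
    and mor: "triangle_mor E SE (Triangle A B C f g h) (Triangle A B C f g h) a b c"
  shows "triangle_mor E SE (Triangle A B C f g h) (Triangle A B C f g h)
    (idem_lift (fst A) a) (idem_lift (fst B) b) (idem_lift (fst C) c)"
proof -
  have "is_triangle T S (Triangle (fst A) (fst B) (fst C) f g h)"
    using t distinguished_is_triangle by (simp only: DeltaE_iff)
  from triangle_mor_idem_lift[OF this] forgetful_triangle_mor[OF mor]
  have "triangle_mor T S (Triangle (fst A) (fst B) (fst C) f g h) (Triangle (fst A) (fst B) (fst C) f g h)
    (idem_lift (fst A) a) (idem_lift (fst B) b) (idem_lift (fst C) c)" by simp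
  then show ?thesis using mor idem_lift_arr_E by simp
qed

text \<open>The polynomial leaves the idempotents \<open>a\<close> and \<open>b\<close> as they are,
  so only the third component changes. The equation for \<open>l \<star> s\<close> is exported
  because the fourth triangle of an octahedron has to be corrected consistently with the other
  three.\<close>

lemma triangle_mor_split_E:
  assumes t: "Triangle A B C f g h \<in> \<Delta>E"
    and mor: "triangle_mor E SE (Triangle A B C f g h) (Triangle A B C f g h) a b c"
    and a: "a \<star> a = a" and b: "b \<star> b = b"
  obtains Z l s where "retract Z C l s" "l \<star> s = idem_lift (fst C) c"
    "triangle_mor E SE (Triangle A B C f g h) (Triangle A B C f g h) a b (l \<star> s)"
proof -
  have abc: "arr E A A a" "arr E B B b" "arr E C C c" using mor by auto
  have tT: "Triangle (fst A) (fst B) (fst C) f g h \<in> \<Delta>" using t by (simp only: DeltaE_iff)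
  have idem: "idem_lift (fst C) c \<star> idem_lift (fst C) c = idem_lift (fst C) c"
    using distinguished_idem_lift_idempotent[OF tT _ a b] forgetful_triangle_mor[OF mor] by simp
  obtain Z l s where Z: "retract Z C l s" "l \<star> s = idem_lift (fst C) c"
    by (rule split_idempotent_E[OF idem_lift_arr_E[OF abc(3)] idem])
  moreover have "triangle_mor E SE (Triangle A B C f g h) (Triangle A B C f g h) a b (l \<star> s)"
    using triangle_mor_idem_lift_E[OF t mor] idem_lift_idem[OF arr_E_D(3)[OF abc(1)] a]
      idem_lift_idem[OF arr_E_D(3)[OF abc(2)] b] Z(2) by simp
  ultimately show thesis using that by blast
qed

lemma ind_retract:
  assumes "X \<in> Obj E" "induced (fst X) A i p"
  shows "retract X A (ind_unit X A i) (ind_retraction X A p)"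
  using ind_unit(1)[OF assms] ind_retraction[OF assms] by (simp add: retract_def)

text \<open>The given \<open>f\<close> is recovered literally, not up to isomorphism, as the
  existence axioms prescribe their base. The second equation makes the two idempotents an
  endomorphism of the induced base. Both rest on the naturality of unit and retraction.\<close>

lemma ind_cut:
  assumes f: "arr E X Y f" and A: "induced (fst X) A i p" and B: "induced (fst Y) B j q"
  shows "cut (ind_retraction Y B q) (ind_mor A p B j f) (ind_unit X A i) = f"
    and "(ind_unit Y B j \<star> ind_retraction Y B q) \<star> ind_mor A p B j f
      = ind_mor A p B j f \<star> (ind_unit X A i \<star> ind_retraction X A p)"
proof -
  note fE = arr_E_D[OF f]
  note x = retractD[OF ind_retract[OF fE(1) A]] and y = retractD[OF ind_retract[OF fE(2) B]]
  note m = arr_E_D(3)[OF ind_mor(1)[OF A B fE(3)]]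
  show "cut (ind_retraction Y B q) (ind_mor A p B j f) (ind_unit X A i) = f"
    unfolding cut_def
    using Comp_assoc[OF x(4) m y(5)] ind_retraction_natural[OF f A B] Comp_assoc[OF x(4,5) fE(3)] x(3)
      Comp_Ident[OF fE(3)] by simp
  show "(ind_unit Y B j \<star> ind_retraction Y B q) \<star> ind_mor A p B j f
      = ind_mor A p B j f \<star> (ind_unit X A i \<star> ind_retraction X A p)"
    using Comp_assoc[OF m y(5,4)] ind_retraction_natural[OF f A B] Comp_assoc[OF x(5) fE(3) y(4)]
      ind_unit_natural[OF f A B] Comp_assoc[OF x(5,4) m] by simp
qed

section \<open>Triangulation axioms of order 2\<close>

lemma iso_arr_E_D: "iso_arr E X Y f \<Longrightarrow> iso_arr T (fst X) (fst Y) f"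
  unfolding iso_arr_def using arr_E_D(3) by fastforce

lemma forgetful_triangle_in_Delta: "t \<in> \<Delta>E \<Longrightarrow> functor_triangle forgetful t \<in> \<Delta>"
  by (simp add: equivariant_distinguished_def)

lemma DeltaE_is_triangle: "t \<in> \<Delta>E \<Longrightarrow> is_triangle E SE t"
  by (simp add: equivariant_distinguished_def)

lemma forgetful_is_triangle: "is_triangle E SE t \<Longrightarrow> is_triangle T S (functor_triangle forgetful t)"
  by (cases t) (auto dest: arr_E_D(3))

lemma E_axiom_1a:
  assumes s: "is_triangle E SE s" and t: "t \<in> \<Delta>E" and iso: "triangle_iso E SE s t"
  shows "s \<in> \<Delta>E"
proof -
  have "triangle_iso T S (functor_triangle forgetful s) (functor_triangle forgetful t)"
  proof (cases s; cases t)
    fix X Y Z f g h X' Y' Z' f' g' h'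
    assume [simp]: "s = Triangle X Y Z f g h" "t = Triangle X' Y' Z' f' g' h'"
    obtain a b c where abc: "iso_arr E X X' a" "iso_arr E Y Y' b" "iso_arr E Z Z' c"
      and mor: "triangle_mor E SE s t a b c" using iso by auto
    show ?thesis
      using abc[THEN iso_arr_E_D] forgetful_triangle_mor[OF mor]
      by simp blast
  qed
  with axiom_1a[OF forgetful_is_triangle[OF s] forgetful_triangle_in_Delta[OF t]] s
  show ?thesis by (simp add: equivariant_distinguished_def)
qed

lemma E_axiom_1b:
  assumes N: "zero_object E N" and X: "X \<in> Obj E"
  shows "Triangle N X X \<zero>\<^bsub>Hom E N X\<^esub> (Ident E X) \<zero>\<^bsub>Hom E X (fobj SE N)\<^esub> \<in> \<Delta>E"
proof -
  interpret E: category E by (rule E_category)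
  have NO: "N \<in> Obj E" using N by (simp add: zero_object_def)
  show ?thesis
    using zero_arr_E[OF NO X] zero_arr_E[OF X SE_obj[OF NO]] E.Ident_arr[OF X]
      axiom_1b[OF zero_object_E[OF N] Obj_E_D(1)[OF X]] by (simp add: DeltaE_iff)
qed

lemma E_axiom_1c:
  assumes t: "is_triangle E SE t"
  shows "t \<in> \<Delta>E \<longleftrightarrow> rotate_triangle E SE t \<in> \<Delta>E"
proof (cases t)
  case [simp]: (Triangle X Y Z f g h)
  have arrs: "arr E X Y f" "arr E Y Z g" "arr E Z (fobj SE X) h" using t by auto
  note Sf = SE_arr[OF arrs(1)]
  have "rotate_triangle T S (functor_triangle forgetful t) = functor_triangle forgetful (rotate_triangle E SE t)"
    by (simp add: E_uminus[OF Sf])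
  moreover have "is_triangle E SE (rotate_triangle E SE t)"
    using arrs uminus_arr_E[OF Sf] by (simp add: E_uminus[OF Sf])
  ultimately show ?thesis
    using axiom_1c[OF forgetful_is_triangle[OF t]] t by (simp add: equivariant_distinguished_def)
qed

lemma E_axiom_3:
  assumes s: "s \<in> \<Delta>E" and t: "t \<in> \<Delta>E" and base: "triangle_base_mor E s t a b"
  shows "\<exists>c. triangle_mor E SE s t a b c"
proof (cases s; cases t)
  fix X Y Z f g h X' Y' Z' f' g' h'
  assume st: "s = Triangle X Y Z f g h" "t = Triangle X' Y' Z' f' g' h'"
  have ab: "arr E X X' a" "arr E Y Y' b" using base st by auto
  have "triangle_base_mor T (functor_triangle forgetful s) (functor_triangle forgetful t) a b"
    using base st arr_E_D(3) by auto
  from axiom_3[OF forgetful_triangle_in_Delta[OF s] forgetful_triangle_in_Delta[OF t] this]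
  obtain c where "triangle_mor T S (functor_triangle forgetful s) (functor_triangle forgetful t) a b c" ..
  then have "triangle_mor E SE s t (average X X' a) (average Y Y' b) (average Z Z' c)"
    using average_triangle_mor DeltaE_is_triangle[OF s] DeltaE_is_triangle[OF t] unfolding st by blast
  \<comment> \<open>Being equivariant, \<open>a\<close> and \<open>b\<close> are their own averages,
    so the averaged triple still extends the given base.\<close>
  then show ?thesis using average_equivariant ab by metis
qed

lemma E_axiom_2:
  assumes f: "arr E X Y f"
  shows "\<exists>Z g h. Triangle X Y Z f g h \<in> \<Delta>E"
proof -
  note fE = arr_E_D[OF f]
  \<comment> \<open>This \<open>Z\<close> comes without structure isomorphisms; it enters only
    through the object \<open>C\<close> induced from it.\<close>
  obtain Z g h where t: "Triangle (fst X) (fst Y) Z f g h \<in> \<Delta>" using axiom_2[OF fE(3)] by blast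
  have Z: "Z \<in> Obj T" using distinguished_arr[OF t] by (simp add: arr_def)
  obtain A i p where A: "induced (fst X) A i p" using ex_induced[OF Obj_E_D(1)[OF fE(1)]] by blast
  obtain B j q where B: "induced (fst Y) B j q" using ex_induced[OF Obj_E_D(1)[OF fE(2)]] by blast
  obtain C l r where C: "induced Z C l r" using ex_induced[OF Z] by blast
  let ?g = "ind_mor B q C l g" and ?h = "ind_mor C r (fobj SE A) (\<lambda>g. fmor S (i g)) h"
  let ?t = "Triangle A B C (ind_mor A p B j f) ?g ?h"
  have t': "?t \<in> \<Delta>E" by (rule ind_triangle[OF t A B C])
  note RX = ind_retract[OF fE(1) A] and RY = ind_retract[OF fE(2) B]
  let ?a = "ind_unit X A i \<star> ind_retraction X A p" and ?b = "ind_unit Y B j \<star> ind_retraction Y B q"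
  have "triangle_base_mor E ?t ?t ?a ?b"
    using retract_idempotent(1)[OF RX] retract_idempotent(1)[OF RY] ind_cut(2)[OF f A B] by simp
  from E_axiom_3[OF t' t' this] obtain c where c: "triangle_mor E SE ?t ?t ?a ?b c" ..
  obtain Z' l' s' where "retract Z' C l' s'" "triangle_mor E SE ?t ?t ?a ?b (l' \<star> s')"
    by (rule triangle_mor_split_E[OF t' c retract_idempotent(2)[OF RX] retract_idempotent(2)[OF RY]])
  from retract_triangle[OF t' RX RY this] show ?thesis unfolding ind_cut(1)[OF f A B] by blast
qed

lemma E_triangulated_order2: "triangulated_order2 E SE \<Delta>E"
  by (intro triangulated_order2.intro E_suspended triangulated_order2_axioms.intro)
    (fact DeltaE_is_triangle E_axiom_1a E_axiom_1b E_axiom_1c E_axiom_2 E_axiom_3)+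

section \<open>Octahedra and the axioms of order 3\<close>

lemma forgetful_distinguished_octahedron:
  assumes "distinguished_octahedron E SE \<Delta>E (Octahedron s1 s2 s3 s4)"
  shows "distinguished_octahedron T S \<Delta> (Octahedron (functor_triangle forgetful s1)
    (functor_triangle forgetful s2) (functor_triangle forgetful s3) (functor_triangle forgetful s4))"
proof (cases s1; cases s2; cases s3; cases s4)
  fix X Y Z1 f x x1 X' Z Y1 k y y1 Y' Z' X1 g z r Z1' Y1' X1' u v w
  assume eq: "s1 = Triangle X Y Z1 f x x1" "s2 = Triangle X' Z Y1 k y y1"
    "s3 = Triangle Y' Z' X1 g z r" "s4 = Triangle Z1' Y1' X1' u v w"
  have "s1 \<in> \<Delta>E" "s2 \<in> \<Delta>E" "s3 \<in> \<Delta>E" "s4 \<in> \<Delta>E"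
    using assms by (simp_all add: distinguished_octahedron_def)
  note D = this[THEN forgetful_triangle_in_Delta]
  with D[THEN distinguished_is_triangle] assms show ?thesis
    unfolding distinguished_octahedron_def eq by simp
qed

lemma E_axiom_5:
  assumes ord3: "triangulated_order3 T S \<Delta>"
    and s: "distinguished_octahedron E SE \<Delta>E s" and t: "distinguished_octahedron E SE \<Delta>E t"
    and base: "octahedron_base_mor E s t a b c"
  shows "\<exists>a1 b1 c1. octahedron_mor E SE s t a b c a1 b1 c1"
proof -
  \<comment> \<open>The datatype lists the vertices of the four triangles independently; being
    distinguished identifies the repetitions, so one name per vertex suffices.\<close>
  have shape: "\<exists>X Y Z X1 Y1 Z1 f g k x x1 y y1 z r u v w. o' = Octahedron
      (Triangle X Y Z1 f x x1) (Triangle X Z Y1 k y y1) (Triangle Y Z X1 g z r) (Triangle Z1 Y1 X1 u v w)"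
    if "distinguished_octahedron E SE \<Delta>E o'" for o'
  proof (cases o')
    case (Octahedron s1 s2 s3 s4)
    with that show ?thesis
      by (cases s1; cases s2; cases s3; cases s4) (auto simp: distinguished_octahedron_def)
  qed
  obtain X Y Z X1 Y1 Z1 f g k x x1 y y1 z r u v w where s_eq: "s = Octahedron
      (Triangle X Y Z1 f x x1) (Triangle X Z Y1 k y y1) (Triangle Y Z X1 g z r) (Triangle Z1 Y1 X1 u v w)"
    using shape[OF s] by blast
  obtain X' Y' Z' X1' Y1' Z1' f' g' k' x' x1' y' y1' z' r' u' v' w' where t_eq: "t = Octahedron
      (Triangle X' Y' Z1' f' x' x1') (Triangle X' Z' Y1' k' y' y1') (Triangle Y' Z' X1' g' z' r')
      (Triangle Z1' Y1' X1' u' v' w')"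
    using shape[OF t] by blast
  have abc: "arr E X X' a" "arr E Y Y' b" "arr E Z Z' c" and comm: "b \<star> f = f' \<star> a" "c \<star> g = g' \<star> b"
    using base by (auto simp: octahedron_base_mor_def s_eq t_eq)
  have tri: "is_triangle E SE (Triangle X Y Z1 f x x1)" "is_triangle E SE (Triangle X Z Y1 k y y1)"
    "is_triangle E SE (Triangle Y Z X1 g z r)" "is_triangle E SE (Triangle Z1 Y1 X1 u v w)"
    using s by (auto simp: s_eq distinguished_octahedron_def)
  have tri': "is_triangle E SE (Triangle X' Y' Z1' f' x' x1')" "is_triangle E SE (Triangle X' Z' Y1' k' y' y1')"
    "is_triangle E SE (Triangle Y' Z' X1' g' z' r')" "is_triangle E SE (Triangle Z1' Y1' X1' u' v' w')"
    using t by (auto simp: t_eq distinguished_octahedron_def)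
  note Us = forgetful_distinguished_octahedron[OF s[unfolded s_eq]]
    and Ut = forgetful_distinguished_octahedron[OF t[unfolded t_eq]]
  have Ubase: "octahedron_base_mor T
      (Octahedron (functor_triangle forgetful (Triangle X Y Z1 f x x1)) (functor_triangle forgetful (Triangle X Z Y1 k y y1))
        (functor_triangle forgetful (Triangle Y Z X1 g z r)) (functor_triangle forgetful (Triangle Z1 Y1 X1 u v w)))
      (Octahedron (functor_triangle forgetful (Triangle X' Y' Z1' f' x' x1')) (functor_triangle forgetful (Triangle X' Z' Y1' k' y' y1'))
        (functor_triangle forgetful (Triangle Y' Z' X1' g' z' r')) (functor_triangle forgetful (Triangle Z1' Y1' X1' u' v' w')))
      a b c"
    using abc[THEN arr_E_D(3)] comm by (simp add: octahedron_base_mor_def)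
  from triangulated_order3.axiom_5[OF ord3 Us Ut Ubase] obtain a1 b1 c1 where
    "triangle_mor T S (functor_triangle forgetful (Triangle X Y Z1 f x x1))
      (functor_triangle forgetful (Triangle X' Y' Z1' f' x' x1')) a b c1"
    "triangle_mor T S (functor_triangle forgetful (Triangle X Z Y1 k y y1))
      (functor_triangle forgetful (Triangle X' Z' Y1' k' y' y1')) a c b1"
    "triangle_mor T S (functor_triangle forgetful (Triangle Y Z X1 g z r))
      (functor_triangle forgetful (Triangle Y' Z' X1' g' z' r')) b c a1"
    "triangle_mor T S (functor_triangle forgetful (Triangle Z1 Y1 X1 u v w))
      (functor_triangle forgetful (Triangle Z1' Y1' X1' u' v' w')) c1 b1 a1"
    unfolding octahedron_mor.simps by blast
  \<comment> \<open>Every component lies in two of the triangles, and its average depends only on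
    the component and its two ends. The four averaged triangle morphisms therefore agree where they
    overlap.\<close>
  note m = this[THEN average_triangle_mor[rotated 2]]
  have "octahedron_mor E SE s t a b c (average X1 X1' a1) (average Y1 Y1' b1) (average Z1 Z1' c1)"
    using m(1)[OF tri(1) tri'(1)] m(2)[OF tri(2) tri'(2)] m(3)[OF tri(3) tri'(3)] m(4)[OF tri(4) tri'(4)]
    unfolding s_eq t_eq octahedron_mor.simps abc[THEN average_equivariant] by blast
  then show ?thesis by blast
qed

text \<open>Beyond the case of a single triangle, three new vertices have to be cut out compatibly.
  Each lies in one of the first three triangles, whose base components are idempotent, and this
  makes its corrected endomorphism idempotent. The fourth triangle contributes only
  commutation.\<close>

lemma E_axiom_4:
  assumes ord3: "triangulated_order3 T S \<Delta>" and f: "arr E X Y f" and g: "arr E Y Z g"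
  shows "\<exists>t. distinguished_octahedron E SE \<Delta>E t \<and> octahedron_base t = (X, Y, Z, f, g)"
proof -
  interpret T3: triangulated_order3 T S \<Delta> by (rule ord3)
  note fE = arr_E_D[OF f] and gE = arr_E_D[OF g]
  obtain t where t: "distinguished_octahedron T S \<Delta> t" "octahedron_base t = (fst X, fst Y, fst Z, f, g)"
    using T3.axiom_4[OF fE(3) gE(3)] by blast
  have "\<exists>X1 Y1 Z1 x x1 y y1 z r u v. t = Octahedron
      (Triangle (fst X) (fst Y) Z1 f x x1) (Triangle (fst X) (fst Z) Y1 (g \<star> f) y y1)
      (Triangle (fst Y) (fst Z) X1 g z r) (Triangle Z1 Y1 X1 u v (fmor S x \<star> r)) \<and>
      u \<star> x = y \<star> g \<and> y1 \<star> u = x1 \<and> v \<star> y = z \<and> fmor S f \<star> y1 = r \<star> v"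
  proof (cases t)
    case (Octahedron s1 s2 s3 s4)
    with t show ?thesis
      by (cases s1; cases s2; cases s3; cases s4) (auto simp: distinguished_octahedron_def)
  qed
  then obtain X1 Y1 Z1 x x1 y y1 z r u v where t_eq: "t = Octahedron
      (Triangle (fst X) (fst Y) Z1 f x x1) (Triangle (fst X) (fst Z) Y1 (g \<star> f) y y1)
      (Triangle (fst Y) (fst Z) X1 g z r) (Triangle Z1 Y1 X1 u v (fmor S x \<star> r))"
    and eqs: "u \<star> x = y \<star> g" "y1 \<star> u = x1" "v \<star> y = z" "fmor S f \<star> y1 = r \<star> v" by blast
  have D: "Triangle (fst X) (fst Y) Z1 f x x1 \<in> \<Delta>" "Triangle (fst X) (fst Z) Y1 (g \<star> f) y y1 \<in> \<Delta>"
    "Triangle (fst Y) (fst Z) X1 g z r \<in> \<Delta>" "Triangle Z1 Y1 X1 u v (fmor S x \<star> r) \<in> \<Delta>"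
    using t(1) by (auto simp: t_eq distinguished_octahedron_def)
  note d1 = distinguished_arr[OF D(1)] and d2 = distinguished_arr[OF D(2)]
    and d3 = distinguished_arr[OF D(3)] and d4 = distinguished_arr[OF D(4)]
  obtain A iA pA where A: "induced (fst X) A iA pA" using ex_induced[OF arr_source[OF d1(1)]] by blast
  obtain B iB pB where B: "induced (fst Y) B iB pB" using ex_induced[OF arr_source[OF d1(2)]] by blast
  obtain C iC pC where C: "induced (fst Z) C iC pC" using ex_induced[OF arr_source[OF d2(2)]] by blast
  obtain A1 iA1 pA1 where A1: "induced X1 A1 iA1 pA1" using ex_induced[OF arr_source[OF d3(3)]] by blast
  obtain B1 iB1 pB1 where B1: "induced Y1 B1 iB1 pB1" using ex_induced[OF arr_source[OF d2(3)]] by blast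
  obtain C1 iC1 pC1 where C1: "induced Z1 C1 iC1 pC1" using ex_induced[OF arr_source[OF d1(3)]] by blast
  note SA = induced_shift[OF A] and SB = induced_shift[OF B] and SC1 = induced_shift[OF C1]
  define F Gg K where "F = ind_mor A pA B iB f" and "Gg = ind_mor B pB C iC g"
    and "K = ind_mor A pA C iC (g \<star> f)"
  define Fx Fx1 where "Fx = ind_mor B pB C1 iC1 x"
    and "Fx1 = ind_mor C1 pC1 (fobj SE A) (\<lambda>g. fmor S (iA g)) x1"
  define Fy Fy1 where "Fy = ind_mor C pC B1 iB1 y"
    and "Fy1 = ind_mor B1 pB1 (fobj SE A) (\<lambda>g. fmor S (iA g)) y1"
  define Fz Fr where "Fz = ind_mor C pC A1 iA1 z"
    and "Fr = ind_mor A1 pA1 (fobj SE B) (\<lambda>g. fmor S (iB g)) r"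
  define Fu Fv Fw where "Fu = ind_mor C1 pC1 B1 iB1 u" and "Fv = ind_mor B1 pB1 A1 iA1 v"
    and "Fw = ind_mor A1 pA1 (fobj SE C1) (\<lambda>g. fmor S (iC1 g)) (fmor S x \<star> r)"
  let ?t1 = "Triangle A B C1 F Fx Fx1" and ?t2 = "Triangle A C B1 K Fy Fy1"
    and ?t3 = "Triangle B C A1 Gg Fz Fr" and ?t4 = "Triangle C1 B1 A1 Fu Fv Fw"
  have t1: "?t1 \<in> \<Delta>E" unfolding F_def Fx_def Fx1_def by (rule ind_triangle[OF D(1) A B C1])
  have t2: "?t2 \<in> \<Delta>E" unfolding K_def Fy_def Fy1_def by (rule ind_triangle[OF D(2) A C B1])
  have t3: "?t3 \<in> \<Delta>E" unfolding Gg_def Fz_def Fr_def by (rule ind_triangle[OF D(3) B C A1])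
  have t4: "?t4 \<in> \<Delta>E" unfolding Fu_def Fv_def Fw_def by (rule ind_triangle[OF D(4) C1 B1 A1])
  have a1: "arr E A B F" "arr E B C1 Fx" "arr E C1 (fobj SE A) Fx1" using t1 by (simp_all add: DeltaE_iff)
  have a2: "arr E A C K" "arr E C B1 Fy" "arr E B1 (fobj SE A) Fy1" using t2 by (simp_all add: DeltaE_iff)
  have a3: "arr E B C Gg" "arr E C A1 Fz" "arr E A1 (fobj SE B) Fr" using t3 by (simp_all add: DeltaE_iff)
  have a4: "arr E C1 B1 Fu" "arr E B1 A1 Fv" "arr E A1 (fobj SE C1) Fw" using t4 by (simp_all add: DeltaE_iff)
  have Sf: "fmor S F = ind_mor (fobj SE A) (\<lambda>g. fmor S (pA g)) (fobj SE B) (\<lambda>g. fmor S (iB g)) (fmor S f)"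
    unfolding F_def by (rule ind_mor_shift[OF A B d1(1), symmetric])
  have Sx: "fmor S Fx = ind_mor (fobj SE B) (\<lambda>g. fmor S (pB g)) (fobj SE C1) (\<lambda>g. fmor S (iC1 g)) (fmor S x)"
    unfolding Fx_def by (rule ind_mor_shift[OF B C1 d1(2), symmetric])
  \<comment> \<open>Induction respects composition and the shift, so each relation of the octahedron
    passes to the induced arrows.\<close>
  have oct: "K = Gg \<star> F" "Fu \<star> Fx = Fy \<star> Gg" "Fy1 \<star> Fu = Fx1" "Fv \<star> Fy = Fz"
    "Fw = fmor S Fx \<star> Fr" "fmor S F \<star> Fy1 = Fr \<star> Fv"
    using ind_mor_Comp[OF A B C d1(1) d3(1)] ind_mor_Comp[OF B C1 B1 d1(2) d4(1)]
      ind_mor_Comp[OF B C B1 d3(1) d2(2)] ind_mor_Comp[OF C1 B1 SA d4(1) d2(3)]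
      ind_mor_Comp[OF C B1 A1 d2(2) d4(2)] ind_mor_Comp[OF A1 SB SC1 d3(3) shift_arr[OF d1(2)]]
      ind_mor_Comp[OF B1 SA SB d2(3) shift_arr[OF d1(1)]] ind_mor_Comp[OF B1 A1 SB d4(2) d3(3)] eqs
    unfolding Sf Sx
    by (simp_all add: F_def Gg_def K_def Fx_def Fx1_def Fy_def Fy1_def Fz_def Fr_def Fu_def Fv_def Fw_def)
  let ?o = "Octahedron ?t1 ?t2 ?t3 ?t4"
  have o: "distinguished_octahedron E SE \<Delta>E ?o"
    using t1 t2 t3 t4 a1 a2 a3 a4 oct by (simp add: distinguished_octahedron_def)
  note RX = ind_retract[OF fE(1) A] and RY = ind_retract[OF fE(2) B] and RZ = ind_retract[OF gE(2) C]
  define i\<^sub>X r\<^sub>X i\<^sub>Y r\<^sub>Y i\<^sub>Z r\<^sub>Z where "i\<^sub>X = ind_unit X A iA" and "r\<^sub>X = ind_retraction X A pA"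
    and "i\<^sub>Y = ind_unit Y B iB" and "r\<^sub>Y = ind_retraction Y B pB"
    and "i\<^sub>Z = ind_unit Z C iC" and "r\<^sub>Z = ind_retraction Z C pC"
  note ir = i\<^sub>X_def[symmetric] r\<^sub>X_def[symmetric] i\<^sub>Y_def[symmetric] r\<^sub>Y_def[symmetric]
    i\<^sub>Z_def[symmetric] r\<^sub>Z_def[symmetric]
  note RX = RX[unfolded ir] and RY = RY[unfolded ir] and RZ = RZ[unfolded ir]
  note cutF = ind_cut[OF f A B, folded F_def, unfolded ir] and cutG = ind_cut[OF g B C, folded Gg_def, unfolded ir]
  have "octahedron_base_mor E ?o ?o (i\<^sub>X \<star> r\<^sub>X) (i\<^sub>Y \<star> r\<^sub>Y) (i\<^sub>Z \<star> r\<^sub>Z)"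
    using retract_idempotent(1)[OF RX] retract_idempotent(1)[OF RY] retract_idempotent(1)[OF RZ]
      cutF(2) cutG(2) by (simp add: octahedron_base_mor_def)
  from E_axiom_5[OF ord3 o o this] obtain a b c where
    m: "triangle_mor E SE ?t1 ?t1 (i\<^sub>X \<star> r\<^sub>X) (i\<^sub>Y \<star> r\<^sub>Y) c"
      "triangle_mor E SE ?t2 ?t2 (i\<^sub>X \<star> r\<^sub>X) (i\<^sub>Z \<star> r\<^sub>Z) b"
      "triangle_mor E SE ?t3 ?t3 (i\<^sub>Y \<star> r\<^sub>Y) (i\<^sub>Z \<star> r\<^sub>Z) a" "triangle_mor E SE ?t4 ?t4 c b a"
    unfolding octahedron_mor.simps by blast
  note idem = retract_idempotent(2)[OF RX] retract_idempotent(2)[OF RY] retract_idempotent(2)[OF RZ]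
  obtain Z1' ic rc where RZ1: "retract Z1' C1 ic rc" and ic: "ic \<star> rc = idem_lift (fst C1) c"
    and m1: "triangle_mor E SE ?t1 ?t1 (i\<^sub>X \<star> r\<^sub>X) (i\<^sub>Y \<star> r\<^sub>Y) (ic \<star> rc)"
    by (rule triangle_mor_split_E[OF t1 m(1) idem(1,2)])
  obtain Y1' ib rb where RY1: "retract Y1' B1 ib rb" and ib: "ib \<star> rb = idem_lift (fst B1) b"
    and m2: "triangle_mor E SE ?t2 ?t2 (i\<^sub>X \<star> r\<^sub>X) (i\<^sub>Z \<star> r\<^sub>Z) (ib \<star> rb)"
    by (rule triangle_mor_split_E[OF t2 m(2) idem(1,3)])
  obtain X1' ia ra where RX1: "retract X1' A1 ia ra" and ia: "ia \<star> ra = idem_lift (fst A1) a"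
    and m3: "triangle_mor E SE ?t3 ?t3 (i\<^sub>Y \<star> r\<^sub>Y) (i\<^sub>Z \<star> r\<^sub>Z) (ia \<star> ra)"
    by (rule triangle_mor_split_E[OF t3 m(3) idem(2,3)])
  have m4: "triangle_mor E SE ?t4 ?t4 (ic \<star> rc) (ib \<star> rb) (ia \<star> ra)"
    unfolding ia ib ic by (rule triangle_mor_idem_lift_E[OF t4 m(4)])
  note s1 = retract_triangle[OF t1 RX RY RZ1 m1] and s2 = retract_triangle[OF t2 RX RZ RY1 m2]
    and s3 = retract_triangle[OF t3 RY RZ RX1 m3] and s4 = retract_triangle[OF t4 RZ1 RY1 RX1 m4]
  note RSX = retract_shift[OF RX] and RSY = retract_shift[OF RY] and RSZ1 = retract_shift[OF RZ1]
  have S_ir: "fmor S (i\<^sub>X \<star> r\<^sub>X) = fmor S i\<^sub>X \<star> fmor S r\<^sub>X" "fmor S (i\<^sub>Y \<star> r\<^sub>Y) = fmor S i\<^sub>Y \<star> fmor S r\<^sub>Y"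
    using shift_Comp[OF retractD(5,4)[OF RX]] shift_Comp[OF retractD(5,4)[OF RY]] by simp_all
  \<comment> \<open>\<open>cut_Comp\<close> asks for commutation of the inner arrow only: one
    equation for each arrow that comes first in a composite of \<open>oct'\<close>.\<close>
  have comm: "(i\<^sub>Y \<star> r\<^sub>Y) \<star> F = F \<star> (i\<^sub>X \<star> r\<^sub>X)" "(ic \<star> rc) \<star> Fx = Fx \<star> (i\<^sub>Y \<star> r\<^sub>Y)"
    "(i\<^sub>Z \<star> r\<^sub>Z) \<star> Gg = Gg \<star> (i\<^sub>Y \<star> r\<^sub>Y)" "(ib \<star> rb) \<star> Fu = Fu \<star> (ic \<star> rc)"
    "(ib \<star> rb) \<star> Fy = Fy \<star> (i\<^sub>Z \<star> r\<^sub>Z)" "(fmor S i\<^sub>Y \<star> fmor S r\<^sub>Y) \<star> Fr = Fr \<star> (ia \<star> ra)"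
    "(fmor S i\<^sub>X \<star> fmor S r\<^sub>X) \<star> Fy1 = Fy1 \<star> (ib \<star> rb)" "(ia \<star> ra) \<star> Fv = Fv \<star> (ib \<star> rb)"
    using m1 m2 m3 m4 S_ir by simp_all
  have oct':
    "cut r\<^sub>Z K i\<^sub>X = cut r\<^sub>Z Gg i\<^sub>Y \<star> cut r\<^sub>Y F i\<^sub>X"
    "cut rb Fu ic \<star> cut rc Fx i\<^sub>Y = cut rb Fy i\<^sub>Z \<star> cut r\<^sub>Z Gg i\<^sub>Y"
    "cut (fmor S r\<^sub>X) Fy1 ib \<star> cut rb Fu ic = cut (fmor S r\<^sub>X) Fx1 ic"
    "cut ra Fv ib \<star> cut rb Fy i\<^sub>Z = cut ra Fz i\<^sub>Z"
    "cut (fmor S rc) Fw ia = fmor S (cut rc Fx i\<^sub>Y) \<star> cut (fmor S r\<^sub>Y) Fr ia"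
    "fmor S (cut r\<^sub>Y F i\<^sub>X) \<star> cut (fmor S r\<^sub>X) Fy1 ib = cut (fmor S r\<^sub>Y) Fr ia \<star> cut ra Fv ib"
    using cut_Comp[OF RX RY RZ a1(1) a3(1) comm(1)] cut_Comp[OF RY RZ1 RY1 a1(2) a4(1) comm(2)]
      cut_Comp[OF RY RZ RY1 a3(1) a2(2) comm(3)] cut_Comp[OF RZ1 RY1 RSX a4(1) a2(3) comm(4)]
      cut_Comp[OF RZ RY1 RX1 a2(2) a4(2) comm(5)]
      cut_Comp[OF RX1 RSY RSZ1 a3(3) SE_arr[OF a1(2)] comm(6)]
      cut_Comp[OF RY1 RSX RSY a2(3) SE_arr[OF a1(1)] comm(7)]
      cut_Comp[OF RY1 RX1 RSY a4(2) a3(3) comm(8)] oct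
      cut_shift[OF RY RZ1 a1(2)] cut_shift[OF RX RY a1(1)] by simp_all
  let ?s = "Octahedron (Triangle X Y Z1' (cut r\<^sub>Y F i\<^sub>X) (cut rc Fx i\<^sub>Y) (cut (fmor S r\<^sub>X) Fx1 ic))
    (Triangle X Z Y1' (cut r\<^sub>Z K i\<^sub>X) (cut rb Fy i\<^sub>Z) (cut (fmor S r\<^sub>X) Fy1 ib))
    (Triangle Y Z X1' (cut r\<^sub>Z Gg i\<^sub>Y) (cut ra Fz i\<^sub>Z) (cut (fmor S r\<^sub>Y) Fr ia))
    (Triangle Z1' Y1' X1' (cut rb Fu ic) (cut ra Fv ib) (cut (fmor S rc) Fw ia))"
  have "is_octahedron E SE ?s"
    using s1[THEN DeltaE_is_triangle] s2[THEN DeltaE_is_triangle] s3[THEN DeltaE_is_triangle]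
      s4[THEN DeltaE_is_triangle] oct' unfolding is_octahedron.simps E_simps SE_simps by blast
  then have "distinguished_octahedron E SE \<Delta>E ?s"
    using s1 s2 s3 s4 unfolding distinguished_octahedron_def octahedron_triangles.simps by blast
  moreover have "octahedron_base ?s = (X, Y, Z, f, g)" using cutF(1) cutG(1) by simp
  ultimately show ?thesis by blast
qed

lemma E_triangulated_order3:
  assumes "triangulated_order3 T S \<Delta>"
  shows "triangulated_order3 E SE \<Delta>E"
  by (intro triangulated_order3.intro E_triangulated_order2 triangulated_order3_axioms.intro)
    (fact E_axiom_4[OF assms] E_axiom_5[OF assms])+

end

theorem theorem6p9:
  fixes k :: "('k, 'r) ring_scheme"
    and T :: "('k, 'o, 'm) cat"
    and S :: "('o, 'm, 'o, 'm) cfunctor"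
    and \<Delta> :: "('o, 'm) triangle set"
    and G :: "('g, 'b) monoid_scheme"
    and \<phi> :: "'g \<Rightarrow> ('o, 'm, 'o, 'm) cfunctor"
    and \<epsilon> :: "'g \<Rightarrow> 'g \<Rightarrow> 'o \<Rightarrow> 'm"
  assumes "suspended_category T S"
    and "linear_category k T"
    and "idempotent_complete T"
    and "right_action T G \<phi> \<epsilon>"
    and "finite (carrier G)"
    and "\<And>g. g \<in> carrier G \<Longrightarrow> exact_functor T S \<Delta> (\<phi> g)"
    and "action_commutes_with_shift T S G \<epsilon>"
    and "add_pow k (order G) \<one>\<^bsub>k\<^esub> \<in> Units k"
  shows "(triangulated_order2 T S \<Delta> \<longrightarrow>
           triangulated_order2 (equivariant_category T G \<phi> \<epsilon>) (equivariant_shift S G)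
             (equivariant_distinguished T S \<Delta> G \<phi> \<epsilon>)) \<and>
         (triangulated_order3 T S \<Delta> \<longrightarrow>
           triangulated_order3 (equivariant_category T G \<phi> \<epsilon>) (equivariant_shift S G)
             (equivariant_distinguished T S \<Delta> G \<phi> \<epsilon>))"
proof -
  have setting: "equivariant_setting k T S G \<phi> \<epsilon>"
    using assms by (intro equivariant_setting.intro equivariant_setting_axioms.intro)
      (auto simp: exact_functor_def)
  \<comment> \<open>A triangulation of order 3 contains one of order 2, so this single instance
    serves both claims.\<close>
  have triangulated: "equivariant_triangulated k T S \<Delta> G \<phi> \<epsilon>" if "triangulated_order2 T S \<Delta>"
    using setting that assms(3,6)
    by (intro equivariant_triangulated.intro equivariant_triangulated_axioms.intro)
  show ?thesis
    using equivariant_triangulated.E_triangulated_order2[OF triangulated]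
      equivariant_triangulated.E_triangulated_order3[OF triangulated] triangulated_order3.axioms(1)
    by blast
qed

end
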